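(* Let $u\in\mathcal S(\mathbb R)$ with $\|u\|_{L^2(\mathbb R)}=1$ be fixed, and for $\alpha\in\mathbb R$ let $H_\alpha=M_x+\alpha\langle\cdot,u\rangle u$ on $L^2(\mathbb R)$. Let $\alpha_0,\lambda_0\in\mathbb R$. Then: (a) The operator $H_{\alpha_0}$ has $\lambda_0$ as an eigenvalue if and only if $u(\lambda_0)=0$ and $1+\alpha_0\gamma(|u|^2,\lambda_0)=0$. In this case $\lambda_0$ is a simple eigenvalue with eigenvector $$\phi(x)=\begin{cases}\dfrac{u(x)}{x-\lambda_0}&\text{if }x\ne\lambda_0,\\ u'(\lambda_0)&\text{if }x=\lambda_0.\end{cases}$$ (b) Suppose $u$ vanishes only at $x=\lambda_0$ and $1+\alpha_0\gamma(|u|^2,\lambda_0)=0$. Then $\mathcal H_{\mathrm{ac}}(H_{\alpha_0})=\{\phi\}^\perp$, and $\mathcal H_{\mathrm{ac}}(H_\alpha)=L^2(\mathbb R)$ for all $\alpha\ne\alpha_0$.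
   Context: The inner product is linear in its first argument. $M_x$ is the self-adjoint operator of multiplication by $x$ on $L^2(\mathbb R)$ with domain $\{f\in L^2(\mathbb R):\int|xf(x)|^2dx<\infty\}$; $H_\alpha$ is self-adjoint on the same domain. $\mathcal H_{\mathrm{ac}}(T)$ is the absolutely continuous subspace of a self-adjoint operator $T$. For $f\in\mathcal S(\mathbb R)$, $\lambda\in\mathbb R$, $\gamma(f,\lambda)=\lim_{\epsilon\to0^+}\int_{|x-\lambda|\ge\epsilon}\frac{f(x)}{x-\lambda}\,dx$ (Cauchy principal value). A simple eigenvalue is one with one-dimensional eigenspace. *)

theory Defs
  imports "HOL-Analysis.Analysis"
begin

text \<open>
  Elements of the Hilbert space are represented by functions; two representatives
  denote the same element iff they agree almost everywhere.  All notions below are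
  invariant under this relation, so sets of functions stand for sets of classes.
\<close>

type_synonym cfun = "real \<Rightarrow> complex"

definition L2 :: "cfun set" where
  "L2 = {f \<in> borel_measurable lborel. integrable lborel (\<lambda>x. (cmod (f x))\<^sup>2)}"

definition ae_eq :: "cfun \<Rightarrow> cfun \<Rightarrow> bool" where
  "ae_eq f g \<longleftrightarrow> (AE x in lborel. f x = g x)"

definition l2_inner :: "cfun \<Rightarrow> cfun \<Rightarrow> complex" where
  "l2_inner f g = (LINT x|lborel. f x * cnj (g x))"

definition l2_norm :: "cfun \<Rightarrow> real" where
  "l2_norm f = sqrt (LINT x|lborel. (cmod (f x))\<^sup>2)"

definition orth_compl :: "cfun \<Rightarrow> cfun set" where
  "orth_compl g = {f \<in> L2. l2_inner f g = 0}"

definition vderiv :: "cfun \<Rightarrow> cfun" where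
  "vderiv f = (\<lambda>x. vector_derivative f (at x))"

definition schwartz :: "cfun \<Rightarrow> bool" where
  "schwartz f \<longleftrightarrow>
     (\<forall>n x. (vderiv ^^ n) f differentiable (at x)) \<and>
     (\<forall>n k. \<exists>C. \<forall>x. \<bar>x\<bar> ^ k * cmod ((vderiv ^^ n) f x) \<le> C)"

text \<open>For Schwartz functions the limit exists, so \<open>Lim\<close> is the actual limit.\<close>

definition pv_gamma :: "cfun \<Rightarrow> real \<Rightarrow> complex" where
  "pv_gamma f l =
     Lim (at_right 0) (\<lambda>\<epsilon>. LINT x:{x. \<epsilon> \<le> \<bar>x - l\<bar>}|lborel. f x / complex_of_real (x - l))"

text \<open>
  An operator is a pair of its domain and its action; values of the action outside the
  domain are irrelevant.
\<close>

type_synonym l2_op = "cfun set \<times> (cfun \<Rightarrow> cfun)"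

definition eigenspace :: "l2_op \<Rightarrow> complex \<Rightarrow> cfun set" where
  "eigenspace T l = {f \<in> fst T. ae_eq (snd T f) (\<lambda>x. l * f x)}"

definition eigenvector :: "l2_op \<Rightarrow> complex \<Rightarrow> cfun \<Rightarrow> bool" where
  "eigenvector T l f \<longleftrightarrow> f \<in> eigenspace T l \<and> \<not> ae_eq f (\<lambda>x. 0)"

definition eigenvalue :: "l2_op \<Rightarrow> complex \<Rightarrow> bool" where
  "eigenvalue T l \<longleftrightarrow> (\<exists>f. eigenvector T l f)"

definition simple_eigenvalue :: "l2_op \<Rightarrow> complex \<Rightarrow> bool" where
  "simple_eigenvalue T l \<longleftrightarrow>
     (\<exists>f. eigenvector T l f \<and> (\<forall>g \<in> eigenspace T l. \<exists>c. ae_eq g (\<lambda>x. c * f x)))"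

definition mult_x :: l2_op where
  "mult_x = ({f \<in> L2. integrable lborel (\<lambda>x. (cmod (of_real x * f x))\<^sup>2)}, \<lambda>f x. of_real x * f x)"

definition H_op :: "cfun \<Rightarrow> real \<Rightarrow> l2_op" where
  "H_op u \<alpha> = (fst mult_x, \<lambda>f x. snd mult_x f x + of_real \<alpha> * l2_inner f u * u x)"

definition orth_projection :: "(cfun \<Rightarrow> cfun) \<Rightarrow> bool" where
  "orth_projection P \<longleftrightarrow>
     (\<forall>f\<in>L2. P f \<in> L2) \<and>
     (\<forall>f\<in>L2. \<forall>g\<in>L2. ae_eq f g \<longrightarrow> ae_eq (P f) (P g)) \<and>
     (\<forall>f\<in>L2. \<forall>g\<in>L2. \<forall>a b. ae_eq (P (\<lambda>x. a * f x + b * g x)) (\<lambda>x. a * P f x + b * P g x)) \<and>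
     (\<forall>f\<in>L2. ae_eq (P (P f)) (P f)) \<and>
     (\<forall>f\<in>L2. \<forall>g\<in>L2. l2_inner (P f) g = l2_inner f (P g))"

definition proj_valued_measure :: "(real set \<Rightarrow> cfun \<Rightarrow> cfun) \<Rightarrow> bool" where
  "proj_valued_measure E \<longleftrightarrow>
     (\<forall>B\<in>sets borel. orth_projection (E B)) \<and>
     (\<forall>f\<in>L2. ae_eq (E {} f) (\<lambda>x. 0)) \<and>
     (\<forall>f\<in>L2. ae_eq (E UNIV f) f) \<and>
     (\<forall>A\<in>sets borel. \<forall>B\<in>sets borel. \<forall>f\<in>L2. ae_eq (E (A \<inter> B) f) (E A (E B f))) \<and>
     (\<forall>A. range A \<subseteq> sets borel \<longrightarrow> disjoint_family A \<longrightarrow>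
        (\<forall>f\<in>L2. (\<lambda>n. l2_norm (\<lambda>x. E (\<Union>i. A i) f x - (\<Sum>i<n. E (A i) f x))) \<longlonglongrightarrow> 0))"

text \<open>
  The measure \<open>B \<mapsto> \<langle>E(B)f, f\<rangle>\<close>.  The real part only changes the type: the inner product is
  a nonnegative real, as \<open>E(B)\<close> is an orthogonal projection.
\<close>

definition scalar_measure :: "(real set \<Rightarrow> cfun \<Rightarrow> cfun) \<Rightarrow> cfun \<Rightarrow> real measure" where
  "scalar_measure E f = measure_of UNIV (sets borel) (\<lambda>B. ennreal (Re (l2_inner (E B f) f)))"

text \<open>
  \<open>T = \<integral> t dE(t)\<close>, including equality of domains.  The quadratic form
  \<open>\<langle>Tf, f\<rangle> = \<integral> t d\<langle>E(t)f, f\<rangle>\<close> on the domain determines \<open>T\<close> by polarization.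
\<close>

definition spectral_resolution :: "(real set \<Rightarrow> cfun \<Rightarrow> cfun) \<Rightarrow> l2_op \<Rightarrow> bool" where
  "spectral_resolution E T \<longleftrightarrow>
     proj_valued_measure E \<and>
     fst T = {f \<in> L2. integrable (scalar_measure E f) (\<lambda>t. t\<^sup>2)} \<and>
     (\<forall>f\<in>fst T. l2_inner (snd T f) f = of_real (LINT t|scalar_measure E f. t))"

text \<open>
  For self-adjoint \<open>T\<close> the spectral theorem provides a spectral resolution, unique up to
  equality almost everywhere; the existential quantifier just names it.
\<close>

definition H_ac :: "l2_op \<Rightarrow> cfun set" where
  "H_ac T = {f \<in> L2. \<exists>E. spectral_resolution E T \<and> absolutely_continuous lborel (scalar_measure E f)}"

end

(* The vector u is cyclic for H = H_alpha as soon as u vanishes only on a null set, and then the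
   Cayley transform V of H makes (V^n u) a stationary sequence.  Herglotz's theorem (Fejer means and
   Helly selection) gives a measure M on the circle with the same Gram matrix as the functions z^n,
   and closing up the correspondence of z^n with V^n u yields a unitary from L2(M) onto L2(R) that
   turns H into multiplication by a real function c.  Its surjectivity uses that a subspace invariant
   under V and V^-1 containing u is invariant under the resolvents of M_x; both density statements
   come from Stone-Weierstrass on the circle.

   The Borel transforms F of |u|^2 and s of the image of M under c satisfy s = F / (1 + alpha F), so
   Im s <= 1 / (alpha^2 Im F).  Where |u|^2 is bounded below this bounds the spectral measure of short
   intervals by a multiple of their length.  The only possible singular part is therefore an atom at
   the zero l of u, and that atom is an eigenspace, which part (a) describes by solving
   (x - l) f = - alpha <f, u> u.  Conversely, for an arbitrary spectral resolution E the quadratic form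
   shows that an eigenvector is fixed by E {l}, so it is orthogonal to the absolutely continuous subspace. *)

theory Submission
  imports "HOL-Probability.Probability" Defs
begin

section \<open>Square-integrable functions\<close>

definition L2on :: "'a measure \<Rightarrow> ('a \<Rightarrow> complex) set" where
  "L2on M = {f \<in> borel_measurable M. integrable M (\<lambda>x. (cmod (f x))\<^sup>2)}"

definition ip :: "'a measure \<Rightarrow> ('a \<Rightarrow> complex) \<Rightarrow> ('a \<Rightarrow> complex) \<Rightarrow> complex" where
  "ip M f g = (LINT x|M. f x * cnj (g x))"

definition nsq :: "'a measure \<Rightarrow> ('a \<Rightarrow> complex) \<Rightarrow> real" where
  "nsq M f = (LINT x|M. (cmod (f x))\<^sup>2)"

definition l2_tendsto :: "'a measure \<Rightarrow> (nat \<Rightarrow> 'a \<Rightarrow> complex) \<Rightarrow> ('a \<Rightarrow> complex) \<Rightarrow> bool" where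
  "l2_tendsto M F f \<longleftrightarrow> (\<lambda>n. nsq M (\<lambda>x. F n x - f x)) \<longlonglongrightarrow> 0"

lemma measurable_cnj [measurable (raw)]:
  "f \<in> borel_measurable M \<Longrightarrow> (\<lambda>x. cnj (f x)) \<in> borel_measurable M"
  by (rule measurable_compose[OF _ borel_measurable_continuous_onI]) (auto intro: continuous_intros)

lemma L2onD:
  assumes "f \<in> L2on M"
  shows "f \<in> borel_measurable M" "integrable M (\<lambda>x. (cmod (f x))\<^sup>2)"
  using assms by (auto simp: L2on_def)

lemma cmod_lincomb_sq_le:
  "(cmod (a * x + b * y))\<^sup>2 \<le> 2 * (cmod a)\<^sup>2 * (cmod x)\<^sup>2 + 2 * (cmod b)\<^sup>2 * (cmod y)\<^sup>2"
proof -
  have "(cmod (a * x + b * y))\<^sup>2 \<le> (cmod a * cmod x + cmod b * cmod y)\<^sup>2"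
    by (intro power_mono) (auto intro: norm_triangle_le simp: norm_mult)
  also have "\<dots> \<le> 2 * (cmod a)\<^sup>2 * (cmod x)\<^sup>2 + 2 * (cmod b)\<^sup>2 * (cmod y)\<^sup>2"
    using sum_squares_bound[of "cmod a * cmod x" "cmod b * cmod y"]
    by (simp add: power2_sum power_mult_distrib algebra_simps)
  finally show ?thesis .
qed

lemma L2on_lincomb:
  assumes "f \<in> L2on M" "g \<in> L2on M"
  shows "(\<lambda>x. a * f x + b * g x) \<in> L2on M"
proof -
  note [measurable] = L2onD(1)[OF assms(1)] L2onD(1)[OF assms(2)]
  have "integrable M (\<lambda>x. 2 * (cmod a)\<^sup>2 * (cmod (f x))\<^sup>2 + 2 * (cmod b)\<^sup>2 * (cmod (g x))\<^sup>2)"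
    using L2onD(2)[OF assms(1)] L2onD(2)[OF assms(2)] by auto
  then have "integrable M (\<lambda>x. (cmod (a * f x + b * g x))\<^sup>2)"
    by (rule Bochner_Integration.integrable_bound) (auto intro!: AE_I2 order_trans[OF cmod_lincomb_sq_le])
  then show ?thesis by (simp add: L2on_def)
qed

lemma L2on_zero: "(\<lambda>x. 0) \<in> L2on M"
  by (simp add: L2on_def)

lemma L2on_scale: "f \<in> L2on M \<Longrightarrow> (\<lambda>x. a * f x) \<in> L2on M"
  using L2on_lincomb[of f M f a 0] by simp

lemma L2on_diff: "f \<in> L2on M \<Longrightarrow> g \<in> L2on M \<Longrightarrow> (\<lambda>x. f x - g x) \<in> L2on M"
  using L2on_lincomb[of f M g 1 "-1"] by simp

lemma L2on_prod:
  assumes "f \<in> L2on M" "g \<in> L2on M"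
  shows "integrable M (\<lambda>x. f x * cnj (g x))"
proof -
  note [measurable] = L2onD(1)[OF assms(1)] L2onD(1)[OF assms(2)]
  have "integrable M (\<lambda>x. (cmod (f x))\<^sup>2 + (cmod (g x))\<^sup>2)"
    using L2onD(2)[OF assms(1)] L2onD(2)[OF assms(2)] by auto
  then show ?thesis
  proof (rule Bochner_Integration.integrable_bound)
    show "AE x in M. norm (f x * cnj (g x)) \<le> norm ((cmod (f x))\<^sup>2 + (cmod (g x))\<^sup>2)"
    proof (rule AE_I2)
      fix x
      have "0 \<le> (cmod (f x))\<^sup>2 + (cmod (g x))\<^sup>2 - 2 * (cmod (f x) * cmod (g x))"
        using sum_squares_bound[of "cmod (f x)" "cmod (g x)"] by (simp add: mult.assoc)
      moreover have "0 \<le> cmod (f x) * cmod (g x)" by simp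
      ultimately have "cmod (f x) * cmod (g x) \<le> (cmod (f x))\<^sup>2 + (cmod (g x))\<^sup>2"
        by linarith
      then show "norm (f x * cnj (g x)) \<le> norm ((cmod (f x))\<^sup>2 + (cmod (g x))\<^sup>2)"
        by (simp add: norm_mult)
    qed
  qed simp
qed

lemma L2on_mult_bounded:
  assumes "f \<in> L2on M" and [measurable]: "p \<in> borel_measurable M" and p: "\<And>x. cmod (p x) \<le> C"
  shows "(\<lambda>x. p x * f x) \<in> L2on M"
proof -
  note [measurable] = L2onD(1)[OF assms(1)]
  have "integrable M (\<lambda>x. C\<^sup>2 * (cmod (f x))\<^sup>2)"
    using L2onD(2)[OF assms(1)] by auto
  then have "integrable M (\<lambda>x. (cmod (p x * f x))\<^sup>2)"
    by (rule Bochner_Integration.integrable_bound)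
      (auto intro!: AE_I2 mult_right_mono power_mono p simp: norm_mult power_mult_distrib)
  then show ?thesis by (simp add: L2on_def)
qed

lemma L2on_cong_AE:
  assumes "f \<in> L2on M" and [measurable]: "g \<in> borel_measurable M" and eq: "AE x in M. f x = g x"
  shows "g \<in> L2on M"
proof -
  note [measurable] = L2onD(1)[OF assms(1)]
  have "integrable M (\<lambda>x. (cmod (g x))\<^sup>2)"
    using L2onD(2)[OF assms(1)] by (rule integrable_cong_AE_imp) (use eq in auto)
  then show ?thesis by (simp add: L2on_def)
qed

lemma (in finite_measure) L2on_bounded:
  assumes [measurable]: "p \<in> borel_measurable M" and p: "\<And>x. cmod (p x) \<le> C"
  shows "p \<in> L2on M"
proof -
  have "(\<lambda>x. 1) \<in> L2on M" by (simp add: L2on_def)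
  from L2on_mult_bounded[OF this assms] show ?thesis by simp
qed

lemma (in finite_measure) L2on_integrable:
  assumes "f \<in> L2on M"
  shows "integrable M f"
  using L2on_prod[OF assms, of "\<lambda>x. 1"] by (simp add: L2on_def)

lemma ip_lincomb_left:
  assumes "f \<in> L2on M" "g \<in> L2on M" "h \<in> L2on M"
  shows "ip M (\<lambda>x. a * f x + b * g x) h = a * ip M f h + b * ip M g h"
  using L2on_prod[OF assms(1,3)] L2on_prod[OF assms(2,3)]
  by (simp add: ip_def distrib_right mult.assoc)

lemma ip_sym: "ip M g f = cnj (ip M f g)"
proof -
  have "ip M g f = (LINT x|M. cnj (f x * cnj (g x)))" by (simp add: ip_def mult.commute)
  also have "\<dots> = cnj (LINT x|M. f x * cnj (g x))" by (rule Bochner_Integration.integral_cnj)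
  finally show ?thesis by (simp add: ip_def)
qed

lemma ip_lincomb_right:
  assumes "f \<in> L2on M" "g \<in> L2on M" "h \<in> L2on M"
  shows "ip M h (\<lambda>x. a * f x + b * g x) = cnj a * ip M h f + cnj b * ip M h g"
  using ip_lincomb_left[OF assms, of a b] ip_sym[of M h] by (metis complex_cnj_add complex_cnj_mult)

lemma ip_scale_left: "ip M (\<lambda>x. a * f x) h = a * ip M f h"
  by (simp add: ip_def mult.assoc)

lemma ip_scale_right: "ip M h (\<lambda>x. a * f x) = cnj a * ip M h f"
  using ip_scale_left[of M a f h] ip_sym[of M h] by (metis complex_cnj_mult)

lemma ip_diff_left:
  assumes "f \<in> L2on M" "g \<in> L2on M" "h \<in> L2on M"
  shows "ip M (\<lambda>x. f x - g x) h = ip M f h - ip M g h"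
  using ip_lincomb_left[OF assms, of 1 "-1"] by simp

lemma ip_self: "ip M f f = of_real (nsq M f)"
  by (simp add: ip_def nsq_def complex_norm_square[symmetric] flip: of_real_power)

lemma nsq_nonneg: "0 \<le> nsq M f"
  by (simp add: nsq_def)

lemma ip_cong_AE:
  assumes [measurable]: "f \<in> borel_measurable M" "f' \<in> borel_measurable M"
    "g \<in> borel_measurable M" "g' \<in> borel_measurable M"
    and eq: "AE x in M. f x = f' x" "AE x in M. g x = g' x"
  shows "ip M f g = ip M f' g'"
  unfolding ip_def by (rule integral_cong_AE) (use eq in auto)

lemma nsq_cong_AE:
  assumes [measurable]: "f \<in> borel_measurable M" "f' \<in> borel_measurable M"
    and eq: "AE x in M. f x = f' x"
  shows "nsq M f = nsq M f'"
  unfolding nsq_def by (rule integral_cong_AE) (use eq in auto)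

lemma nsq_eq_0_iff:
  assumes "f \<in> L2on M"
  shows "nsq M f = 0 \<longleftrightarrow> (AE x in M. f x = 0)"
  unfolding nsq_def by (subst integral_nonneg_eq_0_iff_AE) (auto simp: L2onD[OF assms])

lemma nsq_minus_commute: "nsq M (\<lambda>x. f x - g x) = nsq M (\<lambda>x. g x - f x)"
  by (simp add: nsq_def norm_minus_commute)

lemma nsq_add_le:
  assumes "f \<in> L2on M" "g \<in> L2on M"
  shows "nsq M (\<lambda>x. a * f x + b * g x) \<le> 2 * (cmod a)\<^sup>2 * nsq M f + 2 * (cmod b)\<^sup>2 * nsq M g"
proof -
  have "nsq M (\<lambda>x. a * f x + b * g x)
      \<le> (LINT x|M. 2 * (cmod a)\<^sup>2 * (cmod (f x))\<^sup>2 + 2 * (cmod b)\<^sup>2 * (cmod (g x))\<^sup>2)"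
    unfolding nsq_def
    using L2onD[OF assms(1)] L2onD[OF assms(2)] L2onD[OF L2on_lincomb[OF assms, of a b]]
    by (intro integral_mono cmod_lincomb_sq_le) auto
  also have "\<dots> = 2 * (cmod a)\<^sup>2 * nsq M f + 2 * (cmod b)\<^sup>2 * nsq M g"
    using L2onD[OF assms(1)] L2onD[OF assms(2)] by (simp add: nsq_def)
  finally show ?thesis .
qed

lemma nsq_triangle:
  assumes "f \<in> L2on M" "g \<in> L2on M" "h \<in> L2on M"
  shows "nsq M (\<lambda>x. f x - h x) \<le> 2 * nsq M (\<lambda>x. f x - g x) + 2 * nsq M (\<lambda>x. g x - h x)"
  using nsq_add_le[OF L2on_diff[OF assms(1,2)] L2on_diff[OF assms(2,3)], of 1 1] by simp

lemma nsq_lincomb: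
  assumes "f \<in> L2on M" "g \<in> L2on M"
  shows "nsq M (\<lambda>x. a * f x + b * g x)
    = (cmod a)\<^sup>2 * nsq M f + (cmod b)\<^sup>2 * nsq M g + 2 * Re (a * cnj b * ip M f g)"
proof -
  let ?h = "\<lambda>x. a * f x + b * g x"
  have "complex_of_real (nsq M ?h) = ip M ?h ?h"
    by (rule ip_self[symmetric])
  also have "ip M ?h ?h = a * ip M f ?h + b * ip M g ?h"
    by (rule ip_lincomb_left[OF assms L2on_lincomb[OF assms]])
  also have "\<dots> = a * (cnj a * nsq M f + cnj b * ip M f g) + b * (cnj a * cnj (ip M f g) + cnj b * nsq M g)"
    by (simp only: ip_lincomb_right[OF assms assms(1)] ip_lincomb_right[OF assms assms(2)]
        ip_self ip_sym[of M g f])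
  finally have "nsq M (\<lambda>x. a * f x + b * g x) =
     Re (a * (cnj a * nsq M f + cnj b * ip M f g) + b * (cnj a * cnj (ip M f g) + cnj b * nsq M g))"
    by (metis Re_complex_of_real)
  also have "\<dots> = (cmod a)\<^sup>2 * nsq M f + (cmod b)\<^sup>2 * nsq M g + 2 * Re (a * cnj b * ip M f g)"
    by (simp add: cmod_power2) (simp add: algebra_simps power2_eq_square)
  finally show ?thesis .
qed

lemma ip_cauchy_schwarz:
  assumes "f \<in> L2on M" "g \<in> L2on M"
  shows "(cmod (ip M f g))\<^sup>2 \<le> nsq M f * nsq M g"
proof -
  define w where "w = ip M f g"
  have key: "0 \<le> nsq M f - 2 * t * (cmod w)\<^sup>2 + t\<^sup>2 * (cmod w)\<^sup>2 * nsq M g" for t :: real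
  proof -
    have "0 \<le> nsq M (\<lambda>x. 1 * f x + (- (of_real t * w)) * g x)" by (rule nsq_nonneg)
    also have "\<dots> = nsq M f - 2 * t * (cmod w)\<^sup>2 + t\<^sup>2 * (cmod w)\<^sup>2 * nsq M g"
      unfolding nsq_lincomb[OF assms] w_def[symmetric]
      by (simp add: norm_mult power_mult_distrib cmod_power2) (simp add: power2_eq_square algebra_simps)
    finally show ?thesis .
  qed
  show ?thesis
  proof (cases "w = 0")
    case True
    then show ?thesis using nsq_nonneg[of M f] nsq_nonneg[of M g] by (simp add: w_def)
  next
    case False
    then have w: "0 < (cmod w)\<^sup>2" by simp
    show ?thesis
    proof (cases "nsq M g = 0")
      case True
      have "0 \<le> nsq M f - 2 * ((nsq M f + 1) / (2 * (cmod w)\<^sup>2)) * (cmod w)\<^sup>2"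
        using key[of "(nsq M f + 1) / (2 * (cmod w)\<^sup>2)"] True by simp
      then show ?thesis using w by simp
    next
      case False
      then have g: "0 < nsq M g" using nsq_nonneg[of M g] by linarith
      have "0 \<le> nsq M f - 2 * (1 / nsq M g) * (cmod w)\<^sup>2 + (1 / nsq M g)\<^sup>2 * (cmod w)\<^sup>2 * nsq M g"
        by (rule key)
      also have "\<dots> = nsq M f - (cmod w)\<^sup>2 / nsq M g"
        using g by (simp add: power2_eq_square field_simps)
      finally show ?thesis using g by (simp add: w_def field_simps)
    qed
  qed
qed

lemma l2_tendstoD: "l2_tendsto M F f \<Longrightarrow> (\<lambda>n. nsq M (\<lambda>x. F n x - f x)) \<longlonglongrightarrow> 0"
  by (simp add: l2_tendsto_def)

lemma l2_tendsto_ip_left: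
  assumes "\<And>n. F n \<in> L2on M" "f \<in> L2on M" "g \<in> L2on M" "l2_tendsto M F f"
  shows "(\<lambda>n. ip M (F n) g) \<longlonglongrightarrow> ip M f g"
proof -
  have "(\<lambda>n. sqrt (nsq M (\<lambda>x. F n x - f x) * nsq M g)) \<longlonglongrightarrow> sqrt (0 * nsq M g)"
    by (intro tendsto_intros l2_tendstoD[OF assms(4)])
  then have lim: "(\<lambda>n. sqrt (nsq M (\<lambda>x. F n x - f x) * nsq M g)) \<longlonglongrightarrow> 0" by simp
  have "(\<lambda>n. ip M (F n) g - ip M f g) \<longlonglongrightarrow> 0"
  proof (rule Lim_null_comparison[OF _ lim], rule always_eventually, rule allI)
    fix n
    have "(norm (ip M (F n) g - ip M f g))\<^sup>2 \<le> nsq M (\<lambda>x. F n x - f x) * nsq M g"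
      using ip_cauchy_schwarz[OF L2on_diff[OF assms(1)[of n] assms(2)] assms(3)]
      by (simp add: ip_diff_left[OF assms(1,2,3)])
    then show "norm (ip M (F n) g - ip M f g) \<le> sqrt (nsq M (\<lambda>x. F n x - f x) * nsq M g)"
      by (rule real_le_rsqrt)
  qed
  then show ?thesis by (simp add: LIM_zero_iff)
qed

lemma l2_tendsto_ip_right:
  assumes "\<And>n. F n \<in> L2on M" "f \<in> L2on M" "g \<in> L2on M" "l2_tendsto M F f"
  shows "(\<lambda>n. ip M g (F n)) \<longlonglongrightarrow> ip M g f"
  using tendsto_cnj[OF l2_tendsto_ip_left[OF assms]] by (simp flip: ip_sym)

lemma l2_tendsto_mult_bounded:
  assumes "\<And>n. F n \<in> L2on M" "f \<in> L2on M" and [measurable]: "p \<in> borel_measurable M"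
    and p: "\<And>x. cmod (p x) \<le> C" and lim: "l2_tendsto M F f"
  shows "l2_tendsto M (\<lambda>n x. p x * F n x) (\<lambda>x. p x * f x)"
proof -
  have "(\<lambda>n. C\<^sup>2 * nsq M (\<lambda>x. F n x - f x)) \<longlonglongrightarrow> C\<^sup>2 * 0"
    by (intro tendsto_intros l2_tendstoD[OF lim])
  then have *: "(\<lambda>n. C\<^sup>2 * nsq M (\<lambda>x. F n x - f x)) \<longlonglongrightarrow> 0" by simp
  show ?thesis unfolding l2_tendsto_def
  proof (rule Lim_null_comparison[OF _ *], rule always_eventually, rule allI)
    fix n
    have d: "(\<lambda>x. F n x - f x) \<in> L2on M" using assms by (intro L2on_diff)
    have "nsq M (\<lambda>x. p x * F n x - p x * f x) = nsq M (\<lambda>x. p x * (F n x - f x))"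
      by (simp add: algebra_simps)
    also have "\<dots> \<le> (LINT x|M. C\<^sup>2 * (cmod (F n x - f x))\<^sup>2)"
      unfolding nsq_def using L2onD(2)[OF d] L2onD(2)[OF L2on_mult_bounded[OF d assms(3) p]]
      by (intro integral_mono) (auto simp: norm_mult power_mult_distrib intro!: mult_right_mono power_mono p)
    also have "\<dots> = C\<^sup>2 * nsq M (\<lambda>x. F n x - f x)"
      by (simp add: nsq_def)
    finally show "norm (nsq M (\<lambda>x. p x * F n x - p x * f x)) \<le> C\<^sup>2 * nsq M (\<lambda>x. F n x - f x)"
      by (simp add: nsq_nonneg)
  qed
qed

lemma l2_tendsto_dominated:
  assumes F: "\<And>n. F n \<in> borel_measurable M" and f: "f \<in> borel_measurable M" and g: "g \<in> L2on M"
    and dom: "\<And>n. AE x in M. cmod (F n x) \<le> cmod (g x)"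
    and lim: "AE x in M. (\<lambda>n. F n x) \<longlonglongrightarrow> f x"
  shows "f \<in> L2on M" "\<And>n. F n \<in> L2on M" "l2_tendsto M F f"
proof -
  note [measurable] = F f
  have fdom: "AE x in M. cmod (f x) \<le> cmod (g x)"
  proof -
    have "AE x in M. \<forall>n. cmod (F n x) \<le> cmod (g x)" using dom by (simp add: AE_all_countable)
    with lim show ?thesis
      by eventually_elim (rule LIMSEQ_le_const2[OF tendsto_norm], auto)
  qed
  show "f \<in> L2on M"
    unfolding L2on_def
    using Bochner_Integration.integrable_bound[OF L2onD(2)[OF g], of "\<lambda>x. (cmod (f x))\<^sup>2"] fdom
    by (auto intro!: power_mono)
  show "F n \<in> L2on M" for n
    unfolding L2on_def
    using Bochner_Integration.integrable_bound[OF L2onD(2)[OF g], of "\<lambda>x. (cmod (F n x))\<^sup>2"] dom[of n]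
    by (auto intro!: power_mono)
  have "(\<lambda>n. LINT x|M. (cmod (F n x - f x))\<^sup>2) \<longlonglongrightarrow> (LINT x|M. 0)"
  proof (rule integral_dominated_convergence[where w="\<lambda>x. 4 * (cmod (g x))\<^sup>2"])
    show "integrable M (\<lambda>x. 4 * (cmod (g x))\<^sup>2)" using L2onD(2)[OF g] by simp
    show "AE x in M. (\<lambda>n. (cmod (F n x - f x))\<^sup>2) \<longlonglongrightarrow> 0"
      using lim
    proof eventually_elim
      case (elim x)
      then have "(\<lambda>n. (cmod (F n x - f x))\<^sup>2) \<longlonglongrightarrow> (cmod (f x - f x))\<^sup>2"
        by (intro tendsto_intros)
      then show ?case by simp
    qed
    show "AE x in M. norm ((cmod (F n x - f x))\<^sup>2) \<le> 4 * (cmod (g x))\<^sup>2" for n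
      using dom[of n] fdom
    proof eventually_elim
      case (elim x)
      have "cmod (F n x - f x) \<le> 2 * cmod (g x)"
        using norm_triangle_ineq4[of "F n x" "f x"] elim by linarith
      then have "(cmod (F n x - f x))\<^sup>2 \<le> (2 * cmod (g x))\<^sup>2" by (intro power_mono) auto
      then show ?case by (simp add: power_mult_distrib)
    qed
  qed auto
  then show "l2_tendsto M F f" by (simp add: l2_tendsto_def nsq_def)
qed

lemma L2on_complete:
  assumes F: "\<And>n. F n \<in> L2on M"
    and cauchy: "\<And>e. e > 0 \<Longrightarrow> \<exists>N. \<forall>m\<ge>N. \<forall>n\<ge>N. nsq M (\<lambda>x. F m x - F n x) < e"
  obtains f where "f \<in> L2on M" "l2_tendsto M F f"
proof -
  note [measurable] = L2onD(1)[OF F]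
  obtain N where N: "\<And>e m n. e > 0 \<Longrightarrow> m \<ge> N e \<Longrightarrow> n \<ge> N e \<Longrightarrow> nsq M (\<lambda>x. F m x - F n x) < e"
  proof -
    have "\<forall>e. \<exists>N. e > 0 \<longrightarrow> (\<forall>m\<ge>N. \<forall>n\<ge>N. nsq M (\<lambda>x. F m x - F n x) < e)"
      using cauchy by blast
    then obtain N where "\<forall>e. e > 0 \<longrightarrow> (\<forall>m\<ge>N e. \<forall>n\<ge>N e. nsq M (\<lambda>x. F m x - F n x) < e)"
      by (rule choice[THEN exE])
    then show thesis by (intro that[of N]) blast
  qed
  define r where "r = rec_nat (N 1) (\<lambda>k s. max (Suc s) (N ((1/4) ^ Suc k)))"
  have r_Suc: "r (Suc k) = max (Suc (r k)) (N ((1/4) ^ Suc k))" for k by (simp add: r_def)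
  have r: "strict_mono r" by (rule strict_monoI_Suc) (simp add: r_Suc)
  have r_ge: "r k \<ge> N ((1/4) ^ k)" for k by (cases k) (simp_all add: r_def)
  define d where "d k x = F (r (Suc k)) x - F (r k) x" for k x
  have dL2: "d k \<in> L2on M" for k unfolding d_def by (intro L2on_diff F)
  note [measurable] = L2onD(1)[OF dL2]
  have d_small: "nsq M (d k) \<le> (1/4) ^ k" for k
  proof -
    have "r (Suc k) \<ge> N ((1/4) ^ k)" using r_ge[of k] r_Suc[of k] by simp
    then show ?thesis unfolding d_def using N[of "(1/4) ^ k" "r (Suc k)" "r k"] r_ge[of k] by force
  qed
  have nn_d: "(\<integral>\<^sup>+x. ennreal ((cmod (d k x))\<^sup>2) \<partial>M) = ennreal (nsq M (d k))" for k
    unfolding nsq_def by (rule nn_integral_eq_integral) (auto simp: L2onD(2)[OF dL2])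
  \<comment> \<open>The weights \<open>2 ^ k\<close> make pointwise summability of the increments follow from a
    geometric bound, so that no triangle inequality for the norm is needed.\<close>
  have "(\<integral>\<^sup>+x. (\<Sum>k. ennreal (2 ^ k * (cmod (d k x))\<^sup>2)) \<partial>M)
      = (\<Sum>k. \<integral>\<^sup>+x. ennreal (2 ^ k * (cmod (d k x))\<^sup>2) \<partial>M)"
    by (rule nn_integral_suminf) simp
  also have "\<dots> = (\<Sum>k. ennreal (2 ^ k * nsq M (d k)))"
    by (simp add: ennreal_mult nn_integral_cmult nn_d nsq_nonneg)
  also have "\<dots> \<le> (\<Sum>k. ennreal ((1/2) ^ k))"
  proof (rule suminf_le)
    fix k
    have "2 ^ k * nsq M (d k) \<le> 2 ^ k * (1/4) ^ k" using d_small by (intro mult_left_mono) auto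
    also have "\<dots> = (1/2) ^ k" by (simp flip: power_mult_distrib)
    finally show "ennreal (2 ^ k * nsq M (d k)) \<le> ennreal ((1/2) ^ k)" by (rule ennreal_leI)
  qed auto
  also have "\<dots> = ennreal (\<Sum>k. (1/2) ^ k)"
    by (rule suminf_ennreal2) (auto intro: summable_geometric)
  finally have "(\<integral>\<^sup>+x. (\<Sum>k. ennreal (2 ^ k * (cmod (d k x))\<^sup>2)) \<partial>M) \<noteq> \<infinity>"
    by (auto simp: top_unique)
  then have "AE x in M. (\<Sum>k. ennreal (2 ^ k * (cmod (d k x))\<^sup>2)) \<noteq> \<infinity>"
    by (intro nn_integral_PInf_AE) auto
  then have AE_conv: "AE x in M. convergent (\<lambda>k. F (r k) x)"
  proof eventually_elim
    case (elim x)
    have sm: "summable (\<lambda>k. 2 ^ k * (cmod (d k x))\<^sup>2)"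
      by (rule summable_suminf_not_top) (use elim in auto)
    then have "(\<lambda>k. 2 ^ k * (cmod (d k x))\<^sup>2) \<longlonglongrightarrow> 0" by (rule summable_LIMSEQ_zero)
    then have "Bseq (\<lambda>k. 2 ^ k * (cmod (d k x))\<^sup>2)" by (rule convergent_imp_Bseq[OF convergentI])
    then obtain C where C: "C > 0" "\<And>k. norm (2 ^ k * (cmod (d k x))\<^sup>2) \<le> C"
      by (auto simp: Bseq_def)
    have le: "cmod (d k x) \<le> sqrt C * (sqrt (1/2)) ^ k" for k
    proof -
      have "2 ^ k * (cmod (d k x))\<^sup>2 \<le> C" using C(2)[of k] by simp
      then have "(cmod (d k x))\<^sup>2 \<le> C * (1/2) ^ k" by (simp add: field_simps power_one_over)
      then have "cmod (d k x) \<le> sqrt (C * (1/2) ^ k)" by (rule real_le_rsqrt)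
      then show ?thesis by (simp only: real_sqrt_mult real_sqrt_power)
    qed
    have "summable (\<lambda>k. sqrt C * (sqrt (1/2)) ^ k)"
      by (intro summable_mult summable_geometric) (simp add: real_sqrt_lt_1_iff)
    then have "summable (\<lambda>k. d k x)" by (rule summable_comparison_test') (rule le)
    then have "convergent (\<lambda>n. \<Sum>k<n. d k x)" by (simp add: summable_iff_convergent)
    then have "convergent (\<lambda>n. (\<Sum>k<n. d k x) + F (r 0) x)" by (intro convergent_add convergent_const)
    moreover have "(\<Sum>k<n. d k x) + F (r 0) x = F (r n) x" for n
      using sum_lessThan_telescope[of "\<lambda>k. F (r k) x" n] by (simp add: d_def)
    ultimately show ?case by simp
  qed
  define f where "f x = lim (\<lambda>k. F (r k) x)" for x
  have [measurable]: "f \<in> borel_measurable M" unfolding f_def by (rule borel_measurable_lim_metric) simp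
  have AE_lim: "AE x in M. (\<lambda>k. F (r k) x) \<longlonglongrightarrow> f x"
    using AE_conv by eventually_elim (simp add: f_def convergent_LIMSEQ_iff)
  have bound: "(\<integral>\<^sup>+x. ennreal ((cmod (F n x - f x))\<^sup>2) \<partial>M) \<le> ennreal e"
    if e: "e > 0" and n: "n \<ge> N e" for n e
  proof -
    have "(\<integral>\<^sup>+x. ennreal ((cmod (F n x - f x))\<^sup>2) \<partial>M)
        = (\<integral>\<^sup>+x. liminf (\<lambda>k. ennreal ((cmod (F n x - F (r k) x))\<^sup>2)) \<partial>M)"
    proof (rule nn_integral_cong_AE)
      show "AE x in M. ennreal ((cmod (F n x - f x))\<^sup>2) = liminf (\<lambda>k. ennreal ((cmod (F n x - F (r k) x))\<^sup>2))"
        using AE_lim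
      proof eventually_elim
        case (elim x)
        have "(\<lambda>k. ennreal ((cmod (F n x - F (r k) x))\<^sup>2)) \<longlonglongrightarrow> ennreal ((cmod (F n x - f x))\<^sup>2)"
          by (intro tendsto_ennrealI tendsto_intros elim)
        then show ?case by (rule lim_imp_Liminf[OF trivial_limit_sequentially, symmetric])
      qed
    qed
    also have "\<dots> \<le> liminf (\<lambda>k. \<integral>\<^sup>+x. ennreal ((cmod (F n x - F (r k) x))\<^sup>2) \<partial>M)"
      by (rule nn_integral_liminf) simp
    also have "\<dots> \<le> ennreal e"
    proof (rule Liminf_le)
      show "\<forall>\<^sub>F k in sequentially. (\<integral>\<^sup>+x. ennreal ((cmod (F n x - F (r k) x))\<^sup>2) \<partial>M) \<le> ennreal e"
        using eventually_ge_at_top[of "N e"]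
      proof eventually_elim
        case (elim k)
        then have rk: "r k \<ge> N e" using seq_suble[OF r, of k] by linarith
        have "(\<integral>\<^sup>+x. ennreal ((cmod (F n x - F (r k) x))\<^sup>2) \<partial>M) = ennreal (nsq M (\<lambda>x. F n x - F (r k) x))"
          unfolding nsq_def by (rule nn_integral_eq_integral) (auto simp: L2onD(2)[OF L2on_diff[OF F F]])
        also have "\<dots> \<le> ennreal e" by (rule ennreal_leI) (use N[OF e n rk] in simp)
        finally show ?case .
      qed
    qed simp
    finally show ?thesis .
  qed
  have diffL2: "(\<lambda>x. F n x - f x) \<in> L2on M" if "n \<ge> N 1" for n
  proof -
    have "(\<integral>\<^sup>+x. ennreal ((cmod (F n x - f x))\<^sup>2) \<partial>M) < \<infinity>"
      using bound[OF zero_less_one that] by (rule le_less_trans) simp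
    then show ?thesis unfolding L2on_def by (auto intro!: integrableI_nonneg)
  qed
  have "(\<lambda>x. F (N 1) x - (F (N 1) x - f x)) \<in> L2on M" by (intro L2on_diff F diffL2) simp
  then have fL2: "f \<in> L2on M" by simp
  have "l2_tendsto M F f"
    unfolding l2_tendsto_def
  proof (rule LIMSEQ_I)
    fix e :: real assume e: "0 < e"
    have "norm (nsq M (\<lambda>x. F n x - f x) - 0) < e" if "n \<ge> N (e/2)" for n
    proof -
      have "ennreal (nsq M (\<lambda>x. F n x - f x)) = (\<integral>\<^sup>+x. ennreal ((cmod (F n x - f x))\<^sup>2) \<partial>M)"
        unfolding nsq_def by (rule nn_integral_eq_integral[symmetric]) (auto simp: L2onD(2)[OF L2on_diff[OF F fL2]])
      also have "\<dots> \<le> ennreal (e/2)" using bound[of "e/2" n] e that by simp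
      finally have "nsq M (\<lambda>x. F n x - f x) \<le> e/2" using e by simp
      then show ?thesis using e by (simp add: nsq_nonneg)
    qed
    then show "\<exists>no. \<forall>n\<ge>no. norm (nsq M (\<lambda>x. F n x - f x) - 0) < e" by blast
  qed
  with fL2 show ?thesis by (rule that)
qed

lemma l2_tendsto_cauchy:
  assumes F: "\<And>n. F n \<in> L2on M" and f: "f \<in> L2on M" and lim: "l2_tendsto M F f" and e: "e > 0"
  shows "\<exists>N. \<forall>m\<ge>N. \<forall>n\<ge>N. nsq M (\<lambda>x. F m x - F n x) < e"
proof -
  obtain N where N: "\<And>n. n \<ge> N \<Longrightarrow> nsq M (\<lambda>x. F n x - f x) < e / 4"
    using LIMSEQ_D[OF l2_tendstoD[OF lim], of "e/4"] e by (auto simp: nsq_nonneg)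
  have "nsq M (\<lambda>x. F m x - F n x) < e" if "m \<ge> N" "n \<ge> N" for m n
    using nsq_triangle[OF F[of m] f F[of n]] N[OF that(1)] N[OF that(2)]
      nsq_minus_commute[of M "F n" f] by linarith
  then show ?thesis by blast
qed

definition closed_lin :: "'a measure \<Rightarrow> ('a \<Rightarrow> complex) set \<Rightarrow> bool" where
  "closed_lin M D \<longleftrightarrow> D \<subseteq> L2on M \<and>
     (\<forall>f\<in>D. \<forall>g\<in>D. \<forall>a b. (\<lambda>x. a * f x + b * g x) \<in> D) \<and>
     (\<forall>F f. (\<forall>n. F n \<in> D) \<longrightarrow> f \<in> L2on M \<longrightarrow> l2_tendsto M F f \<longrightarrow> f \<in> D)"

lemma closed_linD:
  assumes "closed_lin M D"
  shows "f \<in> D \<Longrightarrow> f \<in> L2on M"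
    and "f \<in> D \<Longrightarrow> g \<in> D \<Longrightarrow> (\<lambda>x. a * f x + b * g x) \<in> D"
    and "(\<And>n. F n \<in> D) \<Longrightarrow> f \<in> L2on M \<Longrightarrow> l2_tendsto M F f \<Longrightarrow> f \<in> D"
  using assms unfolding closed_lin_def by blast+

lemma closed_lin_scale: "closed_lin M D \<Longrightarrow> f \<in> D \<Longrightarrow> (\<lambda>x. a * f x) \<in> D"
  using closed_linD(2)[of M D f f a 0] by simp

lemma closed_lin_add: "closed_lin M D \<Longrightarrow> f \<in> D \<Longrightarrow> g \<in> D \<Longrightarrow> (\<lambda>x. f x + g x) \<in> D"
  using closed_linD(2)[of M D f g 1 1] by simp

lemma closed_lin_diff: "closed_lin M D \<Longrightarrow> f \<in> D \<Longrightarrow> g \<in> D \<Longrightarrow> (\<lambda>x. f x - g x) \<in> D"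
  using closed_linD(2)[of M D f g 1 "-1"] by simp

lemma closed_lin_cong_AE:
  assumes D: "closed_lin M D" and f: "f \<in> D" and g: "g \<in> borel_measurable M" and eq: "AE x in M. f x = g x"
  shows "g \<in> D"
proof (rule closed_linD(3)[OF D, of "\<lambda>n. f"])
  show gL: "g \<in> L2on M" by (rule L2on_cong_AE[OF closed_linD(1)[OF D f] g eq])
  have "nsq M (\<lambda>x. f x - g x) = 0"
    using nsq_eq_0_iff[OF L2on_diff[OF closed_linD(1)[OF D f] gL]] eq by auto
  then show "l2_tendsto M (\<lambda>n. f) g" by (simp add: l2_tendsto_def)
qed (rule f)

section \<open>Isometries as closed linear relations\<close>

definition iso_rel :: "'a measure \<Rightarrow> 'b measure \<Rightarrow> (('a \<Rightarrow> complex) \<Rightarrow> ('b \<Rightarrow> complex) \<Rightarrow> bool) \<Rightarrow> bool" where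
  "iso_rel M N R \<longleftrightarrow>
     (\<forall>f g. R f g \<longrightarrow> f \<in> L2on M \<and> g \<in> L2on N) \<and>
     (\<forall>f g f' g' a b. R f g \<longrightarrow> R f' g' \<longrightarrow> R (\<lambda>x. a * f x + b * f' x) (\<lambda>x. a * g x + b * g' x)) \<and>
     (\<forall>F G f g. (\<forall>n. R (F n) (G n)) \<longrightarrow> f \<in> L2on M \<longrightarrow> g \<in> L2on N \<longrightarrow>
        l2_tendsto M F f \<longrightarrow> l2_tendsto N G g \<longrightarrow> R f g) \<and>
     (\<forall>f g f' g'. R f g \<longrightarrow> R f' g' \<longrightarrow> ip M f f' = ip N g g')"

lemma iso_relD:
  assumes "iso_rel M N R"
  shows "R f g \<Longrightarrow> f \<in> L2on M" "R f g \<Longrightarrow> g \<in> L2on N"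
    and "R f g \<Longrightarrow> R f' g' \<Longrightarrow> R (\<lambda>x. a * f x + b * f' x) (\<lambda>x. a * g x + b * g' x)"
    and "(\<And>n. R (F n) (G n)) \<Longrightarrow> f \<in> L2on M \<Longrightarrow> g \<in> L2on N \<Longrightarrow>
        l2_tendsto M F f \<Longrightarrow> l2_tendsto N G g \<Longrightarrow> R f g"
    and "R f g \<Longrightarrow> R f' g' \<Longrightarrow> ip M f f' = ip N g g'"
proof -
  note * = assms[unfolded iso_rel_def]
  show "R f g \<Longrightarrow> f \<in> L2on M" "R f g \<Longrightarrow> g \<in> L2on N"
    using *[THEN conjunct1] by simp_all
  show "R f g \<Longrightarrow> R f' g' \<Longrightarrow> R (\<lambda>x. a * f x + b * f' x) (\<lambda>x. a * g x + b * g' x)"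
    using *[THEN conjunct2, THEN conjunct1] by simp
  show "(\<And>n. R (F n) (G n)) \<Longrightarrow> f \<in> L2on M \<Longrightarrow> g \<in> L2on N \<Longrightarrow>
        l2_tendsto M F f \<Longrightarrow> l2_tendsto N G g \<Longrightarrow> R f g"
    using *[THEN conjunct2, THEN conjunct2, THEN conjunct1, rule_format, of F G f g] .
  show "R f g \<Longrightarrow> R f' g' \<Longrightarrow> ip M f f' = ip N g g'"
    using *[THEN conjunct2, THEN conjunct2, THEN conjunct2, rule_format, of f g f' g'] .
qed

lemma iso_relI:
  assumes 1: "\<And>f g. R f g \<Longrightarrow> f \<in> L2on M" "\<And>f g. R f g \<Longrightarrow> g \<in> L2on N"
    and 2: "\<And>f g f' g' a b. R f g \<Longrightarrow> R f' g' \<Longrightarrow>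
      R (\<lambda>x. a * f x + b * f' x) (\<lambda>x. a * g x + b * g' x)"
    and 3: "\<And>F G f g. (\<And>n. R (F n) (G n)) \<Longrightarrow> f \<in> L2on M \<Longrightarrow> g \<in> L2on N \<Longrightarrow>
      l2_tendsto M F f \<Longrightarrow> l2_tendsto N G g \<Longrightarrow> R f g"
    and 4: "\<And>f g f' g'. R f g \<Longrightarrow> R f' g' \<Longrightarrow> ip M f f' = ip N g g'"
  shows "iso_rel M N R"
proof -
  have 1: "\<forall>f g. R f g \<longrightarrow> f \<in> L2on M \<and> g \<in> L2on N"
    by (intro allI impI conjI) (erule 1)+
  have 2: "\<forall>f g f' g' a b. R f g \<longrightarrow> R f' g' \<longrightarrow>
      R (\<lambda>x. a * f x + b * f' x) (\<lambda>x. a * g x + b * g' x)"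
    by (rule allI)+ (intro impI, erule 2, assumption)
  have 3: "\<forall>F G f g. (\<forall>n. R (F n) (G n)) \<longrightarrow> f \<in> L2on M \<longrightarrow> g \<in> L2on N \<longrightarrow>
      l2_tendsto M F f \<longrightarrow> l2_tendsto N G g \<longrightarrow> R f g"
  proof (rule allI)+
    fix F G f g
    show "(\<forall>n. R (F n) (G n)) \<longrightarrow> f \<in> L2on M \<longrightarrow> g \<in> L2on N \<longrightarrow>
      l2_tendsto M F f \<longrightarrow> l2_tendsto N G g \<longrightarrow> R f g"
      using 3[of F G f g] by simp
  qed
  have 4: "\<forall>f g f' g'. R f g \<longrightarrow> R f' g' \<longrightarrow> ip M f f' = ip N g g'"
    by (intro allI impI) (erule 4, assumption)
  show ?thesis unfolding iso_rel_def using 1 2 3 4 by (intro conjI)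
qed

lemma iso_rel_converse:
  assumes R: "iso_rel M N R"
  shows "iso_rel N M (\<lambda>g f. R f g)"
proof (rule iso_relI, goal_cases)
  case (1 f g)
  then show ?case by (rule iso_relD(2)[OF R])
next
  case (2 f g)
  then show ?case by (rule iso_relD(1)[OF R])
next
  case (3 f g f' g' a b)
  then show ?case using iso_relD(3)[OF R, of g f g' f' a b] by simp
next
  case (4 F G f g)
  then show ?case using iso_relD(4)[OF R, of G F g f] by simp
next
  case (5 f g f' g')
  then show ?case using iso_relD(5)[OF R, of g f g' f'] by simp
qed

lemma iso_rel_nsq:
  assumes R: "iso_rel M N R" and h: "R f g"
  shows "nsq M f = nsq N g"
  using iso_relD(5)[OF R, OF h h] unfolding ip_self of_real_eq_iff .

lemma iso_rel_diff:
  assumes R: "iso_rel M N R" and h: "R f g" "R f' g'"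
  shows "R (\<lambda>x. f x - f' x) (\<lambda>x. g x - g' x)"
  using iso_relD(3)[OF R, OF h, of 1 "-1"] by simp

lemma iso_rel_add:
  assumes R: "iso_rel M N R" and h: "R f g" "R f' g'"
  shows "R (\<lambda>x. f x + f' x) (\<lambda>x. g x + g' x)"
  using iso_relD(3)[OF R, OF h, of 1 1] by simp

lemma iso_rel_scale:
  assumes R: "iso_rel M N R" and h: "R f g"
  shows "R (\<lambda>x. a * f x) (\<lambda>x. a * g x)"
  using iso_relD(3)[OF R, OF h h, of a 0] by simp

lemma iso_rel_unique:
  assumes R: "iso_rel M N R" and h: "R f g" "R f' g'" and eq: "AE x in M. f x = f' x"
  shows "AE x in N. g x = g' x"
proof -
  have d: "R (\<lambda>x. f x - f' x) (\<lambda>x. g x - g' x)" using iso_rel_diff[OF R, OF h] .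
  have "nsq M (\<lambda>x. f x - f' x) = 0"
    using eq by (subst nsq_eq_0_iff[OF iso_relD(1)[OF R, OF d]]) auto
  then have "nsq N (\<lambda>x. g x - g' x) = 0" using iso_rel_nsq[OF R, OF d] by simp
  then show ?thesis by (simp add: nsq_eq_0_iff[OF iso_relD(2)[OF R, OF d]])
qed

lemma l2_tendsto_const_AE:
  assumes "f \<in> L2on M" "f' \<in> L2on M" and eq: "AE x in M. f x = f' x"
  shows "l2_tendsto M (\<lambda>n. f) f'"
proof -
  have "nsq M (\<lambda>x. f x - f' x) = 0"
    unfolding nsq_eq_0_iff[OF L2on_diff[OF assms(1,2)]] using eq by auto
  then show ?thesis by (simp add: l2_tendsto_def)
qed

lemma iso_rel_cong_AE:
  assumes R: "iso_rel M N R" and h: "R f g" and m: "f' \<in> borel_measurable M" "g' \<in> borel_measurable N"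
    and eq: "AE x in M. f x = f' x" "AE x in N. g x = g' x"
  shows "R f' g'"
proof -
  note fg = iso_relD(1)[OF R, OF h] iso_relD(2)[OF R, OF h]
  have f': "f' \<in> L2on M" by (rule L2on_cong_AE[OF fg(1) m(1) eq(1)])
  have g': "g' \<in> L2on N" by (rule L2on_cong_AE[OF fg(2) m(2) eq(2)])
  show ?thesis
    using iso_relD(4)[OF R, of "\<lambda>n. f" "\<lambda>n. g" f' g'] h f' g'
      l2_tendsto_const_AE[OF fg(1) f' eq(1)] l2_tendsto_const_AE[OF fg(2) g' eq(2)] by simp
qed

lemma iso_rel_domain_closed:
  assumes R: "iso_rel M N R"
  shows "closed_lin M {f. \<exists>g. R f g}"
  unfolding closed_lin_def
proof (intro conjI ballI allI impI)
  show "{f. \<exists>g. R f g} \<subseteq> L2on M"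
  proof (rule subsetI, elim CollectE exE)
    fix f g assume "R f g"
    then show "f \<in> L2on M" by (rule iso_relD(1)[OF R])
  qed
next
  fix f f' a b assume "f \<in> {f. \<exists>g. R f g}" "f' \<in> {f. \<exists>g. R f g}"
  then obtain g g' where h: "R f g" "R f' g'" by auto
  show "(\<lambda>x. a * f x + b * f' x) \<in> {f. \<exists>g. R f g}"
    by (rule CollectI, rule exI) (rule iso_relD(3)[OF R, OF h])
next
  fix F f assume "\<forall>n. F n \<in> {f. \<exists>g. R f g}" and f: "f \<in> L2on M" and lim: "l2_tendsto M F f"
  then have "\<forall>n. \<exists>g. R (F n) g" by simp
  then have "\<exists>G. \<forall>n. R (F n) (G n)" by (rule choice)
  then obtain G where "\<forall>n. R (F n) (G n)" by (rule exE)
  then have G: "R (F n) (G n)" for n by (rule spec)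
  have eq: "nsq M (\<lambda>x. F m x - F n x) = nsq N (\<lambda>x. G m x - G n x)" for m n
    using iso_rel_nsq[OF R, OF iso_rel_diff[OF R, OF G[of m] G[of n]]] .
  have "\<exists>N'. \<forall>m\<ge>N'. \<forall>n\<ge>N'. nsq N (\<lambda>x. G m x - G n x) < e" if "e > 0" for e
    using l2_tendsto_cauchy[OF iso_relD(1)[OF R, OF G] f lim that] unfolding eq .
  from L2on_complete[of G N, OF iso_relD(2)[OF R, OF G] this]
  obtain g where "g \<in> L2on N" "l2_tendsto N G g" by blast
  then have "R f g" using iso_relD(4)[OF R, of F G f g, OF G f _ lim] by simp
  then show "f \<in> {f. \<exists>g. R f g}" by (intro CollectI exI)
qed

lemma iso_rel_range_closed: "iso_rel M N R \<Longrightarrow> closed_lin N {g. \<exists>f. R f g}"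
  using iso_rel_domain_closed[OF iso_rel_converse] .

inductive closed_hull :: "'a measure \<Rightarrow> 'b measure \<Rightarrow> (('a \<Rightarrow> complex) \<Rightarrow> ('b \<Rightarrow> complex) \<Rightarrow> bool) \<Rightarrow>
    ('a \<Rightarrow> complex) \<Rightarrow> ('b \<Rightarrow> complex) \<Rightarrow> bool" for M N B where
  base: "B f g \<Longrightarrow> closed_hull M N B f g"
| lin: "closed_hull M N B f g \<Longrightarrow> closed_hull M N B f' g' \<Longrightarrow>
    closed_hull M N B (\<lambda>x. a * f x + b * f' x) (\<lambda>x. a * g x + b * g' x)"
| lim: "(\<And>n. closed_hull M N B (F n) (G n)) \<Longrightarrow> f \<in> L2on M \<Longrightarrow> g \<in> L2on N \<Longrightarrow>
    l2_tendsto M F f \<Longrightarrow> l2_tendsto N G g \<Longrightarrow> closed_hull M N B f g"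

lemma iso_rel_hull:
  assumes B: "\<And>f g. B f g \<Longrightarrow> f \<in> L2on M \<and> g \<in> L2on N"
    and iso: "\<And>f g f' g'. B f g \<Longrightarrow> B f' g' \<Longrightarrow> ip M f f' = ip N g g'"
  shows "iso_rel M N (closed_hull M N B)"
proof -
  have L2: "f \<in> L2on M \<and> g \<in> L2on N" if "closed_hull M N B f g" for f g
    using that by induction (auto simp: B intro: L2on_lincomb)
  have iso1: "ip M f f' = ip N g g'" if "closed_hull M N B f g" "B f' g'" for f g f' g'
    using that
  proof (induction)
    case (base f g)
    then show ?case by (rule iso)
  next
    case (lin f1 g1 f2 g2 a b)
    note l = L2[OF lin.hyps(1)] L2[OF lin.hyps(2)] B[OF lin.prems]
    show ?case using l by (simp add: ip_lincomb_left lin.IH[OF lin.prems])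
  next
    case (lim F G f g)
    have "(\<lambda>n. ip M (F n) f') \<longlonglongrightarrow> ip M f f'"
      using L2[OF lim.hyps(1)] B[OF lim.prems] by (intro l2_tendsto_ip_left lim.hyps(2,4)) blast+
    moreover have "(\<lambda>n. ip N (G n) g') \<longlonglongrightarrow> ip N g g'"
      using L2[OF lim.hyps(1)] B[OF lim.prems] by (intro l2_tendsto_ip_left lim.hyps(3,5)) blast+
    ultimately show ?case unfolding lim.IH[OF lim.prems] by (rule LIMSEQ_unique)
  qed
  have iso2: "ip M f f' = ip N g g'" if "closed_hull M N B f' g'" "closed_hull M N B f g" for f g f' g'
    using that
  proof (induction)
    case (base f' g')
    then show ?case by (intro iso1)
  next
    case (lin f1 g1 f2 g2 a b)
    note l = L2[OF lin.hyps(1)] L2[OF lin.hyps(2)] L2[OF lin.prems]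
    show ?case using l by (simp add: ip_lincomb_right lin.IH[OF lin.prems])
  next
    case (lim F G f' g')
    have "(\<lambda>n. ip M f (F n)) \<longlonglongrightarrow> ip M f f'"
      using L2[OF lim.hyps(1)] L2[OF lim.prems] by (intro l2_tendsto_ip_right lim.hyps(2,4)) blast+
    moreover have "(\<lambda>n. ip N g (G n)) \<longlonglongrightarrow> ip N g g'"
      using L2[OF lim.hyps(1)] L2[OF lim.prems] by (intro l2_tendsto_ip_right lim.hyps(3,5)) blast+
    ultimately show ?case unfolding lim.IH[OF lim.prems] by (rule LIMSEQ_unique)
  qed
  show ?thesis
  proof (rule iso_relI, goal_cases)
    case (3 f g f' g' a b)
    then show ?case using closed_hull.lin[of M N B f g f' g' a b] by simp
  next
    case (4 F G f g)
    then show ?case using closed_hull.lim[of M N B F G f g] by simp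
  qed (simp_all add: L2 iso2)
qed

definition unitary_rel :: "'a measure \<Rightarrow> 'b measure \<Rightarrow> (('a \<Rightarrow> complex) \<Rightarrow> ('b \<Rightarrow> complex) \<Rightarrow> bool) \<Rightarrow> bool" where
  "unitary_rel M N R \<longleftrightarrow> iso_rel M N R \<and> (\<forall>f\<in>L2on M. \<exists>g. R f g) \<and> (\<forall>g\<in>L2on N. \<exists>f. R f g)"

section \<open>Density of trigonometric polynomials\<close>

context
  fixes M :: "'a measure" and v :: "'a \<Rightarrow> complex" and D :: "('a \<Rightarrow> complex) set"
  assumes fin: "finite_measure M" and v_meas [measurable]: "v \<in> borel_measurable M"
    and v_unit: "AE x in M. cmod (v x) = 1"
    and D: "closed_lin M D" and D_1: "(\<lambda>x. 1) \<in> D"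
    and D_v: "\<And>f. f \<in> D \<Longrightarrow> (\<lambda>x. v x * f x) \<in> D"
    and D_cnj: "\<And>f. f \<in> D \<Longrightarrow> (\<lambda>x. cnj (v x) * f x) \<in> D"
begin

lemma const_in: "(\<lambda>x. c) \<in> D"
  using closed_lin_scale[OF D D_1, of c] by simp

lemma mult_polynomial_in:
  assumes "real_polynomial_function p" "f \<in> D"
  shows "(\<lambda>x. of_real (p (v x)) * f x) \<in> D"
  using assms
proof (induction arbitrary: f rule: real_polynomial_function.induct)
  case (linear p)
  interpret bounded_linear p by fact
  have p: "p z = Re z * p 1 + Im z * p \<i>" for z
  proof -
    have "z = Re z *\<^sub>R 1 + Im z *\<^sub>R \<i>" by (simp add: complex_eq_iff)
    then have "p z = p (Re z *\<^sub>R 1 + Im z *\<^sub>R \<i>)" by simp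
    then show ?thesis by (simp only: add scaleR real_scaleR_def)
  qed
  define a where "a = (complex_of_real (p 1) - \<i> * of_real (p \<i>)) / 2"
  define b where "b = (complex_of_real (p 1) + \<i> * of_real (p \<i>)) / 2"
  have eq: "of_real (p z) = a * z + b * cnj z" for z
    unfolding p[of z] a_def b_def by (simp add: complex_eq_iff field_simps)
  have "(\<lambda>x. a * (v x * f x) + b * (cnj (v x) * f x)) \<in> D"
    by (rule closed_linD(2)[OF D D_v[OF linear.prems] D_cnj[OF linear.prems]])
  then show ?case by (simp add: eq algebra_simps)
next
  case (const c)
  then show ?case by (intro closed_lin_scale[OF D])
next
  case (add p q)
  show ?case
    using closed_lin_add[OF D add.IH(1)[OF add.prems] add.IH(2)[OF add.prems]] by (simp add: algebra_simps)
next
  case (mult p q)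
  show ?case
    using mult.IH(1)[OF mult.IH(2)[OF mult.prems]] by (simp add: mult.assoc)
qed

lemma L2_const: "(\<lambda>x. c) \<in> L2on M"
  by (rule closed_linD(1)[OF D const_in])

lemma dominated_limit_in:
  assumes F: "\<And>n. F n \<in> D" and f: "f \<in> borel_measurable M" and g: "g \<in> L2on M"
    and dom: "\<And>n. AE x in M. cmod (F n x) \<le> cmod (g x)"
    and lim: "AE x in M. (\<lambda>n. F n x) \<longlonglongrightarrow> f x"
  shows "f \<in> D"
proof -
  note * = l2_tendsto_dominated[OF L2onD(1)[OF closed_linD(1)[OF D F]] f g dom lim]
  show ?thesis by (rule closed_linD(3)[OF D F *(1) *(3)])
qed

lemma continuous_in:
  fixes g :: "complex \<Rightarrow> real"
  assumes g: "continuous_on UNIV g"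
  shows "(\<lambda>x. of_real (g (v x))) \<in> D"
proof -
  have S: "compact (sphere (0::complex) 1)" and gS: "continuous_on (sphere 0 1) g"
    using g by (auto intro: continuous_on_subset)
  have "\<exists>p. real_polynomial_function p \<and> (\<forall>z\<in>sphere 0 1. \<bar>g z - p z\<bar> < 1 / Suc n)" for n
    using Stone_Weierstrass_real_polynomial_function[OF S gS, of "1 / Suc n"]
    by (metis of_nat_0_less_iff zero_less_Suc zero_less_divide_1_iff)
  then obtain p where p: "\<And>n. real_polynomial_function (p n)"
      and gp: "\<And>n z. z \<in> sphere 0 1 \<Longrightarrow> \<bar>g z - p n z\<bar> < 1 / Suc n"
    by metis
  obtain K where "\<forall>y\<in>g ` sphere 0 1. norm y \<le> K"
    using compact_imp_bounded[OF compact_continuous_image[OF gS S]] unfolding bounded_iff by blast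
  then have K: "\<bar>g z\<bar> \<le> K" if "z \<in> sphere 0 1" for z using that by (auto simp del: mem_sphere mem_sphere_0)
  have [measurable]: "g \<in> borel_measurable borel" by (rule borel_measurable_continuous_onI[OF g])
  show ?thesis
  proof (rule dominated_limit_in)
    show "(\<lambda>x. of_real (p n (v x))) \<in> D" for n
      using mult_polynomial_in[OF p D_1] by simp
    show "(\<lambda>x. complex_of_real (g (v x))) \<in> borel_measurable M" by measurable
    show "(\<lambda>x. complex_of_real (K + 1)) \<in> L2on M" by (rule L2_const)
    show "AE x in M. cmod (complex_of_real (p n (v x))) \<le> cmod (complex_of_real (K + 1))" for n
      using v_unit
    proof eventually_elim
      case (elim x)
      then have "v x \<in> sphere 0 1" by simp
      from gp[OF this, of n] K[OF this] have "\<bar>p n (v x)\<bar> \<le> K + 1 / Suc n" by linarith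
      moreover have "1 / real (Suc n) \<le> 1" by simp
      ultimately have "\<bar>p n (v x)\<bar> \<le> \<bar>K + 1\<bar>" by linarith
      then show ?case by (simp only: norm_of_real)
    qed
    show "AE x in M. (\<lambda>n. complex_of_real (p n (v x))) \<longlonglongrightarrow> of_real (g (v x))"
      using v_unit
    proof eventually_elim
      case (elim x)
      then have "v x \<in> sphere 0 1" by simp
      note gp = gp[OF this]
      have "(\<lambda>n. p n (v x) - g (v x)) \<longlonglongrightarrow> 0"
      proof (rule Lim_null_comparison)
        show "\<forall>\<^sub>F n in sequentially. norm (p n (v x) - g (v x)) \<le> 1 / Suc n"
          using gp by (intro always_eventually allI) (simp add: abs_minus_commute less_imp_le)
        show "(\<lambda>n. 1 / real (Suc n)) \<longlonglongrightarrow> 0" by (rule LIMSEQ_Suc[OF lim_1_over_n])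
      qed
      then show ?case by (intro tendsto_of_real) (simp add: LIM_zero_iff)
    qed
  qed
qed

lemma indicator_open_in:
  assumes "open U"
  shows "(\<lambda>x. of_real (indicator U (v x))) \<in> D"
proof (cases "U = UNIV")
  case True
  then show ?thesis using D_1 by simp
next
  case False
  then have ne: "- U \<noteq> {}" by auto
  have cl: "closed (- U)" using assms by (simp add: closed_Compl)
  define g where "g n z = min 1 (real n * infdist z (- U))" for n and z :: complex
  have g_le: "0 \<le> g n z" "g n z \<le> 1" for n z by (auto simp: g_def infdist_nonneg)
  have [measurable]: "U \<in> sets borel" using assms by simp
  show ?thesis
  proof (rule dominated_limit_in[where F="\<lambda>n x. of_real (g n (v x))"])
    show "(\<lambda>x. of_real (g n (v x))) \<in> D" for n
      by (rule continuous_in) (auto simp: g_def intro!: continuous_intros)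
    show "(\<lambda>x. complex_of_real (indicator U (v x))) \<in> borel_measurable M" by measurable
    show "(\<lambda>x. 1) \<in> L2on M" by (rule L2_const)
    show "AE x in M. cmod (complex_of_real (g n (v x))) \<le> cmod 1" for n
      using g_le by (auto simp: abs_of_nonneg)
    show "AE x in M. (\<lambda>n. complex_of_real (g n (v x))) \<longlonglongrightarrow> of_real (indicator U (v x))"
    proof (intro AE_I2 tendsto_of_real)
      fix x
      show "(\<lambda>n. g n (v x)) \<longlonglongrightarrow> indicator U (v x)"
      proof (cases "v x \<in> U")
        case True
        then have "infdist (v x) (- U) \<noteq> 0" using in_closed_iff_infdist_zero[OF cl ne, of "v x"] by simp
        then have pos: "infdist (v x) (- U) > 0" using infdist_nonneg[of "v x" "- U"] by linarith
        have "\<forall>\<^sub>F n in sequentially. g n (v x) = 1"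
          using eventually_ge_at_top[of "nat \<lceil>1 / infdist (v x) (- U)\<rceil>"]
        proof eventually_elim
          case (elim n)
          then have "1 / infdist (v x) (- U) \<le> real n" by linarith
          then have "1 \<le> real n * infdist (v x) (- U)" using pos by (simp add: field_simps)
          then show ?case by (simp add: g_def)
        qed
        then show ?thesis using True by (simp add: tendsto_eventually)
      next
        case False
        then have "infdist (v x) (- U) = 0" by simp
        then show ?thesis using False by (simp add: g_def)
      qed
    qed
  qed
qed

lemma indicator_borel_in:
  assumes "A \<in> sets borel"
  shows "(\<lambda>x. of_real (indicator A (v x))) \<in> D"
proof -
  have "Int_stable {S::complex set. open S}" by (auto simp: Int_stable_def)
  moreover have "{S::complex set. open S} \<subseteq> Pow UNIV" by auto
  moreover have "A \<in> sigma_sets UNIV {S::complex set. open S}" using assms by (simp add: borel_def)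
  ultimately show ?thesis
  proof (induction rule: sigma_sets_induct_disjoint)
    case (basic A)
    then show ?case by (intro indicator_open_in) simp
  next
    case empty
    then show ?case using const_in[of 0] by simp
  next
    case (compl A)
    have "(\<lambda>x. 1 - of_real (indicator A (v x))) \<in> D"
      by (rule closed_lin_diff[OF D D_1 compl.IH])
    moreover have "(\<lambda>x. 1 - complex_of_real (indicator A (v x))) = (\<lambda>x. of_real (indicator (UNIV - A) (v x)))"
      by (auto simp: indicator_def)
    ultimately show ?case by simp
  next
    case (union A)
    have Am: "A n \<in> sets borel" for n
      using union.hyps(2) unfolding borel_def by (auto simp: sets_measure_of)
    then have [measurable]: "(\<Union>i. A i) \<in> sets borel" by blast
    have part: "(\<lambda>x. \<Sum>i<n. complex_of_real (indicator (A i) (v x))) \<in> D" for n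
    proof (induction n)
      case 0
      then show ?case using const_in[of 0] by simp
    next
      case (Suc n)
      show ?case using closed_lin_add[OF D Suc union.IH[of n]] by (simp add: add.commute)
    qed
    have eq: "(\<Sum>i<n. complex_of_real (indicator (A i) (v x))) = of_real (indicator (\<Union>i<n. A i) (v x))" for n x
      using union.hyps(1)
      by (subst indicator_UN_disjoint) (auto simp: disjoint_family_on_def)
    show ?case
    proof (rule dominated_limit_in[OF part])
      show "(\<lambda>x. complex_of_real (indicator (\<Union> (range A)) (v x))) \<in> borel_measurable M" by measurable
      show "(\<lambda>x. 1) \<in> L2on M" by (rule L2_const)
      show "AE x in M. cmod (\<Sum>i<n. complex_of_real (indicator (A i) (v x))) \<le> cmod 1" for n
        unfolding eq by (auto simp: indicator_def)
      show "AE x in M. (\<lambda>n. \<Sum>i<n. complex_of_real (indicator (A i) (v x)))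
          \<longlonglongrightarrow> complex_of_real (indicator (\<Union> (range A)) (v x))"
        unfolding eq
        by (intro AE_I2 tendsto_of_real LIMSEQ_indicator_UN[where 'a=real, THEN tendsto_eq_rhs]) auto
    qed
  qed
qed

lemma circle_dense:
  assumes sets_v: "\<And>A. A \<in> sets M \<Longrightarrow> \<exists>B\<in>sets borel. AE x in M. v x \<in> B \<longleftrightarrow> x \<in> A"
    and f: "f \<in> L2on M"
  shows "f \<in> D"
proof -
  have ind: "(\<lambda>x. of_real (indicator A x)) \<in> D" if A: "A \<in> sets M" for A
  proof -
    from sets_v[OF A] obtain B where B: "B \<in> sets borel" "AE x in M. v x \<in> B \<longleftrightarrow> x \<in> A" by blast
    show ?thesis
    proof (rule closed_lin_cong_AE[OF D indicator_borel_in[OF B(1)]])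
      show "AE x in M. complex_of_real (indicator B (v x)) = of_real (indicator A x)"
        using B(2) by eventually_elim (simp add: indicator_def)
    qed (use A in measurable)
  qed
  have simple: "g \<in> D" if g: "simple_function M g" for g
  proof -
    have fing: "finite (g ` space M)" by (rule simple_functionD(1)[OF g])
    have sum: "(\<lambda>x. \<Sum>y\<in>Y. y * complex_of_real (indicator (g -` {y} \<inter> space M) x)) \<in> D"
      if "finite Y" for Y :: "complex set"
      using that
    proof induction
      case empty
      then show ?case using const_in[of 0] by simp
    next
      case (insert y Y)
      have "(\<lambda>x. y * complex_of_real (indicator (g -` {y} \<inter> space M) x)) \<in> D"
        by (rule closed_lin_scale[OF D ind]) (rule simple_functionD(2)[OF g])
      from closed_lin_add[OF D this insert.IH] show ?case
        using insert.hyps by (simp add: sum.insert)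
    qed
    show ?thesis
    proof (rule closed_lin_cong_AE[OF D sum[OF fing]])
      show "g \<in> borel_measurable M" by (rule borel_measurable_simple_function[OF g])
      show "AE x in M. (\<Sum>y\<in>g ` space M. y * complex_of_real (indicator (g -` {y} \<inter> space M) x)) = g x"
      proof (rule AE_I2)
        fix x assume x: "x \<in> space M"
        have "(\<Sum>y\<in>g ` space M. y * complex_of_real (indicator (g -` {y} \<inter> space M) x))
            = (\<Sum>y\<in>g ` space M. if y = g x then y else 0)"
          by (rule sum.cong) (use x in \<open>auto simp: indicator_def\<close>)
        then show "(\<Sum>y\<in>g ` space M. y * complex_of_real (indicator (g -` {y} \<inter> space M) x)) = g x"
          using x fing by (simp add: sum.delta)
      qed
    qed
  qed
  obtain F where F: "\<And>i. simple_function M (F i)" "\<And>x. x \<in> space M \<Longrightarrow> (\<lambda>i. F i x) \<longlonglongrightarrow> f x"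
      "\<And>i x. x \<in> space M \<Longrightarrow> dist (F i x) 0 \<le> 2 * dist (f x) 0"
    using borel_measurable_implies_sequence_metric[OF L2onD(1)[OF f], of 0] by blast
  show ?thesis
  proof (rule dominated_limit_in[OF simple[OF F(1)] L2onD(1)[OF f] L2on_scale[OF f, of 2]])
    show "AE x in M. cmod (F n x) \<le> cmod (2 * f x)" for n
      using F(3) by (intro AE_I2) (simp add: norm_mult)
    show "AE x in M. (\<lambda>n. F n x) \<longlonglongrightarrow> f x" using F(2) by (intro AE_I2)
  qed
qed

end

section \<open>The spectral measure of a stationary sequence\<close>

lemma L2on_sum:
  assumes "finite I" "\<And>i. i \<in> I \<Longrightarrow> f i \<in> L2on M"
  shows "(\<lambda>x. \<Sum>i\<in>I. a i * f i x) \<in> L2on M"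
  using assms
proof (induction I rule: finite_induct)
  case empty
  then show ?case by (simp add: L2on_zero)
next
  case (insert i I)
  then have "(\<lambda>x. a i * f i x + 1 * (\<Sum>i\<in>I. a i * f i x)) \<in> L2on M"
    by (intro L2on_lincomb) auto
  then show ?case using insert.hyps by simp
qed

lemma ip_sum_left:
  assumes "finite I" "\<And>i. i \<in> I \<Longrightarrow> f i \<in> L2on M" "g \<in> L2on M"
  shows "ip M (\<lambda>x. \<Sum>i\<in>I. a i * f i x) g = (\<Sum>i\<in>I. a i * ip M (f i) g)"
  using assms
proof (induction I rule: finite_induct)
  case empty
  then show ?case by (simp add: ip_def)
next
  case (insert i I)
  have "ip M (\<lambda>x. a i * f i x + 1 * (\<Sum>i\<in>I. a i * f i x)) g
      = a i * ip M (f i) g + 1 * ip M (\<lambda>x. \<Sum>i\<in>I. a i * f i x) g"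
    using insert by (intro ip_lincomb_left L2on_sum) auto
  then show ?case using insert by simp
qed

lemma ip_sum_right:
  assumes "finite I" "\<And>i. i \<in> I \<Longrightarrow> f i \<in> L2on M" "g \<in> L2on M"
  shows "ip M g (\<lambda>x. \<Sum>i\<in>I. a i * f i x) = (\<Sum>i\<in>I. cnj (a i) * ip M g (f i))"
proof -
  have "ip M g (\<lambda>x. \<Sum>i\<in>I. a i * f i x) = cnj (\<Sum>i\<in>I. a i * ip M (f i) g)"
    by (subst ip_sym) (simp only: ip_sum_left[OF assms])
  also have "\<dots> = (\<Sum>i\<in>I. cnj (a i) * cnj (ip M (f i) g))"
    by simp
  finally show ?thesis by (simp only: ip_sym[of M g])
qed

lemma borel_measurable_cis [measurable]: "cis \<in> borel_measurable borel"
  by (rule borel_measurable_continuous_onI) (auto intro: continuous_intros)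

lemma has_bochner_integral_cis:
  "has_bochner_integral lborel (\<lambda>t. indicator {0..2 * pi} t *\<^sub>R cis (of_int m * t))
     (if m = 0 then 2 * pi else 0)"
proof (cases "m = 0")
  case True
  have "has_bochner_integral lborel (\<lambda>t. indicator {0..2 * pi} t *\<^sub>R (1::complex))
     (complex_of_real (2 * pi) - complex_of_real 0)"
    by (rule has_bochner_integral_FTC_Icc)
      (auto intro!: derivative_eq_intros has_vector_derivative_of_real)
  then show ?thesis using True by simp
next
  case False
  define F where "F t = cis (of_int m * t) / (\<i> * of_int m)" for t :: real
  have "has_bochner_integral lborel (\<lambda>t. indicator {0..2 * pi} t *\<^sub>R cis (of_int m * t)) (F (2 * pi) - F 0)"
  proof (rule has_bochner_integral_FTC_Icc)
    show "(F has_vector_derivative cis (of_int m * t)) (at t within {0..2 * pi})" for t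
    proof -
      have "((\<lambda>z. exp ((\<i> * of_int m) * z) / (\<i> * of_int m)) has_field_derivative
          exp ((\<i> * of_int m) * of_real t)) (at (of_real t))"
        using False by (auto intro!: derivative_eq_intros)
      from has_vector_derivative_real_field[OF this, of "{0..2 * pi}"]
      have "((\<lambda>t. exp ((\<i> * of_int m) * of_real t) / (\<i> * of_int m)) has_vector_derivative
          exp ((\<i> * of_int m) * of_real t)) (at t within {0..2 * pi})" .
      then show ?thesis by (simp add: F_def[abs_def] cis_conv_exp mult.assoc)
    qed
  qed (auto intro!: continuous_intros)
  moreover have "cis (of_int m * (2 * pi)) = 1"
    by (metis cis_2pi cis_power_int power_int_1_left)
  ultimately show ?thesis using False by (simp add: F_def)
qed

lemma stationary_measure_nonneg:
  fixes e :: "int \<Rightarrow> 'a \<Rightarrow> complex"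
  assumes e: "\<And>n. e n \<in> L2on N" and stat: "\<And>a b. ip N (e a) (e b) = r (a - b)" and r0: "r 0 = 1"
  obtains M :: "real measure" where "real_distribution M" "\<And>m::nat. (LINT t|M. cis (m * t)) = r (int m)"
proof -
  define p where "p n t = nsq N (\<lambda>x. \<Sum>k<Suc n. cnj (cis (k * t)) * e (int k) x) / (2 * pi * Suc n)"
    for n and t :: real
  define q where "q n t = indicator {0..2 * pi} t * p n t" for n t
  have p_nonneg: "0 \<le> p n t" for n t by (simp add: p_def nsq_nonneg)
  have q_nonneg: "0 \<le> q n t" for n t by (simp add: q_def p_nonneg)
  have p_eq: "of_real (p n t) = (\<Sum>j<Suc n. \<Sum>k<Suc n. r (int j - int k) / (2 * pi * Suc n) * cis ((int k - int j) * t))" for n and t :: real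
  proof -
    have "of_real (nsq N (\<lambda>x. \<Sum>k<Suc n. cnj (cis (k * t)) * e (int k) x))
        = (\<Sum>j<Suc n. cnj (cis (j * t)) * (\<Sum>k<Suc n. cis (k * t) * r (int j - int k)))"
      unfolding ip_self[symmetric]
      by (subst ip_sum_left) (simp_all add: e L2on_sum ip_sum_right stat del: sum.lessThan_Suc)
    also have "\<dots> = (\<Sum>j<Suc n. \<Sum>k<Suc n. r (int j - int k) * cis ((int k - int j) * t))"
      unfolding sum_distrib_left
      by (intro sum.cong refl) (simp add: cis_cnj cis_mult algebra_simps)
    finally show ?thesis
      by (simp add: p_def sum_divide_distrib del: sum.lessThan_Suc)
  qed
  have q_int: "has_bochner_integral lborel (\<lambda>t::real. q n t *\<^sub>R cis (m * t))
      ((\<Sum>j<Suc n. \<Sum>k<Suc n. if int m + int k - int j = 0 then r (int j - int k) else 0) / Suc n)" for n m :: nat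
  proof -
    have "has_bochner_integral lborel
       (\<lambda>t::real. \<Sum>j<Suc n. \<Sum>k<Suc n. r (int j - int k) / (2 * pi * Suc n) *
          (indicator {0..2 * pi} t *\<^sub>R cis (of_int (int m + int k - int j) * t)))
       (\<Sum>j<Suc n. \<Sum>k<Suc n. r (int j - int k) / (2 * pi * Suc n) * (if int m + int k - int j = 0 then 2 * pi else 0))"
      by (intro has_bochner_integral_sum has_bochner_integral_mult_right has_bochner_integral_cis)
    also have "(\<lambda>t::real. \<Sum>j<Suc n. \<Sum>k<Suc n. r (int j - int k) / (2 * pi * Suc n) *
          (indicator {0..2 * pi} t *\<^sub>R cis (of_int (int m + int k - int j) * t))) = (\<lambda>t::real. q n t *\<^sub>R cis (m * t))"
    proof (rule ext)
      fix t :: real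
      have "q n t *\<^sub>R cis (m * t) = indicator {0..2 * pi} t *\<^sub>R (of_real (p n t) * cis (m * t))"
        by (simp add: q_def scaleR_conv_of_real)
      also have "\<dots> = (\<Sum>j<Suc n. \<Sum>k<Suc n. r (int j - int k) / (2 * pi * Suc n) *
          (indicator {0..2 * pi} t *\<^sub>R cis (of_int (int m + int k - int j) * t)))"
        unfolding p_eq sum_distrib_right scaleR_sum_right
        by (intro sum.cong refl) (simp add: cis_mult algebra_simps scaleR_conv_of_real)
      finally show "(\<Sum>j<Suc n. \<Sum>k<Suc n. r (int j - int k) / (2 * pi * Suc n) *
          (indicator {0..2 * pi} t *\<^sub>R cis (of_int (int m + int k - int j) * t))) = q n t *\<^sub>R cis (m * t)" ..
    qed
    also have "(\<Sum>j<Suc n. \<Sum>k<Suc n. r (int j - int k) / (2 * pi * Suc n) * (if int m + int k - int j = 0 then 2 * pi else 0))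
       = (\<Sum>j<Suc n. \<Sum>k<Suc n. if int m + int k - int j = 0 then r (int j - int k) else 0) / Suc n"
      unfolding sum_divide_distrib by (intro sum.cong refl) (simp del: of_nat_Suc)
    finally show ?thesis .
  qed
  have count: "(\<Sum>j<Suc n. \<Sum>k<Suc n. if int m + int k - int j = 0 then r (int j - int k) else 0)
      = of_nat (Suc n - m) * r (int m)" for n m :: nat
  proof -
    have "(\<Sum>k<Suc n. if int m + int k - int j = 0 then r (int j - int k) else 0) = (if m \<le> j then r (int m) else 0)"
      if "j < Suc n" for j
    proof -
      have "(\<Sum>k<Suc n. if int m + int k - int j = 0 then r (int j - int k) else 0)
          = (\<Sum>k<Suc n. if m \<le> j \<and> k = j - m then r (int m) else 0)"
        by (intro sum.cong refl if_cong arg_cong[of _ _ r]) auto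
      also have "\<dots> = (if m \<le> j then r (int m) else 0)"
        using that by (cases "m \<le> j") (auto simp: sum.delta less_imp_diff_less simp del: sum.lessThan_Suc)
      finally show ?thesis .
    qed
    then have "(\<Sum>j<Suc n. \<Sum>k<Suc n. if int m + int k - int j = 0 then r (int j - int k) else 0)
       = (\<Sum>j<Suc n. if m \<le> j then r (int m) else 0)"
      by (intro sum.cong) auto
    also have "\<dots> = (\<Sum>j\<in>{m..<Suc n}. r (int m))"
      by (rule sum.mono_neutral_cong_right) auto
    finally show ?thesis by simp
  qed
  define \<mu> where "\<mu> n = density lborel (\<lambda>t. ennreal (q n t))" for n
  have q_int0: "has_bochner_integral lborel (\<lambda>t. complex_of_real (q n t)) 1" for n
    using q_int[of n 0] unfolding count by (simp add: r0 scaleR_conv_of_real del: of_nat_Suc)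
  have q_intR: "has_bochner_integral lborel (q n) 1" for n
    using has_bochner_integral_Re[OF q_int0[of n]] by simp
  have [measurable]: "q n \<in> borel_measurable borel" for n
    using borel_measurable_has_bochner_integral[OF q_intR[of n]] by simp
  have prob: "prob_space (\<mu> n)" for n
  proof
    have "emeasure (\<mu> n) (space (\<mu> n)) = (\<integral>\<^sup>+t. ennreal (q n t) \<partial>lborel)"
      by (simp add: \<mu>_def emeasure_density)
    also have "\<dots> = ennreal (LINT t|lborel. q n t)"
      using q_intR[of n] by (intro nn_integral_eq_integral) (auto simp: q_nonneg has_bochner_integral_iff)
    finally show "emeasure (\<mu> n) (space (\<mu> n)) = 1"
      using q_intR[of n] by (simp add: has_bochner_integral_iff)
  qed
  have distr: "real_distribution (\<mu> n)" for n
    using prob[of n] by (auto simp: real_distribution_def real_distribution_axioms_def \<mu>_def)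
  have "tight \<mu>"
    unfolding tight_def
  proof (intro conjI allI impI distr)
    fix \<epsilon> :: real assume "\<epsilon> > 0"
    have "measure (\<mu> n) {-1<..2 * pi} = 1" for n
    proof -
      interpret prob_space "\<mu> n" by (rule prob)
      have "AE t in \<mu> n. t \<in> {-1<..2 * pi}"
        unfolding \<mu>_def by (subst AE_density, measurable) (auto simp: q_def indicator_def)
      then show ?thesis by (subst prob_eq_1) (auto simp: \<mu>_def)
    qed
    then show "\<exists>a b. a < b \<and> (\<forall>n. measure (\<mu> n) {a<..b} > 1 - \<epsilon>)"
      using \<open>\<epsilon> > 0\<close> by (intro exI[of _ "-1"] exI[of _ "2 * pi"]) (auto intro: less_trans[of _ 0])
  qed
  from tight_imp_convergent_subsubsequence[OF this strict_mono_id]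
  obtain s M where s: "strict_mono s" and M: "real_distribution M" and conv: "weak_conv_m (\<mu> \<circ> s) M"
    by auto
  have "(LINT t|M. cis (m * t)) = r (int m)" for m :: nat
  proof -
    have lim1: "(\<lambda>n. LINT t|(\<mu> \<circ> s) n. cis (m * t)) \<longlonglongrightarrow> (LINT t|M. cis (m * t))"
    proof (rule weak_conv_imp_integral_bdd_continuous_conv[where B=1, OF _ M conv])
      have "continuous_on UNIV (\<lambda>t::real. cis (real m * t))" by (intro continuous_intros)
      then show "isCont (\<lambda>t. cis (real m * t)) t" for t
        by (simp add: continuous_on_eq_continuous_at)
    qed (simp_all add: distr)
    have "(LINT t|\<mu> n. cis (m * t)) = of_nat (Suc n - m) * r (int m) / Suc n" for n
    proof -
      have "(LINT t|\<mu> n. cis (m * t)) = (LINT t|lborel. q n t *\<^sub>R cis (m * t))"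
        unfolding \<mu>_def by (rule integral_density) (auto simp: q_nonneg)
      also have "\<dots> = of_nat (Suc n - m) * r (int m) / Suc n"
        using q_int[of n m] unfolding count by (simp add: has_bochner_integral_iff)
      finally show ?thesis .
    qed
    moreover have "(\<lambda>n. of_nat (Suc n - m) * r (int m) / Suc n) \<longlonglongrightarrow> r (int m)"
    proof (rule LIMSEQ_Suc)
      have "(\<lambda>n. r (int m) - of_nat m * r (int m) * (1 / of_nat n)) \<longlonglongrightarrow> r (int m) - of_nat m * r (int m) * 0"
        by (intro tendsto_intros lim_1_over_n)
      moreover have "\<forall>\<^sub>F n in sequentially. r (int m) - of_nat m * r (int m) * (1 / of_nat n) = of_nat (n - m) * r (int m) / of_nat n"
        using eventually_ge_at_top[of "Suc m"]
        by eventually_elim (simp add: field_simps of_nat_diff)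
      ultimately show "(\<lambda>n. of_nat (n - m) * r (int m) / of_nat n) \<longlonglongrightarrow> r (int m)"
        by (simp add: filterlim_cong)
    qed
    ultimately have "(\<lambda>n. LINT t|\<mu> n. cis (m * t)) \<longlonglongrightarrow> r (int m)" by simp
    from LIMSEQ_subseq_LIMSEQ[OF this s] lim1 show ?thesis
      by (auto intro!: LIMSEQ_unique simp: o_def)
  qed
  with M show thesis by (rule that)
qed

lemma stationary_spectral_measure:
  fixes e :: "int \<Rightarrow> 'a \<Rightarrow> complex"
  assumes e: "\<And>n. e n \<in> L2on N" and stat: "\<And>a b. ip N (e a) (e b) = r (a - b)"
    and norm: "nsq N (e 0) = 1"
  obtains M :: "complex measure" where "prob_space M" "sets M = sets borel" "AE z in M. cmod z = 1"
    "\<And>a b. ip M (\<lambda>z. z powi a) (\<lambda>z. z powi b) = ip N (e a) (e b)"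
proof -
  have "r 0 = 1" using stat[of 0 0] norm by (simp add: ip_self)
  from stationary_measure_nonneg[of e N r, OF e stat this]
  obtain M where M: "real_distribution M" and moments: "\<And>m::nat. (LINT t|M. cis (m * t)) = r (int m)" by blast
  interpret real_distribution M by (rule M)
  have [measurable]: "cis \<in> measurable M borel"
    using borel_measurable_cis by (simp add: measurable_cong_sets[OF events_eq_borel refl])
  define M' where "M' = distr M borel cis"
  have powi_meas: "(\<lambda>z::complex. z powi a) \<in> borel_measurable borel" for a
    unfolding power_int_def by measurable
  have eq: "ip M' (\<lambda>z. z powi a) (\<lambda>z. z powi b) = (LINT t|M. cis (of_int (a - b) * t))" for a b
  proof -
    note [measurable] = powi_meas
    have "ip M' (\<lambda>z. z powi a) (\<lambda>z. z powi b) = (LINT t|M. cis t powi a * cnj (cis t powi b))"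
      unfolding ip_def M'_def by (rule integral_distr) measurable
    also have "\<dots> = (LINT t|M. cis (of_int (a - b) * t))"
      by (intro Bochner_Integration.integral_cong refl) (simp add: cis_power_int cis_cnj cis_mult algebra_simps)
    finally show ?thesis .
  qed
  show thesis
  proof (rule that[of M'])
    show "prob_space M'" unfolding M'_def by (rule prob_space_distr) measurable
    show "sets M' = sets borel" by (simp add: M'_def)
    show "AE z in M'. cmod z = 1" unfolding M'_def by (subst AE_distr_iff) auto
    fix a b
    have *: "ip M' (\<lambda>z. z powi a) (\<lambda>z. z powi b) = ip N (e a) (e b)" if "b \<le> a" for a b
      using moments[of "nat (a - b)"] that by (simp add: eq stat)
    show "ip M' (\<lambda>z. z powi a) (\<lambda>z. z powi b) = ip N (e a) (e b)"
    proof (cases "b \<le> a")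
      case False
      then show ?thesis using *[of a b] by (subst (1 2) ip_sym) simp
    qed (rule *)
  qed
qed

section \<open>The resolvent and the Cayley transform\<close>

lemma L2_eq: "L2 = L2on lborel"
  by (simp add: L2_def L2on_def)

lemma l2_inner_eq: "l2_inner = ip lborel"
  by (intro ext) (simp add: l2_inner_def ip_def)

lemma l2_norm_eq: "l2_norm f = sqrt (nsq lborel f)"
  by (simp add: l2_norm_def nsq_def)

lemma in_dom_iff: "f \<in> fst mult_x \<longleftrightarrow> f \<in> L2on lborel \<and> (\<lambda>x. of_real x * f x) \<in> L2on lborel"
  by (auto simp: mult_x_def L2_eq L2on_def)

locale rank_one =
  fixes u :: cfun and \<alpha> :: real
  assumes u_L2: "u \<in> L2on lborel" and u_norm: "nsq lborel u = 1"
begin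

definition dom :: "cfun set" where
  "dom = fst (H_op u \<alpha>)"

definition H :: "cfun \<Rightarrow> cfun" where
  "H = snd (H_op u \<alpha>)"

lemma dom_iff: "f \<in> dom \<longleftrightarrow> f \<in> L2on lborel \<and> (\<lambda>x. of_real x * f x) \<in> L2on lborel"
  by (simp add: dom_def H_op_def in_dom_iff)

lemma H_apply: "H f x = of_real x * f x + of_real \<alpha> * ip lborel f u * u x"
  by (simp add: H_def H_op_def mult_x_def l2_inner_eq)

lemma dom_L2: "f \<in> dom \<Longrightarrow> f \<in> L2on lborel"
  by (simp add: dom_iff)

lemma H_L2:
  assumes "f \<in> dom"
  shows "H f \<in> L2on lborel"
  using L2on_lincomb[of "\<lambda>x. of_real x * f x" lborel u 1 "of_real \<alpha> * ip lborel f u"] assms u_L2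
  by (simp add: dom_iff H_apply[abs_def])

lemma dom_lincomb:
  assumes "f \<in> dom" "g \<in> dom"
  shows "(\<lambda>x. a * f x + b * g x) \<in> dom"
  using assms L2on_lincomb[of f lborel g a b]
    L2on_lincomb[of "\<lambda>x. of_real x * f x" lborel "\<lambda>x. of_real x * g x" a b]
  by (simp add: dom_iff algebra_simps)

lemma H_lincomb:
  assumes "f \<in> dom" "g \<in> dom"
  shows "H (\<lambda>x. a * f x + b * g x) x = a * H f x + b * H g x"
  using assms u_L2 by (simp add: H_apply ip_lincomb_left dom_iff algebra_simps)

lemma dom_cong_AE:
  assumes "f \<in> dom" "g \<in> borel_measurable lborel" "AE x in lborel. f x = g x"
  shows "g \<in> dom"
proof -
  have "g \<in> L2on lborel" using L2on_cong_AE[OF dom_L2[OF assms(1)] assms(2,3)] .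
  moreover have "(\<lambda>x. of_real x * g x) \<in> L2on lborel"
    by (rule L2on_cong_AE[of "\<lambda>x. of_real x * f x"]) (use assms in \<open>auto simp: dom_iff\<close>)
  ultimately show ?thesis by (simp add: dom_iff)
qed

lemma H_cong_AE:
  assumes "f \<in> dom" "g \<in> dom" "AE x in lborel. f x = g x"
  shows "AE x in lborel. H f x = H g x"
proof -
  have "ip lborel f u = ip lborel g u"
    using assms(3) by (intro ip_cong_AE L2onD(1)[OF dom_L2[OF assms(1)]] L2onD(1)[OF dom_L2[OF assms(2)]]
        L2onD(1)[OF u_L2]) auto
  with assms(3) show ?thesis by (auto simp: H_apply)
qed

lemma H_symmetric:
  assumes f: "f \<in> dom" and g: "g \<in> dom"
  shows "ip lborel (H f) g = ip lborel f (H g)"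
proof -
  note L = dom_iff[THEN iffD1, OF f] dom_iff[THEN iffD1, OF g]
  have "ip lborel (\<lambda>x. 1 * (of_real x * f x) + (of_real \<alpha> * ip lborel f u) * u x) g
      = 1 * ip lborel (\<lambda>x. of_real x * f x) g + (of_real \<alpha> * ip lborel f u) * ip lborel u g"
    using L u_L2 by (intro ip_lincomb_left) auto
  moreover have "ip lborel f (\<lambda>x. 1 * (of_real x * g x) + (of_real \<alpha> * ip lborel g u) * u x)
      = cnj 1 * ip lborel f (\<lambda>x. of_real x * g x) + cnj (of_real \<alpha> * ip lborel g u) * ip lborel f u"
    using L u_L2 by (intro ip_lincomb_right) auto
  moreover have "ip lborel (\<lambda>x. of_real x * f x) g = ip lborel f (\<lambda>x. of_real x * g x)"
    by (simp add: ip_def mult_ac)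
  ultimately show ?thesis
    by (simp add: H_apply[abs_def] ip_sym[of lborel g u] mult_ac)
qed

definition R0 :: "complex \<Rightarrow> cfun \<Rightarrow> cfun" where
  "R0 w g = (\<lambda>x. g x / (of_real x - w))"

definition F :: "complex \<Rightarrow> complex" where
  "F w = ip lborel (R0 w u) u"

definition kap :: "complex \<Rightarrow> cfun \<Rightarrow> complex" where
  "kap w g = of_real \<alpha> * ip lborel (R0 w g) u / (1 + of_real \<alpha> * F w)"

definition Rs :: "complex \<Rightarrow> cfun \<Rightarrow> cfun" where
  "Rs w g = (\<lambda>x. R0 w g x - kap w g * R0 w u x)"

lemma of_real_diff_ne: "Im w \<noteq> 0 \<Longrightarrow> of_real x - w \<noteq> 0"
  by (auto simp: complex_eq_iff)

lemma norm_resolvent_le: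
  assumes "Im w \<noteq> 0"
  shows "cmod (1 / (of_real x - w)) \<le> 1 / \<bar>Im w\<bar>"
proof -
  have "\<bar>Im w\<bar> \<le> cmod (of_real x - w)" using abs_Im_le_cmod[of "of_real x - w"] by simp
  then show ?thesis using assms by (simp add: norm_divide frac_le)
qed

lemma R0_L2:
  assumes "Im w \<noteq> 0" "g \<in> L2on lborel"
  shows "R0 w g \<in> L2on lborel"
proof -
  have "(\<lambda>x. (1 / (of_real x - w)) * g x) \<in> L2on lborel"
    by (rule L2on_mult_bounded[OF assms(2) _ norm_resolvent_le[OF assms(1)]]) simp
  then show ?thesis by (simp add: R0_def)
qed

lemma x_R0:
  assumes "Im w \<noteq> 0"
  shows "of_real x * R0 w g x = g x + w * R0 w g x"
  using of_real_diff_ne[OF assms, of x] by (simp add: R0_def field_simps)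

lemma R0_dom:
  assumes "Im w \<noteq> 0" "g \<in> L2on lborel"
  shows "R0 w g \<in> dom"
  using R0_L2[OF assms] L2on_lincomb[OF assms(2) R0_L2[OF assms], of 1 w]
  by (simp add: dom_iff x_R0[OF assms(1)])

lemma R0_lincomb: "R0 w (\<lambda>x. a * f x + b * g x) = (\<lambda>x. a * R0 w f x + b * R0 w g x)"
  by (simp add: R0_def add_divide_distrib)

lemma F_Im:
  assumes w: "Im w \<noteq> 0"
  shows "Im (F w) = Im w * nsq lborel (R0 w u)"
proof -
  have int: "integrable lborel (\<lambda>x. R0 w u x * cnj (u x))" by (rule L2on_prod[OF R0_L2[OF w u_L2] u_L2])
  have "Im (F w) = (LINT x|lborel. Im (R0 w u x * cnj (u x)))"
    unfolding F_def ip_def by (rule integral_Im[OF int, symmetric])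
  also have "\<dots> = (LINT x|lborel. Im w * (cmod (R0 w u x))\<^sup>2)"
  proof (rule Bochner_Integration.integral_cong[OF refl])
    fix x
    have "R0 w u x * cnj (u x) = R0 w u x * cnj (R0 w u x * (of_real x - w))"
      using of_real_diff_ne[OF w, of x] by (simp add: R0_def)
    also have "\<dots> = of_real ((cmod (R0 w u x))\<^sup>2) * cnj (of_real x - w)"
      by (simp only: complex_cnj_mult mult.assoc[symmetric] complex_norm_square)
    finally show "Im (R0 w u x * cnj (u x)) = Im w * (cmod (R0 w u x))\<^sup>2" by simp
  qed
  finally show ?thesis by (simp add: nsq_def)
qed

lemma F_ne:
  assumes w: "Im w \<noteq> 0"
  shows "1 + of_real \<alpha> * F w \<noteq> 0"
proof
  assume eq: "1 + of_real \<alpha> * F w = 0"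
  then have "\<alpha> * Im (F w) = 0" by (simp add: complex_eq_iff)
  moreover have "\<alpha> \<noteq> 0" using eq by auto
  ultimately have "nsq lborel (R0 w u) = 0" using w by (simp add: F_Im)
  then have "AE x in lborel. R0 w u x = 0" by (simp add: nsq_eq_0_iff[OF R0_L2[OF w u_L2]])
  then have "AE x in lborel. u x = 0"
    using of_real_diff_ne[OF w] by (auto simp: R0_def)
  then have "nsq lborel u = 0" by (simp add: nsq_eq_0_iff[OF u_L2])
  then show False by (simp add: u_norm)
qed

lemma Rs_dom:
  assumes "Im w \<noteq> 0" "g \<in> L2on lborel"
  shows "Rs w g \<in> dom"
  using dom_lincomb[OF R0_dom[OF assms] R0_dom[OF assms(1) u_L2], of 1 "- kap w g"] by (simp add: Rs_def)

lemma Rs_L2: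
  assumes "Im w \<noteq> 0" "g \<in> L2on lborel"
  shows "Rs w g \<in> L2on lborel"
  by (rule dom_L2[OF Rs_dom[OF assms]])

lemma H_Rs:
  assumes w: "Im w \<noteq> 0" and g: "g \<in> L2on lborel"
  shows "H (Rs w g) x = g x + w * Rs w g x"
proof -
  have "ip lborel (Rs w g) u = ip lborel (R0 w g) u - kap w g * F w"
    using ip_lincomb_left[OF R0_L2[OF w g] R0_L2[OF w u_L2] u_L2, of 1 "- kap w g"] by (simp add: Rs_def F_def)
  moreover have "kap w g * (1 + of_real \<alpha> * F w) = of_real \<alpha> * ip lborel (R0 w g) u"
    using F_ne[OF w] by (simp add: kap_def)
  ultimately have k: "of_real \<alpha> * ip lborel (Rs w g) u = kap w g"
    by (simp only: right_diff_distrib) (simp add: algebra_simps)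
  have "of_real x * Rs w g x = of_real x * R0 w g x - kap w g * (of_real x * R0 w u x)"
    by (simp add: Rs_def algebra_simps)
  also have "\<dots> = g x + w * Rs w g x - kap w g * u x"
    unfolding x_R0[OF w] by (simp add: Rs_def algebra_simps)
  finally show ?thesis by (simp add: H_apply k)
qed

lemma Rs_H:
  assumes w: "Im w \<noteq> 0" and f: "f \<in> dom"
  shows "Rs w (\<lambda>x. H f x - w * f x) = f"
proof -
  define a where "a = of_real \<alpha> * ip lborel f u"
  have R: "R0 w (\<lambda>x. H f x - w * f x) = (\<lambda>x. f x + a * R0 w u x)"
    using of_real_diff_ne[OF w] by (auto simp: R0_def H_apply a_def field_simps)
  have "ip lborel (\<lambda>x. f x + a * R0 w u x) u = ip lborel f u + a * F w"
    using ip_lincomb_left[OF dom_L2[OF f] R0_L2[OF w u_L2] u_L2, of 1 a] by (simp add: F_def)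
  also have "\<dots> = ip lborel f u * (1 + of_real \<alpha> * F w)" by (simp add: a_def algebra_simps)
  finally have "kap w (\<lambda>x. H f x - w * f x) = a"
    using F_ne[OF w] by (simp add: kap_def R a_def)
  then show ?thesis by (simp add: Rs_def R)
qed

lemma Rs_lincomb:
  assumes w: "Im w \<noteq> 0" and f: "f \<in> L2on lborel" and g: "g \<in> L2on lborel"
  shows "Rs w (\<lambda>x. a * f x + b * g x) = (\<lambda>x. a * Rs w f x + b * Rs w g x)"
proof -
  have "kap w (\<lambda>x. a * f x + b * g x) = a * kap w f + b * kap w g"
    unfolding kap_def R0_lincomb ip_lincomb_left[OF R0_L2[OF w f] R0_L2[OF w g] u_L2]
    by (simp add: add_divide_distrib algebra_simps)
  then show ?thesis by (simp add: Rs_def R0_lincomb algebra_simps)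
qed

text \<open>The Cayley transform \<open>(H - w)(H + w)\<^sup>-\<^sup>1\<close> for \<open>w = \<plusminus>\<i>\<close>.\<close>

definition V :: "complex \<Rightarrow> cfun \<Rightarrow> cfun" where
  "V w g = (\<lambda>x. g x - 2 * w * Rs (- w) g x)"

lemma V_L2:
  assumes "Im w \<noteq> 0" "g \<in> L2on lborel"
  shows "V w g \<in> L2on lborel"
  using L2on_lincomb[OF assms(2) Rs_L2[OF _ assms(2), of "- w"], of 1 "- (2 * w)"] assms(1) by (simp add: V_def)

lemma V_lincomb:
  assumes "Im w \<noteq> 0" "f \<in> L2on lborel" "g \<in> L2on lborel"
  shows "V w (\<lambda>x. a * f x + b * g x) = (\<lambda>x. a * V w f x + b * V w g x)"
  using assms by (simp add: V_def Rs_lincomb algebra_simps)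

lemma V_eq_H:
  assumes "Im w \<noteq> 0" "g \<in> L2on lborel"
  shows "V w g = (\<lambda>x. H (Rs (- w) g) x - w * Rs (- w) g x)"
  using assms by (simp add: V_def H_Rs mult.assoc)

lemma V_inverse:
  assumes w: "Im w \<noteq> 0" and g: "g \<in> L2on lborel"
  shows "V (- w) (V w g) = g"
proof -
  have w': "Im (- w) \<noteq> 0" using w by simp
  have "Rs w (V w g) = Rs (- w) g"
    unfolding V_eq_H[OF w g] by (rule Rs_H[OF w Rs_dom[OF w' g]])
  then show ?thesis by (simp add: V_def)
qed

lemma V_ip:
  assumes w: "Re w = 0" "Im w \<noteq> 0" and f: "f \<in> L2on lborel" and g: "g \<in> L2on lborel"
  shows "ip lborel (V w f) (V w g) = ip lborel f g"
proof -
  have w': "Im (- w) \<noteq> 0" and cw: "cnj w = - w" using w by (simp_all add: complex_eq_iff)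
  define f' where "f' = Rs (- w) f"
  define g' where "g' = Rs (- w) g"
  have d: "f' \<in> dom" "g' \<in> dom" unfolding f'_def g'_def by (rule Rs_dom[OF w' f], rule Rs_dom[OF w' g])
  note L = H_L2[OF d(1)] dom_L2[OF d(1)] H_L2[OF d(2)] dom_L2[OF d(2)]
  have Vf: "V w f = (\<lambda>x. 1 * H f' x + (- w) * f' x)" "V w g = (\<lambda>x. 1 * H g' x + (- w) * g' x)"
    unfolding V_eq_H[OF w(2) f] V_eq_H[OF w(2) g] by (simp_all add: f'_def g'_def)
  have fg: "f = (\<lambda>x. 1 * H f' x + w * f' x)" "g = (\<lambda>x. 1 * H g' x + w * g' x)"
    using H_Rs[OF w' f] H_Rs[OF w' g] by (simp_all add: f'_def g'_def fun_eq_iff)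
  have exp: "ip lborel (\<lambda>x. 1 * H f' x + a * f' x) (\<lambda>x. 1 * H g' x + b * g' x)
     = ip lborel (H f') (H g') + cnj b * ip lborel (H f') g' + a * ip lborel f' (H g') + a * cnj b * ip lborel f' g'" for a b
    unfolding ip_lincomb_left[OF L(1,2) L2on_lincomb[OF L(3,4)]] ip_lincomb_right[OF L(3,4) L(1)]
      ip_lincomb_right[OF L(3,4) L(2)] by (simp add: algebra_simps)
  have "ip lborel (V w f) (V w g) = ip lborel (\<lambda>x. 1 * H f' x + w * f' x) (\<lambda>x. 1 * H g' x + w * g' x)"
    unfolding Vf exp by (simp add: cw H_symmetric[OF d])
  then show ?thesis using fg by simp
qed

lemma V_nsq:
  assumes w: "Re w = 0" "Im w \<noteq> 0" and f: "f \<in> L2on lborel"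
  shows "nsq lborel (V w f) = nsq lborel f"
  using V_ip[OF w f f] by (simp add: ip_self)

lemma V_tendsto:
  assumes w: "Re w = 0" "Im w \<noteq> 0" and G: "\<And>n. G n \<in> L2on lborel" and g: "g \<in> L2on lborel"
    and lim: "l2_tendsto lborel G g"
  shows "l2_tendsto lborel (\<lambda>n. V w (G n)) (V w g)"
proof -
  have "nsq lborel (\<lambda>x. V w (G n) x - V w g x) = nsq lborel (\<lambda>x. G n x - g x)" for n
    using V_nsq[OF w L2on_diff[OF G[of n] g]] V_lincomb[OF w(2) G[of n] g, of 1 "-1"] by simp
  then show ?thesis using lim by (simp add: l2_tendsto_def)
qed

end

section \<open>Spectral representation when the vector is cyclic\<close>

definition spectral_model ::
    "'a measure \<Rightarrow> ('a \<Rightarrow> real) \<Rightarrow> (('a \<Rightarrow> complex) \<Rightarrow> cfun \<Rightarrow> bool) \<Rightarrow> l2_op \<Rightarrow> bool" where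
  "spectral_model M c W T \<longleftrightarrow> unitary_rel M lborel W \<and> c \<in> borel_measurable M \<and>
     (\<forall>h f. W h f \<longrightarrow> (f \<in> fst T \<longleftrightarrow> (\<lambda>z. of_real (c z) * h z) \<in> L2on M)) \<and>
     (\<forall>h f. W h f \<longrightarrow> f \<in> fst T \<longrightarrow> W (\<lambda>z. of_real (c z) * h z) (snd T f))"

lemma (in rank_one) closed_hull_mult:
  fixes M :: "'a measure"
  assumes B: "\<And>h f. B h f \<Longrightarrow> h \<in> L2on M \<and> f \<in> L2on lborel"
    and iso: "iso_rel M lborel (closed_hull M lborel B)"
    and w: "Re w = 0" "Im w \<noteq> 0" and p: "p \<in> borel_measurable M" "\<And>z. cmod (p z) \<le> 1"
    and base: "\<And>h f. B h f \<Longrightarrow> closed_hull M lborel B (\<lambda>z. p z * h z) (V w f)"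
    and h: "closed_hull M lborel B h f"
  shows "closed_hull M lborel B (\<lambda>z. p z * h z) (V w f)"
  using h
proof induction
  case (base h f)
  then show ?case by (rule assms(7))
next
  case (lin h f h' f' a b)
  note L = iso_relD(2)[OF iso, OF lin.hyps(1)] iso_relD(2)[OF iso, OF lin.hyps(2)]
  have "closed_hull M lborel B (\<lambda>z. a * (p z * h z) + b * (p z * h' z)) (\<lambda>x. a * V w f x + b * V w f' x)"
    by (rule closed_hull.lin[OF lin.IH])
  then show ?case by (simp add: V_lincomb[OF w(2) L] algebra_simps)
next
  case (lim h' f' h f)
  have L: "h' n \<in> L2on M" "f' n \<in> L2on lborel" for n
    using iso_relD(1)[OF iso, OF lim.hyps(1)] iso_relD(2)[OF iso, OF lim.hyps(1)] .
  show ?case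
  proof (rule closed_hull.lim[OF lim.IH])
    show "(\<lambda>z. p z * h z) \<in> L2on M" by (rule L2on_mult_bounded[OF lim.hyps(2) p])
    show "V w f \<in> L2on lborel" by (rule V_L2[OF w(2) lim.hyps(3)])
    show "l2_tendsto M (\<lambda>n z. p z * h' n z) (\<lambda>z. p z * h z)"
      by (rule l2_tendsto_mult_bounded[OF L(1) lim.hyps(2) p lim.hyps(4)])
    show "l2_tendsto lborel (\<lambda>n. V w (f' n)) (V w f)"
      by (rule V_tendsto[OF w L(2) lim.hyps(3) lim.hyps(5)])
  qed
qed

locale cyclic_rank_one = rank_one +
  assumes u_nz: "AE x in lborel. u x \<noteq> 0"
begin

definition orbit :: "int \<Rightarrow> cfun" where
  "orbit n = (if 0 \<le> n then (V \<i> ^^ nat n) u else (V (-\<i>) ^^ nat (-n)) u)"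

lemma funpow_V_L2: "Im w \<noteq> 0 \<Longrightarrow> (V w ^^ n) u \<in> L2on lborel"
  by (induction n) (auto simp: u_L2 V_L2)

lemma orbit_L2: "orbit n \<in> L2on lborel"
  by (simp add: orbit_def funpow_V_L2)

lemma V_orbit: "V \<i> (orbit n) = orbit (n + 1)"
proof (cases "0 \<le> n")
  case True
  then have "nat (n + 1) = Suc (nat n)" by simp
  then show ?thesis using True by (simp add: orbit_def)
next
  case False
  define m where "m = nat (- n - 1)"
  have "nat (- n) = Suc m" using False by (simp add: m_def)
  then have "V \<i> (orbit n) = (V (-\<i>) ^^ m) u"
    using False V_inverse[of "-\<i>" "(V (-\<i>) ^^ m) u"] by (simp add: orbit_def funpow_V_L2)
  also have "\<dots> = orbit (n + 1)"
  proof (cases "n = -1")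
    case True
    then show ?thesis by (simp add: orbit_def m_def)
  next
    case False
    then have "nat (- (n + 1)) = m" "\<not> 0 \<le> n + 1" using \<open>\<not> 0 \<le> n\<close> by (simp_all add: m_def)
    then show ?thesis by (simp add: orbit_def)
  qed
  finally show ?thesis .
qed

lemma V_inv_orbit: "V (-\<i>) (orbit n) = orbit (n - 1)"
  using V_inverse[of "\<i>" "orbit (n - 1)"] V_orbit[of "n - 1"] by (simp add: orbit_L2)

lemma orbit_stationary: "ip lborel (orbit a) (orbit b) = ip lborel (orbit (a - b)) u"
proof -
  have step: "ip lborel (orbit (a + 1)) (orbit (b + 1)) = ip lborel (orbit a) (orbit b)" for a b
    unfolding V_orbit[symmetric] by (rule V_ip) (simp_all add: orbit_L2)
  have "ip lborel (orbit (d + b)) (orbit b) = ip lborel (orbit d) (orbit 0)" for d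
  proof (induction b rule: int_induct[of _ 0])
    case base
    then show ?case by simp
  next
    case (step1 b)
    then show ?case using step[of "d + b" b] by (simp add: add.assoc)
  next
    case (step2 b)
    then show ?case using step[of "d + (b - 1)" "b - 1"] by (simp add: algebra_simps)
  qed
  from this[of "a - b"] show ?thesis by (simp add: orbit_def[of 0])
qed

text \<open>A closed subspace containing \<open>u\<close> and invariant under both Cayley transforms is invariant
  under both resolvents of multiplication by \<open>x\<close>, so it contains all bounded multiples of \<open>u\<close>.\<close>

lemma invariant_subspace_eq:
  assumes Q: "closed_lin lborel Q" and uQ: "u \<in> Q"
    and inv: "\<And>f. f \<in> Q \<Longrightarrow> V \<i> f \<in> Q" "\<And>f. f \<in> Q \<Longrightarrow> V (-\<i>) f \<in> Q"
    and f: "f \<in> L2on lborel"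
  shows "f \<in> Q"
proof -
  have inv': "V w g \<in> Q" if "g \<in> Q" "w = \<i> \<or> w = -\<i>" for g w using that inv by auto
  have RsQ: "Rs (- w) g \<in> Q" if g: "g \<in> Q" and w: "w = \<i> \<or> w = -\<i>" for g w
  proof -
    have w0: "w \<noteq> 0" using w by auto
    have "(\<lambda>x. (1 / (2 * w)) * g x + (- 1 / (2 * w)) * V w g x) \<in> Q"
      by (rule closed_linD(2)[OF Q g inv'[OF g w]])
    moreover have "(\<lambda>x. (1 / (2 * w)) * g x + (- 1 / (2 * w)) * V w g x) = Rs (- w) g"
      using w0 by (auto simp: V_def fun_eq_iff field_simps)
    ultimately show ?thesis by simp
  qed
  have R0u: "R0 (- w) u \<in> Q" if w: "w = \<i> \<or> w = -\<i>" for w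
  proof -
    have "Im (- w) \<noteq> 0" using w by auto
    note ne = F_ne[OF this]
    have "(\<lambda>x. (1 + of_real \<alpha> * F (- w)) * Rs (- w) u x) \<in> Q"
      by (rule closed_lin_scale[OF Q RsQ[OF uQ w]])
    moreover have "(1 + of_real \<alpha> * F (- w)) * Rs (- w) u x = R0 (- w) u x" for x
    proof -
      have "(1 + of_real \<alpha> * F (- w)) * kap (- w) u = of_real \<alpha> * F (- w)"
        using ne by (simp add: kap_def F_def)
      then have "(1 + of_real \<alpha> * F (- w)) * Rs (- w) u x
        = (1 + of_real \<alpha> * F (- w)) * R0 (- w) u x - (of_real \<alpha> * F (- w)) * R0 (- w) u x"
        by (simp only: Rs_def right_diff_distrib mult.assoc[symmetric])
      then show ?thesis by (simp add: algebra_simps)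
    qed
    ultimately show ?thesis by simp
  qed
  have R0Q: "R0 (- w) g \<in> Q" if g: "g \<in> Q" and w: "w = \<i> \<or> w = -\<i>" for g w
  proof -
    have "(\<lambda>x. 1 * Rs (- w) g x + kap (- w) g * R0 (- w) u x) \<in> Q"
      by (rule closed_linD(2)[OF Q RsQ[OF g w] R0u[OF w]])
    then show ?thesis by (simp add: Rs_def)
  qed
  define m where "m x = (of_real x - \<i>) / (of_real x + \<i>)" for x :: real
  have ne: "of_real x + \<i> \<noteq> 0" "of_real x - \<i> \<noteq> 0" for x :: real by (auto simp: complex_eq_iff)
  have m_unit: "cmod (m x) = 1" for x
  proof -
    have "cmod (of_real x - \<i>) = cmod (of_real x + \<i>)" by (simp add: cmod_def)
    then show ?thesis using ne by (simp add: m_def norm_divide)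
  qed
  have cnj_m: "cnj (m x) = (of_real x + \<i>) / (of_real x - \<i>)" for x by (simp add: m_def)
  have mQ: "(\<lambda>x. m x * g x) \<in> Q" if g: "g \<in> Q" for g
  proof -
    have "(\<lambda>x. 1 * g x + (- 2 * \<i>) * R0 (- \<i>) g x) \<in> Q"
      by (rule closed_linD(2)[OF Q g R0Q[OF g]]) simp
    moreover have "1 * g x + (- 2 * \<i>) * R0 (- \<i>) g x = m x * g x" for x
      using ne[of x] by (simp add: R0_def m_def field_simps)
    ultimately show ?thesis by simp
  qed
  have mQ': "(\<lambda>x. cnj (m x) * g x) \<in> Q" if g: "g \<in> Q" for g
  proof -
    have "(\<lambda>x. 1 * g x + (2 * \<i>) * R0 (- (- \<i>)) g x) \<in> Q"
      by (rule closed_linD(2)[OF Q g R0Q[OF g]]) simp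
    moreover have "1 * g x + (2 * \<i>) * R0 (- (- \<i>)) g x = cnj (m x) * g x" for x
      using ne[of x] unfolding cnj_m by (simp add: R0_def field_simps)
    ultimately show ?thesis by simp
  qed
  define \<nu> where "\<nu> = density lborel (\<lambda>x. ennreal ((cmod (u x))\<^sup>2))"
  have um [measurable]: "u \<in> borel_measurable borel" using L2onD(1)[OF u_L2] by simp
  have \<nu>_sets [simp]: "sets \<nu> = sets borel" by (simp add: \<nu>_def)
  have \<nu>_meas [simp]: "borel_measurable \<nu> = borel_measurable borel"
    by (rule measurable_cong_sets) simp_all
  have nsq_\<nu>: "nsq \<nu> h = nsq lborel (\<lambda>x. h x * u x)" if [measurable]: "h \<in> borel_measurable borel" for h
    unfolding nsq_def \<nu>_def by (subst integral_density) (auto simp: norm_mult power_mult_distrib mult.commute)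
  have L2_\<nu>: "h \<in> L2on \<nu> \<longleftrightarrow> h \<in> borel_measurable borel \<and> (\<lambda>x. h x * u x) \<in> L2on lborel" for h
  proof (cases "h \<in> borel_measurable borel")
    case True
    note [measurable] = True
    have "integrable \<nu> (\<lambda>x. (cmod (h x))\<^sup>2) \<longleftrightarrow> integrable lborel (\<lambda>x. (cmod (h x * u x))\<^sup>2)"
      unfolding \<nu>_def by (subst integrable_density) (auto simp: norm_mult power_mult_distrib mult.commute)
    then show ?thesis using True by (simp add: L2on_def)
  qed (simp add: L2on_def)
  define D where "D = {h \<in> L2on \<nu>. (\<lambda>x. h x * u x) \<in> Q}"
  have "closed_lin \<nu> D"
    unfolding closed_lin_def
  proof (intro conjI ballI allI impI)
    show "D \<subseteq> L2on \<nu>" by (auto simp: D_def)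
  next
    fix h h' a b assume "h \<in> D" "h' \<in> D"
    then show "(\<lambda>x. a * h x + b * h' x) \<in> D"
      using closed_linD(2)[OF Q, of "\<lambda>x. h x * u x" "\<lambda>x. h' x * u x" a b]
      by (auto simp: D_def algebra_simps intro: L2on_lincomb)
  next
    fix h' h assume h': "\<forall>n. h' n \<in> D" and h: "h \<in> L2on \<nu>" and lim: "l2_tendsto \<nu> h' h"
    have "(\<lambda>x. h' n x - h x) \<in> borel_measurable borel" for n
      using L2onD(1)[OF L2on_diff[of "h' n" \<nu> h]] h' h by (simp add: D_def)
    then have "l2_tendsto lborel (\<lambda>n x. h' n x * u x) (\<lambda>x. h x * u x)"
      using lim by (simp add: l2_tendsto_def nsq_\<nu> algebra_simps)
    then have "(\<lambda>x. h x * u x) \<in> Q"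
      using closed_linD(3)[OF Q, of "\<lambda>n x. h' n x * u x" "\<lambda>x. h x * u x"] h' h by (auto simp: D_def L2_\<nu>)
    then show "h \<in> D" using h by (simp add: D_def)
  qed
  note D = this
  define c where "c z = Re (\<i> * (1 + z) / (1 - z))" for z
  have c_m: "c (m x) = x" for x
  proof -
    have m: "1 - m x = 2 * \<i> / (of_real x + \<i>)" "1 + m x = 2 * of_real x / (of_real x + \<i>)"
      using ne[of x] by (simp_all add: m_def field_simps)
    have "\<i> * (1 + m x) / (1 - m x) = of_real x"
      unfolding m using ne(1)[of x] by simp
    then show ?thesis by (simp add: c_def)
  qed
  have [measurable]: "c \<in> borel_measurable borel" unfolding c_def by measurable
  have m_meas: "m \<in> borel_measurable borel" unfolding m_def by measurable
  have fin: "finite_measure \<nu>"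
  proof
    have "emeasure \<nu> (space \<nu>) = (\<integral>\<^sup>+x. ennreal ((cmod (u x))\<^sup>2) \<partial>lborel)"
      by (simp add: \<nu>_def emeasure_density)
    also have "\<dots> < \<infinity>" using L2onD(2)[OF u_L2] by (simp add: nn_integral_eq_integral)
    finally show "emeasure \<nu> (space \<nu>) \<noteq> \<infinity>" by simp
  qed
  define h where "h x = f x / u x" for x
  have fm [measurable]: "f \<in> borel_measurable borel" using L2onD(1)[OF f] by simp
  have [measurable]: "h \<in> borel_measurable borel" unfolding h_def by measurable
  have hf: "AE x in lborel. f x = h x * u x" using u_nz by eventually_elim (simp add: h_def)
  have hu: "(\<lambda>x. h x * u x) \<in> L2on lborel" by (rule L2on_cong_AE[OF f _ hf]) simp
  have "h \<in> D"
  proof (rule circle_dense[of \<nu> m D, OF fin _ _ D])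
    show "m \<in> borel_measurable \<nu>" using m_meas by simp
    show "AE x in \<nu>. cmod (m x) = 1" using m_unit by simp
    show "(\<lambda>x. 1) \<in> D" using uQ u_L2 by (simp add: D_def L2_\<nu>)
    show "(\<lambda>x. m x * g x) \<in> D" if "g \<in> D" for g
    proof -
      have "(\<lambda>x. m x * g x) \<in> L2on \<nu>"
        using that m_meas m_unit by (intro L2on_mult_bounded[where C=1]) (auto simp: D_def)
      then show ?thesis using that mQ[of "\<lambda>x. g x * u x"] by (simp add: D_def mult.assoc)
    qed
    show "(\<lambda>x. cnj (m x) * g x) \<in> D" if "g \<in> D" for g
    proof -
      have "(\<lambda>x. cnj (m x) * g x) \<in> L2on \<nu>"
        using that m_meas m_unit by (intro L2on_mult_bounded[where C=1] measurable_cnj) (auto simp: D_def)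
      then show ?thesis using that mQ'[of "\<lambda>x. g x * u x"] by (simp add: D_def mult.assoc)
    qed
    show "\<exists>B\<in>sets borel. AE x in \<nu>. m x \<in> B \<longleftrightarrow> x \<in> A" if "A \<in> sets \<nu>" for A
    proof (rule bexI[of _ "c -` A"])
      show "AE x in \<nu>. m x \<in> c -` A \<longleftrightarrow> x \<in> A" by (simp add: c_m)
      show "c -` A \<in> sets borel" using that by (auto intro: measurable_sets_borel[of c borel])
    qed
    show "h \<in> L2on \<nu>" using hu by (simp add: L2_\<nu>)
  qed
  then have "(\<lambda>x. h x * u x) \<in> Q" by (simp add: D_def)
  then show "f \<in> Q"
    by (rule closed_lin_cong_AE[OF Q]) (use hf in auto)
qed

end

lemma unitary_relD:
  assumes "unitary_rel M N R"
  shows "iso_rel M N R" and "f \<in> L2on M \<Longrightarrow> \<exists>g. R f g" and "g \<in> L2on N \<Longrightarrow> \<exists>f. R f g"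
  using assms by (simp_all add: unitary_rel_def)

context cyclic_rank_one
begin

lemma cayley_representation:
  obtains M :: "complex measure" and v W where "prob_space M" "sets M = sets borel"
    "v \<in> borel_measurable M" "\<And>z. cmod (v z) = 1" "unitary_rel M lborel W" "W (\<lambda>z. 1) u"
    "\<And>h f. W h f \<Longrightarrow> W (\<lambda>z. v z * h z) (V \<i> f)"
proof -
  have "nsq lborel (orbit 0) = 1" by (simp add: orbit_def u_norm)
  from stationary_spectral_measure[of orbit lborel "\<lambda>n. ip lborel (orbit n) u", OF orbit_L2 orbit_stationary this]
  obtain M :: "complex measure" where M: "prob_space M" and sM: "sets M = sets borel"
    and circ: "AE z in M. cmod z = 1"
    and ipM: "\<And>a b. ip M (\<lambda>z. z powi a) (\<lambda>z. z powi b) = ip lborel (orbit a) (orbit b)" by blast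
  interpret prob_space M by (rule M)
  define v :: "complex \<Rightarrow> complex" where "v z = (if cmod z = 1 then z else 1)" for z
  have v1: "cmod (v z) = 1" for z by (simp add: v_def)
  have v0: "v z \<noteq> 0" for z using v1[of z] by (metis norm_zero zero_neq_one)
  have meas: "borel_measurable M = (borel_measurable borel :: (complex \<Rightarrow> complex) set)"
    by (rule measurable_cong_sets[OF sM refl])
  have v_meas [measurable]: "v \<in> borel_measurable borel" unfolding v_def[abs_def] by measurable
  have powi_meas [measurable]: "(\<lambda>z::complex. z powi a) \<in> borel_measurable borel" for a
    unfolding power_int_def by measurable
  have vp_meas: "(\<lambda>z. v z powi n) \<in> borel_measurable M" for n
    unfolding meas by (rule measurable_compose[OF v_meas powi_meas])
  have vp_L2: "(\<lambda>z. v z powi n) \<in> L2on M" for n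
    by (rule L2on_bounded[OF vp_meas, of _ 1]) (simp add: norm_power_int v1)
  have ipv: "ip M (\<lambda>z. v z powi a) (\<lambda>z. v z powi b) = ip lborel (orbit a) (orbit b)" for a b
    unfolding ipM[symmetric]
    by (rule ip_cong_AE) (use circ vp_meas powi_meas in \<open>auto simp: meas v_def\<close>)
  define B where "B h f \<longleftrightarrow> (\<exists>n. h = (\<lambda>z. v z powi n) \<and> f = orbit n)" for h f
  have BL: "h \<in> L2on M \<and> f \<in> L2on lborel" if "B h f" for h f
    using that by (auto simp: B_def vp_L2 orbit_L2)
  define W where "W = closed_hull M lborel B"
  have iso: "iso_rel M lborel W"
    unfolding W_def by (rule iso_rel_hull[OF BL]) (auto simp: B_def ipv)
  have base: "W (\<lambda>z. v z powi n) (orbit n)" for n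
    unfolding W_def by (rule closed_hull.base) (auto simp: B_def)
  have shift: "W (\<lambda>z. v z * h z) (V \<i> f)" if "W h f" for h f
    unfolding W_def
  proof (rule closed_hull_mult[OF BL iso[unfolded W_def] _ _ _ _ _ that[unfolded W_def]])
    show "closed_hull M lborel B (\<lambda>z. v z * h z) (V \<i> f)" if Bhf: "B h f" for h f
    proof -
      obtain n where n: "h = (\<lambda>z. v z powi n)" "f = orbit n" using Bhf by (auto simp: B_def)
      have "(\<lambda>z. v z * h z) = (\<lambda>z. v z powi (n + 1))" by (simp add: n power_int_add v0 mult.commute)
      then show ?thesis using base[of "n + 1"] by (simp add: n V_orbit W_def)
    qed
  qed (simp_all add: v1 meas)
  have shift': "W (\<lambda>z. cnj (v z) * h z) (V (-\<i>) f)" if "W h f" for h f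
    unfolding W_def
  proof (rule closed_hull_mult[OF BL iso[unfolded W_def] _ _ _ _ _ that[unfolded W_def]])
    show "closed_hull M lborel B (\<lambda>z. cnj (v z) * h z) (V (-\<i>) f)" if Bhf: "B h f" for h f
    proof -
      obtain n where n: "h = (\<lambda>z. v z powi n)" "f = orbit n" using Bhf by (auto simp: B_def)
      have "cnj (v z) = 1 / v z" for z
        using v1[of z] v0[of z] complex_norm_square[of "v z"] by (simp add: field_simps)
      then have "(\<lambda>z. cnj (v z) * h z) = (\<lambda>z. v z powi (n - 1))"
        by (simp add: n power_int_diff v0)
      then show ?thesis using base[of "n - 1"] by (simp add: n V_inv_orbit W_def)
    qed
  qed (simp_all add: v1 meas)
  have one: "W (\<lambda>z. 1) u" using base[of 0] by (simp add: orbit_def)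
  have "\<exists>f. W h f" if h: "h \<in> L2on M" for h
  proof -
    have "h \<in> {h. \<exists>f. W h f}"
    proof (rule circle_dense[where M=M and v=v, OF _ _ _ iso_rel_domain_closed[OF iso]])
      show "finite_measure M" by (rule finite_measure_axioms)
      show "v \<in> borel_measurable M" by (simp add: meas)
      show "AE z in M. cmod (v z) = 1" by (simp add: v1)
      show "(\<lambda>z. 1) \<in> {h. \<exists>f. W h f}" using one by auto
      show "(\<lambda>z. v z * h z) \<in> {h. \<exists>f. W h f}" if "h \<in> {h. \<exists>f. W h f}" for h
        using that shift by auto
      show "(\<lambda>z. cnj (v z) * h z) \<in> {h. \<exists>f. W h f}" if "h \<in> {h. \<exists>f. W h f}" for h
        using that shift' by auto
      show "h \<in> L2on M" by (rule h)
      show "\<exists>B\<in>sets borel. AE z in M. v z \<in> B \<longleftrightarrow> z \<in> A" if "A \<in> sets M" for A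
        by (rule bexI[of _ A]) (use circ that in \<open>auto simp: v_def sM\<close>)
    qed
    then show ?thesis by simp
  qed
  moreover have "\<exists>h. W h f" if f: "f \<in> L2on lborel" for f
  proof -
    have "f \<in> {f. \<exists>h. W h f}"
    proof (rule invariant_subspace_eq[OF iso_rel_range_closed[OF iso] _ _ _ f])
      show "u \<in> {f. \<exists>h. W h f}" by (intro CollectI exI) (rule one)
      show "V \<i> f \<in> {f. \<exists>h. W h f}" if "f \<in> {f. \<exists>h. W h f}" for f
        using that by (elim CollectE exE, intro CollectI exI) (rule shift)
      show "V (-\<i>) f \<in> {f. \<exists>h. W h f}" if "f \<in> {f. \<exists>h. W h f}" for f
        using that by (elim CollectE exE, intro CollectI exI) (rule shift')
    qed
    then show ?thesis by simp
  qed
  ultimately have "unitary_rel M lborel W" using iso by (simp add: unitary_rel_def)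
  from that[OF M sM _ v1 this one shift] show thesis by (simp add: meas)
qed

lemma spectral_model_exists:
  obtains M :: "complex measure" and c W where "prob_space M" "sets M = sets borel"
    "spectral_model M c W (H_op u \<alpha>)" "W (\<lambda>z. 1) u"
proof -
  obtain M :: "complex measure" and v W where M: "prob_space M" and sM: "sets M = sets borel"
    and v_meas [measurable]: "v \<in> borel_measurable M" and v1: "\<And>z. cmod (v z) = 1"
    and uni: "unitary_rel M lborel W" and one: "W (\<lambda>z. 1) u"
    and shift: "\<And>h f. W h f \<Longrightarrow> W (\<lambda>z. v z * h z) (V \<i> f)"
    by (rule cayley_representation) blast
  interpret prob_space M by (rule M)
  note iso = unitary_relD(1)[OF uni]
  have no_atom: "AE z in M. v z \<noteq> 1"
  proof -
    define h where "h z = (if v z = 1 then 1 else 0 :: complex)" for z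
    have [measurable]: "h \<in> borel_measurable M" unfolding h_def[abs_def] by measurable
    have hL: "h \<in> L2on M" by (rule L2on_bounded[of _ 1]) (auto simp: h_def)
    then obtain g where g: "W h g" using unitary_relD(2)[OF uni] by auto
    have gL: "g \<in> L2on lborel" by (rule iso_relD(2)[OF iso, OF g])
    have vh: "(\<lambda>z. v z * h z) = h" by (auto simp: h_def)
    have "AE x in lborel. g x = V \<i> g x"
      by (rule iso_rel_unique[OF iso, OF g shift[OF g, unfolded vh]]) simp
    then have z: "AE x in lborel. Rs (-\<i>) g x = 0" by eventually_elim (simp add: V_def)
    have Rd: "Rs (-\<i>) g \<in> dom" by (rule Rs_dom[OF _ gL]) simp
    have "(\<lambda>x. 0) \<in> dom" by (simp add: dom_iff L2on_zero)
    from H_cong_AE[OF Rd this] z have "AE x in lborel. H (Rs (-\<i>) g) x = H (\<lambda>x. 0) x" by simp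
    then have "AE x in lborel. g x = 0"
      using z
    proof eventually_elim
      case (elim x)
      have "H (\<lambda>x. 0) x = 0" by (simp add: H_apply ip_def)
      then show ?case using H_Rs[of "-\<i>" g x] gL elim by simp
    qed
    then have "nsq lborel g = 0" by (simp add: nsq_eq_0_iff[OF gL])
    then have "nsq M h = 0" using iso_rel_nsq[OF iso, OF g] by simp
    then have "AE z in M. h z = 0" by (simp add: nsq_eq_0_iff[OF hL])
    then show ?thesis by eventually_elim (auto simp: h_def split: if_splits)
  qed
  define c where "c z = Re (\<i> * (1 + v z) / (1 - v z))" for z
  have [measurable]: "c \<in> borel_measurable M" unfolding c_def[abs_def] by measurable
  have c_eq: "(of_real (c z) + \<i>) * (1 - v z) = 2 * \<i>" if "v z \<noteq> 1" for z
  proof -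
    have v0: "v z \<noteq> 0" using v1[of z] by auto
    have "v z * cnj (v z) = 1" using complex_norm_square[of "v z"] v1[of z] by simp
    then have cv: "cnj (v z) = 1 / v z" using v0 by (simp add: field_simps)
    define q where "q = \<i> * (1 + v z) / (1 - v z)"
    have "cnj q = - \<i> * (1 + 1 / v z) / (1 - 1 / v z)" by (simp add: q_def cv)
    also have "\<dots> = q" using v0 that by (simp add: q_def divide_simps) (simp add: algebra_simps)
    finally have "Im q = 0" by (simp add: complex_eq_iff)
    then have "of_real (c z) = q" by (simp add: c_def q_def[symmetric] complex_eq_iff)
    then show ?thesis using that by (simp add: q_def field_simps)
  qed
  have res: "W (\<lambda>z. (1 - v z) / (2 * \<i>) * k z) (Rs (-\<i>) g)" if "W k g" for k g
  proof -
    have "W (\<lambda>z. 1 / (2 * \<i>) * k z + (- 1 / (2 * \<i>)) * (v z * k z))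
        (\<lambda>x. 1 / (2 * \<i>) * g x + (- 1 / (2 * \<i>)) * V \<i> g x)"
      by (rule iso_relD(3)[OF iso, OF that shift[OF that]])
    moreover have "(\<lambda>z. 1 / (2 * \<i>) * k z + (- 1 / (2 * \<i>)) * (v z * k z)) = (\<lambda>z. (1 - v z) / (2 * \<i>) * k z)"
      by (auto simp: fun_eq_iff field_simps)
    moreover have "(\<lambda>x. 1 / (2 * \<i>) * g x + (- 1 / (2 * \<i>)) * V \<i> g x) = Rs (-\<i>) g"
      by (auto simp: fun_eq_iff V_def field_simps)
    ultimately show ?thesis by simp
  qed
  have model1: "W (\<lambda>z. of_real (c z) * h z) (H f)" if h: "W h f" and f: "f \<in> dom" for h f
  proof -
    define g where "g x = 1 * H f x + \<i> * f x" for x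
    have gL: "g \<in> L2on lborel" unfolding g_def by (rule L2on_lincomb[OF H_L2[OF f] dom_L2[OF f]])
    have Rg: "Rs (-\<i>) g = f" using Rs_H[of "-\<i>" f] f by (simp add: g_def[abs_def])
    obtain k where k: "W k g" using unitary_relD(3)[OF uni gL] by auto
    have "AE z in M. h z = (1 - v z) / (2 * \<i>) * k z"
      by (rule iso_rel_unique[OF iso_rel_converse[OF iso], OF h res[OF k, unfolded Rg]]) simp
    with no_atom have ae: "AE z in M. 1 * k z + (- \<i>) * h z = of_real (c z) * h z"
    proof eventually_elim
      case (elim z)
      have "(of_real (c z) + \<i>) * h z = ((of_real (c z) + \<i>) * (1 - v z)) * k z / (2 * \<i>)"
        by (simp add: elim(2))
      also have "\<dots> = k z" using c_eq[OF elim(1)] by simp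
      finally show ?case by (simp add: algebra_simps)
    qed
    note * = iso_relD(3)[OF iso, OF k h, of 1 "-\<i>"]
    have [measurable]: "h \<in> borel_measurable M" by (rule L2onD(1)[OF iso_relD(1)[OF iso, OF h]])
    show ?thesis
      by (rule iso_rel_cong_AE[OF iso, OF * _ _ ae]) (auto simp: g_def L2onD(1)[OF H_L2[OF f], simplified])
  qed
  have model2: "f \<in> dom" if h: "W h f" and ch: "(\<lambda>z. of_real (c z) * h z) \<in> L2on M" for h f
  proof -
    have hL: "h \<in> L2on M" by (rule iso_relD(1)[OF iso, OF h])
    have "(\<lambda>z. 1 * (of_real (c z) * h z) + \<i> * h z) \<in> L2on M" by (rule L2on_lincomb[OF ch hL])
    then obtain g where g: "W (\<lambda>z. 1 * (of_real (c z) * h z) + \<i> * h z) g"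
      using unitary_relD(2)[OF uni] by auto
    have gL: "g \<in> L2on lborel" by (rule iso_relD(2)[OF iso, OF g])
    have ae: "AE z in M. (1 - v z) / (2 * \<i>) * (1 * (of_real (c z) * h z) + \<i> * h z) = h z"
      using no_atom
    proof eventually_elim
      case (elim z)
      have "(1 - v z) / (2 * \<i>) * (1 * (of_real (c z) * h z) + \<i> * h z)
        = ((of_real (c z) + \<i>) * (1 - v z)) * h z / (2 * \<i>)"
        by (simp add: field_simps)
      also have "\<dots> = h z" using c_eq[OF elim] by simp
      finally show ?case .
    qed
    have "AE x in lborel. Rs (-\<i>) g x = f x"
      by (rule iso_rel_unique[OF iso, OF res[OF g] h ae])
    then show ?thesis
      using dom_cong_AE[of "Rs (-\<i>) g" f] Rs_dom[of "-\<i>" g] gL L2onD(1)[OF iso_relD(2)[OF iso, OF h]] by simp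
  qed
  have "spectral_model M c W (H_op u \<alpha>)"
    unfolding spectral_model_def dom_def[symmetric] H_def[symmetric]
  proof (intro conjI allI impI uni)
    fix h f assume h: "W h f"
    show "f \<in> dom \<longleftrightarrow> (\<lambda>z. of_real (c z) * h z) \<in> L2on M"
      using model1[OF h] model2[OF h] iso_relD(1)[OF iso, of "\<lambda>z. of_real (c z) * h z" "H f"] by blast
  qed (simp_all add: model1)
  from that[OF M sM this one] show thesis .
qed

end

section \<open>Spectral resolutions\<close>

lemma scalar_measure_eqI:
  assumes sets: "sets \<nu> = sets borel"
    and eq: "\<And>B. B \<in> sets borel \<Longrightarrow> ennreal (Re (l2_inner (E B f) f)) = emeasure \<nu> B"
  shows "scalar_measure E f = \<nu>"
proof -
  have "scalar_measure E f = measure_of UNIV (sets borel) (emeasure \<nu>)"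
    unfolding scalar_measure_def
  proof (rule measure_of_eq)
    fix B assume "B \<in> sigma_sets UNIV (sets (borel :: real measure))"
    then have "B \<in> sets borel" using sets.sigma_sets_eq[of "borel :: real measure"] by simp
    then show "ennreal (Re (l2_inner (E B f) f)) = emeasure \<nu> B" by (rule eq)
  qed auto
  also have "\<dots> = measure_of (space \<nu>) (sets \<nu>) (emeasure \<nu>)"
    using sets_eq_imp_space_eq[OF sets] sets by simp
  finally show ?thesis by (simp add: measure_of_of_measure)
qed

lemma spectral_resolution_of_model:
  fixes M :: "'a measure"
  assumes model: "spectral_model M c W T" and dom_sub: "fst T \<subseteq> L2on lborel"
  obtains E where "spectral_resolution E T"
    "\<And>h f. W h f \<Longrightarrow> scalar_measure E f = distr (density M (\<lambda>z. ennreal ((cmod (h z))\<^sup>2))) borel c"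
proof -
  have uni: "unitary_rel M lborel W" and c_meas [measurable]: "c \<in> borel_measurable M"
    and dom: "\<And>h f. W h f \<Longrightarrow> f \<in> fst T \<longleftrightarrow> (\<lambda>z. of_real (c z) * h z) \<in> L2on M"
    and act: "\<And>h f. W h f \<Longrightarrow> f \<in> fst T \<Longrightarrow> W (\<lambda>z. of_real (c z) * h z) (snd T f)"
    using model by (simp_all add: spectral_model_def)
  note iso = unitary_relD(1)[OF uni]
  define I :: "real set \<Rightarrow> 'a \<Rightarrow> complex" where "I B z = indicator B (c z)" for B z
  have I_meas [measurable]: "I B \<in> borel_measurable M" if [measurable]: "B \<in> sets borel" for B
    unfolding I_def[abs_def] by measurable
  have I_le: "cmod (I B z) \<le> 1" for B z by (simp add: I_def indicator_def)
  have IL: "(\<lambda>z. I B z * h z) \<in> L2on M" if "h \<in> L2on M" "B \<in> sets borel" for h B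
    by (rule L2on_mult_bounded[OF that(1) I_meas[OF that(2)] I_le])
  define E where "E B f = (SOME g. \<exists>h. W h f \<and> W (\<lambda>z. I B z * h z) g)" for B f
  have E: "W (\<lambda>z. I B z * h z) (E B f)" if h: "W h f" and B: "B \<in> sets borel" for h f B
  proof -
    have hL: "h \<in> L2on M" by (rule iso_relD(1)[OF iso, OF h])
    obtain g where "W (\<lambda>z. I B z * h z) g" using unitary_relD(2)[OF uni IL[OF hL B]] by (rule exE)
    with h have "\<exists>g h. W h f \<and> W (\<lambda>z. I B z * h z) g" by (intro exI conjI)
    from someI_ex[OF this] obtain h' where h': "W h' f" "W (\<lambda>z. I B z * h' z) (E B f)"
      unfolding E_def by (elim exE conjE)
    have "AE z in M. h' z = h z"
      by (rule iso_rel_unique[OF iso_rel_converse[OF iso], OF h'(1) h]) simp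
    then have "AE z in M. I B z * h' z = I B z * h z" by eventually_elim simp
    then show ?thesis
      using iso_rel_cong_AE[OF iso, OF h'(2) L2onD(1)[OF IL[OF hL B]] L2onD(1)[OF iso_relD(2)[OF iso, OF h'(2)]]]
      by simp
  qed
  have ex: "\<exists>h. W h f" if "f \<in> L2" for f using unitary_relD(3)[OF uni, of f] that by (simp add: L2_eq)
  have uniq: "ae_eq f g" if "W h f" "W h g" for h f g
    unfolding ae_eq_def by (rule iso_rel_unique[OF iso, OF that]) simp
  have WL: "f \<in> L2" if "W h f" for h f using iso_relD(2)[OF iso, OF that] by (simp add: L2_eq)
  have I_mult: "I A z * (I B z * h z) = I (A \<inter> B) z * h z" for A B z h
    by (simp add: I_def indicator_inter_arith)
  have proj: "orth_projection (E B)" if B: "B \<in> sets borel" for B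
    unfolding orth_projection_def
  proof (intro conjI ballI allI impI)
    fix f assume "f \<in> L2"
    then obtain h where h: "W h f" using ex by auto
    show "E B f \<in> L2" by (rule WL[OF E[OF h B]])
    show "ae_eq (E B (E B f)) (E B f)"
      using uniq[OF E[OF E[OF h B] B, unfolded I_mult Int_absorb] E[OF h B]] .
    {
      fix g assume "g \<in> L2"
      then obtain k where k: "W k g" using ex by auto
      show "l2_inner (E B f) g = l2_inner f (E B g)"
        unfolding l2_inner_eq iso_relD(5)[OF iso, OF E[OF h B] k, symmetric]
          iso_relD(5)[OF iso, OF h E[OF k B], symmetric]
        unfolding ip_def by (rule Bochner_Integration.integral_cong) (auto simp: I_def indicator_def)
      show "ae_eq (E B (\<lambda>x. a * f x + b * g x)) (\<lambda>x. a * E B f x + b * E B g x)" for a b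
      proof (rule uniq)
        show "W (\<lambda>z. I B z * (a * h z + b * k z)) (E B (\<lambda>x. a * f x + b * g x))"
          by (rule E[OF iso_relD(3)[OF iso, OF h k] B])
        show "W (\<lambda>z. I B z * (a * h z + b * k z)) (\<lambda>x. a * E B f x + b * E B g x)"
          using iso_relD(3)[OF iso, OF E[OF h B] E[OF k B], of a b] by (simp add: algebra_simps)
      qed
      show "ae_eq (E B f) (E B g)" if eq: "ae_eq f g"
      proof (rule uniq[OF E[OF h B]])
        have "AE z in M. k z = h z"
          by (rule iso_rel_unique[OF iso_rel_converse[OF iso], OF k h]) (use eq in \<open>auto simp: ae_eq_def\<close>)
        then have "AE z in M. I B z * k z = I B z * h z" by eventually_elim simp
        then show "W (\<lambda>z. I B z * h z) (E B g)"
          using iso_rel_cong_AE[OF iso, OF E[OF k B] L2onD(1)[OF IL[OF iso_relD(1)[OF iso, OF h] B]]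
              L2onD(1)[OF iso_relD(2)[OF iso, OF E[OF k B]]]] by simp
      qed
    }
  qed
  have pvm: "proj_valued_measure E"
    unfolding proj_valued_measure_def
  proof (intro conjI ballI allI impI)
    show "orth_projection (E B)" if "B \<in> sets borel" for B by (rule proj[OF that])
  next
    fix f assume "f \<in> L2"
    then obtain h where h: "W h f" using ex by auto
    have "W (\<lambda>z. 0) (\<lambda>x. 0)" using iso_rel_scale[OF iso, OF h, of 0] by simp
    then show "ae_eq (E {} f) (\<lambda>x. 0)"
      using uniq[of "\<lambda>z. 0" "E {} f" "\<lambda>x. 0"] E[OF h, of "{}"] by (simp add: I_def)
    show "ae_eq (E UNIV f) f"
      using uniq[of h "E UNIV f" f] E[OF h, of UNIV] h by (simp add: I_def)
  next
    fix A B :: "real set" and f assume A: "A \<in> sets borel" and B: "B \<in> sets borel" and "f \<in> L2"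
    then obtain h where h: "W h f" using ex by auto
    show "ae_eq (E (A \<inter> B) f) (E A (E B f))"
      by (rule uniq[OF E[OF h sets.Int[OF A B]] E[OF E[OF h B] A, unfolded I_mult]])
  next
    fix A :: "nat \<Rightarrow> real set" and f
    assume A: "range A \<subseteq> sets borel" and disj: "disjoint_family A" and "f \<in> L2"
    then obtain h where h: "W h f" using ex by auto
    have Am [measurable]: "A i \<in> sets borel" for i using A by auto
    have hL: "h \<in> L2on M" by (rule iso_relD(1)[OF iso, OF h])
    note [measurable] = L2onD(1)[OF hL]
    have W0: "W (\<lambda>z. 0) (\<lambda>x. 0)" using iso_rel_scale[OF iso, OF h, of 0] by simp
    have part: "W (\<lambda>z. I (\<Union>i<n. A i) z * h z) (\<lambda>x. \<Sum>i<n. E (A i) f x)" for n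
    proof (induction n)
      case 0
      then show ?case using W0 by (simp add: I_def)
    next
      case (Suc n)
      have dj: "(\<Union>i<n. A i) \<inter> A n = {}"
      proof -
        have "A i \<inter> A n = {}" if "i < n" for i using disj that by (simp add: disjoint_family_on_def)
        then show ?thesis by blast
      qed
      have "I (\<Union>i<Suc n. A i) z = I (\<Union>i<n. A i) z + I (A n) z" for z
        using dj by (auto simp: I_def indicator_def less_Suc_eq)
      then show ?case using iso_rel_add[OF iso, OF Suc E[OF h Am[of n]]] by (simp add: algebra_simps)
    qed
    have Um: "(\<Union>i. A i) \<in> sets borel" using Am by blast
    have full: "W (\<lambda>z. I (\<Union>i. A i) z * h z) (E (\<Union>i. A i) f)" by (rule E[OF h Um])
    have lim: "l2_tendsto M (\<lambda>n z. I (\<Union>i<n. A i) z * h z) (\<lambda>z. I (\<Union>i. A i) z * h z)"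
    proof (rule l2_tendsto_dominated(3)[OF _ _ hL])
      show "(\<lambda>z. I (\<Union>i<n. A i) z * h z) \<in> borel_measurable M" for n by measurable
      show "(\<lambda>z. I (\<Union>i. A i) z * h z) \<in> borel_measurable M" using I_meas[OF Um] by measurable
      show "AE z in M. cmod (I (\<Union>i<n. A i) z * h z) \<le> cmod (h z)" for n
        using I_le by (auto simp: norm_mult mult_left_le_one_le)
      show "AE z in M. (\<lambda>n. I (\<Union>i<n. A i) z * h z) \<longlonglongrightarrow> I (\<Union>i. A i) z * h z"
        unfolding I_def
        by (intro AE_I2 tendsto_mult tendsto_const LIMSEQ_indicator_UN[where 'a=complex, THEN tendsto_eq_rhs]) auto
    qed
    have "nsq lborel (\<lambda>x. E (\<Union>i. A i) f x - (\<Sum>i<n. E (A i) f x))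
        = nsq M (\<lambda>z. I (\<Union>i<n. A i) z * h z - I (\<Union>i. A i) z * h z)" for n
      using iso_rel_nsq[OF iso, OF iso_rel_diff[OF iso, OF full part[of n]]]
      by (simp add: nsq_minus_commute)
    then have "(\<lambda>n. nsq lborel (\<lambda>x. E (\<Union>i. A i) f x - (\<Sum>i<n. E (A i) f x))) \<longlonglongrightarrow> 0"
      using l2_tendstoD[OF lim] by simp
    from tendsto_real_sqrt[OF this]
    show "(\<lambda>n. l2_norm (\<lambda>x. E (\<Union>i. A i) f x - (\<Sum>i<n. E (A i) f x))) \<longlonglongrightarrow> 0"
      by (simp add: l2_norm_eq)
  qed
  have sc: "scalar_measure E f = distr (density M (\<lambda>z. ennreal ((cmod (h z))\<^sup>2))) borel c" if h: "W h f" for h f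
  proof (rule scalar_measure_eqI)
    fix B :: "real set" assume B [measurable]: "B \<in> sets borel"
    have hL: "h \<in> L2on M" by (rule iso_relD(1)[OF iso, OF h])
    note [measurable] = L2onD(1)[OF hL]
    have int: "integrable M (\<lambda>z. (cmod (I B z * h z))\<^sup>2)" by (rule L2onD(2)[OF IL[OF hL B]])
    have "l2_inner (E B f) f = ip M (\<lambda>z. I B z * h z) h"
      using iso_relD(5)[OF iso, OF E[OF h B] h] by (simp add: l2_inner_eq)
    also have "\<dots> = ip M (\<lambda>z. I B z * h z) (\<lambda>z. I B z * h z)"
      unfolding ip_def by (rule Bochner_Integration.integral_cong) (auto simp: I_def indicator_def)
    finally have "ennreal (Re (l2_inner (E B f) f)) = ennreal (LINT z|M. (cmod (I B z * h z))\<^sup>2)"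
      by (simp add: ip_self nsq_def)
    also have "\<dots> = (\<integral>\<^sup>+z. ennreal ((cmod (I B z * h z))\<^sup>2) \<partial>M)"
      by (rule nn_integral_eq_integral[symmetric]) (use int in auto)
    also have "\<dots> = (\<integral>\<^sup>+z. ennreal ((cmod (h z))\<^sup>2) * indicator (c -` B \<inter> space M) z \<partial>M)"
      by (rule nn_integral_cong) (auto simp: I_def indicator_def)
    also have "\<dots> = emeasure (density M (\<lambda>z. ennreal ((cmod (h z))\<^sup>2))) (c -` B \<inter> space M)"
      by (rule emeasure_density[symmetric]) measurable
    also have "\<dots> = emeasure (distr (density M (\<lambda>z. ennreal ((cmod (h z))\<^sup>2))) borel c) B"
      by (subst emeasure_distr) auto
    finally show "ennreal (Re (l2_inner (E B f) f))
      = emeasure (distr (density M (\<lambda>z. ennreal ((cmod (h z))\<^sup>2))) borel c) B" .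
  qed simp
  have "spectral_resolution E T"
    unfolding spectral_resolution_def
  proof (intro conjI ballI pvm)
    have "f \<in> fst T \<longleftrightarrow> integrable (scalar_measure E f) (\<lambda>t. t\<^sup>2)" if h: "W h f" for f h
    proof -
      note [measurable] = L2onD(1)[OF iso_relD(1)[OF iso, OF h]]
      have "integrable (scalar_measure E f) (\<lambda>t. t\<^sup>2)
        \<longleftrightarrow> integrable (density M (\<lambda>z. ennreal ((cmod (h z))\<^sup>2))) (\<lambda>z. (c z)\<^sup>2)"
        unfolding sc[OF h] by (rule integrable_distr_eq) auto
      also have "\<dots> \<longleftrightarrow> integrable M (\<lambda>z. (cmod (of_real (c z) * h z))\<^sup>2)"
        by (subst integrable_density) (auto simp: norm_mult power_mult_distrib mult.commute)
      also have "\<dots> \<longleftrightarrow> f \<in> fst T"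
        unfolding dom[OF h] by (simp add: L2on_def)
      finally show ?thesis ..
    qed
    note iff = this
    have "f \<in> fst T \<longleftrightarrow> integrable (scalar_measure E f) (\<lambda>t. t\<^sup>2)" if "f \<in> L2" for f
      using ex[OF that] by (elim exE) (rule iff)
    then show "fst T = {f \<in> L2. integrable (scalar_measure E f) (\<lambda>t. t\<^sup>2)}"
      using dom_sub by (auto simp: L2_eq)
  next
    fix f assume f: "f \<in> fst T"
    then obtain h where h: "W h f" using ex dom_sub by (auto simp: L2_eq)
    note [measurable] = L2onD(1)[OF iso_relD(1)[OF iso, OF h]]
    have "l2_inner (snd T f) f = ip M (\<lambda>z. of_real (c z) * h z) h"
      using iso_relD(5)[OF iso, OF act[OF h f] h] by (simp add: l2_inner_eq)
    also have "\<dots> = (LINT z|M. of_real ((cmod (h z))\<^sup>2 * c z))"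
      unfolding ip_def
      by (rule Bochner_Integration.integral_cong[OF refl])
        (simp add: mult.assoc mult.commute[of "(cmod _)\<^sup>2"] flip: complex_norm_square)
    also have "\<dots> = of_real (LINT z|M. (cmod (h z))\<^sup>2 * c z)"
      by (rule integral_complex_of_real)
    also have "(LINT z|M. (cmod (h z))\<^sup>2 * c z) = (LINT t|scalar_measure E f. t)"
      unfolding sc[OF h] by (subst integral_distr) (auto simp: integral_density)
    finally show "l2_inner (snd T f) f = of_real (LINT t|scalar_measure E f. t)" .
  qed
  from that[OF this sc] show thesis .
qed

lemma ip_cong_AE_L2:
  assumes "f \<in> L2on M" "f' \<in> L2on M" "g \<in> L2on M" "AE x in M. f x = f' x"
  shows "ip M f g = ip M f' g" "ip M g f = ip M g f'"
  using assms(4) by (auto intro!: ip_cong_AE L2onD(1) assms)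

lemma sets_scalar_measure [simp, measurable_cong]: "sets (scalar_measure E f) = sets borel"
  using sets.sigma_sets_eq[of "borel :: real measure"] by (simp add: scalar_measure_def)

lemma space_scalar_measure [simp]: "space (scalar_measure E f) = UNIV"
  by (simp add: scalar_measure_def)

context
  fixes E assumes pvm: "proj_valued_measure E"
begin

lemma pvm_proj:
  assumes "B \<in> sets borel"
  shows "orth_projection (E B)"
  using pvm assms by (simp add: proj_valued_measure_def)

lemma pvm_L2:
  assumes "B \<in> sets borel" "f \<in> L2on lborel"
  shows "E B f \<in> L2on lborel"
  using pvm_proj[OF assms(1)] assms(2) by (simp add: orth_projection_def L2_eq)

lemma pvm_sym:
  assumes "B \<in> sets borel" "f \<in> L2on lborel" "g \<in> L2on lborel"
  shows "ip lborel (E B f) g = ip lborel f (E B g)"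
  using pvm_proj[OF assms(1)] assms(2,3) by (simp add: orth_projection_def L2_eq l2_inner_eq)

lemma pvm_Int:
  assumes "A \<in> sets borel" "B \<in> sets borel" "f \<in> L2on lborel"
  shows "AE x in lborel. E (A \<inter> B) f x = E A (E B f) x"
  using pvm assms by (simp add: proj_valued_measure_def L2_eq ae_eq_def)

lemma pvm_UNIV:
  assumes "f \<in> L2on lborel"
  shows "AE x in lborel. E UNIV f x = f x"
  using pvm assms by (simp add: proj_valued_measure_def L2_eq ae_eq_def)

lemma pvm_ip:
  assumes A: "A \<in> sets borel" and B: "B \<in> sets borel" and f: "f \<in> L2on lborel"
  shows "ip lborel (E A f) (E B f) = ip lborel (E (A \<inter> B) f) f"
proof -
  have AB: "A \<inter> B \<in> sets borel" "B \<inter> A \<in> sets borel" using A B by auto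
  have "ip lborel (E A f) (E B f) = ip lborel (E B (E A f)) f"
    by (rule pvm_sym[OF B pvm_L2[OF A f] f, symmetric])
  also have "\<dots> = ip lborel (E (B \<inter> A) f) f"
    by (rule ip_cong_AE_L2(1)[OF pvm_L2[OF AB(2) f] pvm_L2[OF B pvm_L2[OF A f]] f pvm_Int[OF B A f], symmetric])
  finally show ?thesis by (simp add: Int_commute)
qed

lemma pvm_nsq:
  assumes B: "B \<in> sets borel" and f: "f \<in> L2on lborel"
  shows "ip lborel (E B f) f = of_real (nsq lborel (E B f))"
  using pvm_ip[OF B B f] by (simp add: ip_self)

lemma emeasure_scalar_measure:
  assumes f: "f \<in> L2on lborel" and B: "B \<in> sets borel"
  shows "emeasure (scalar_measure E f) B = ennreal (nsq lborel (E B f))"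
proof -
  have eq: "Re (l2_inner (E B f) f) = nsq lborel (E B f)" if "B \<in> sets borel" for B
    using pvm_nsq[OF that f] by (simp add: l2_inner_eq)
  let ?\<mu> = "\<lambda>B. ennreal (Re (l2_inner (E B f) f))"
  have "emeasure (scalar_measure E f) B = ?\<mu> B"
  proof (rule emeasure_measure_of[OF scalar_measure_def])
    show "positive (sets (scalar_measure E f)) ?\<mu>"
    proof -
      have "AE x in lborel. E {} f x = 0"
        using pvm f by (simp add: proj_valued_measure_def L2_eq ae_eq_def)
      then have "nsq lborel (E {} f) = 0" using nsq_eq_0_iff[OF pvm_L2[OF _ f], of "{}"] by simp
      then show ?thesis by (simp add: positive_def eq)
    qed
    show "countably_additive (sets (scalar_measure E f)) ?\<mu>"
    proof (rule countably_additiveI)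
      fix A :: "nat \<Rightarrow> real set"
      assume A: "range A \<subseteq> sets (scalar_measure E f)" and disj: "disjoint_family A"
      have A': "range A \<subseteq> sets borel" using A by simp
      then have Am: "A i \<in> sets borel" for i by auto
      have Um: "(\<Union>i. A i) \<in> sets borel" using Am by blast
      have SL: "(\<lambda>x. \<Sum>i<n. E (A i) f x) \<in> L2on lborel" for n
        using L2on_sum[of "{..<n}" "\<lambda>i. E (A i) f" lborel "\<lambda>_. 1"] pvm_L2[OF Am f] by simp
      have "(\<lambda>n. (l2_norm (\<lambda>x. E (\<Union>i. A i) f x - (\<Sum>i<n. E (A i) f x)))\<^sup>2) \<longlonglongrightarrow> 0\<^sup>2"
        using pvm A' disj f unfolding proj_valued_measure_def L2_eq by (intro tendsto_power) blast
      then have "l2_tendsto lborel (\<lambda>n x. \<Sum>i<n. E (A i) f x) (E (\<Union>i. A i) f)"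
        unfolding l2_tendsto_def
        by (subst nsq_minus_commute) (simp add: l2_norm_eq nsq_nonneg)
      from l2_tendsto_ip_left[OF SL pvm_L2[OF Um f] f this]
      have "(\<lambda>n. Re (ip lborel (\<lambda>x. \<Sum>i<n. E (A i) f x) f)) \<longlonglongrightarrow> Re (ip lborel (E (\<Union>i. A i) f) f)"
        by (rule tendsto_Re)
      moreover have "Re (ip lborel (\<lambda>x. \<Sum>i<n. E (A i) f x) f) = (\<Sum>i<n. nsq lborel (E (A i) f))" for n
        using ip_sum_left[of "{..<n}" "\<lambda>i. E (A i) f" lborel f "\<lambda>_. 1"] pvm_L2[OF Am f] f
        by (simp add: pvm_nsq[OF Am f])
      ultimately have "(\<lambda>i. nsq lborel (E (A i) f)) sums nsq lborel (E (\<Union>i. A i) f)"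
        by (simp add: sums_def pvm_nsq[OF Um f])
      then have "(\<Sum>i. ennreal (nsq lborel (E (A i) f))) = ennreal (nsq lborel (E (\<Union>i. A i) f))"
        by (intro suminf_ennreal_eq nsq_nonneg)
      then show "(\<Sum>i. ?\<mu> (A i)) = ?\<mu> (\<Union>i. A i)" by (simp add: eq Am Um)
    qed
  qed (use B in auto)
  then show ?thesis by (simp add: eq[OF B])
qed

lemma finite_scalar_measure: "f \<in> L2on lborel \<Longrightarrow> finite_measure (scalar_measure E f)"
  by standard (simp add: emeasure_scalar_measure)

lemma measure_scalar_measure:
  "f \<in> L2on lborel \<Longrightarrow> B \<in> sets borel \<Longrightarrow> measure (scalar_measure E f) B = nsq lborel (E B f)"
  by (simp add: measure_def emeasure_scalar_measure nsq_nonneg)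

lemma scalar_measure_pvm:
  assumes f: "f \<in> L2on lborel" and B: "B \<in> sets borel"
  shows "scalar_measure E (E B f) = density (scalar_measure E f) (indicator B)"
proof (rule measure_eqI)
  fix A assume "A \<in> sets (scalar_measure E (E B f))"
  then have A: "A \<in> sets borel" by simp
  have AB: "A \<inter> B \<in> sets borel" using A B by simp
  have "nsq lborel (E A (E B f)) = nsq lborel (E (A \<inter> B) f)"
    by (rule nsq_cong_AE[OF L2onD(1)[OF pvm_L2[OF A pvm_L2[OF B f]]] L2onD(1)[OF pvm_L2[OF AB f]]])
      (use pvm_Int[OF A B f] in \<open>auto simp: eq_commute\<close>)
  moreover have "emeasure (density (scalar_measure E f) (indicator B)) A = emeasure (scalar_measure E f) (A \<inter> B)"
    using A B by (subst emeasure_density) (auto simp: indicator_inter_arith[symmetric] Int_commute)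
  ultimately show "emeasure (scalar_measure E (E B f)) A = emeasure (density (scalar_measure E f) (indicator B)) A"
    by (simp add: emeasure_scalar_measure[OF pvm_L2[OF B f] A] emeasure_scalar_measure[OF f AB])
qed simp

lemma pvm_compl:
  assumes f: "f \<in> L2on lborel" and B: "B \<in> sets borel"
  shows "AE x in lborel. f x = E B f x + E (- B) f x"
proof -
  have cB: "- B \<in> sets borel" using B by auto
  interpret finite_measure "scalar_measure E f" by (rule finite_scalar_measure[OF f])
  define P where "P x = f x - E B f x" for x
  have PL: "P \<in> L2on lborel" unfolding P_def by (rule L2on_diff[OF f pvm_L2[OF B f]])
  have tot: "nsq lborel (E B f) + nsq lborel (E (- B) f) = nsq lborel f"
  proof -
    have "measure (scalar_measure E f) UNIV = measure (scalar_measure E f) B + measure (scalar_measure E f) (- B)"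
      using finite_measure_compl[of B] B by (simp add: Compl_eq_Diff_UNIV)
    moreover have "nsq lborel (E UNIV f) = nsq lborel f"
      by (rule nsq_cong_AE[OF L2onD(1)[OF pvm_L2[OF _ f]] L2onD(1)[OF f] pvm_UNIV[OF f]]) simp
    ultimately show ?thesis by (simp add: measure_scalar_measure f B cB)
  qed
  have "ip lborel (E B f) (E (- B) f) = 0"
    using pvm_ip[OF B cB f] pvm_nsq[of "{}" f] emeasure_scalar_measure[OF f, of "{}"] f
    by (simp add: nsq_nonneg)
  moreover have "ip lborel f (E (- B) f) = of_real (nsq lborel (E (- B) f))"
    using ip_sym[of lborel "E (- B) f" f] pvm_nsq[OF cB f] by (metis complex_cnj_cancel_iff complex_cnj_complex_of_real)
  ultimately have c: "ip lborel P (E (- B) f) = of_real (nsq lborel (E (- B) f))"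
    unfolding P_def by (simp add: ip_diff_left[OF f pvm_L2[OF B f] pvm_L2[OF cB f]])
  have "ip lborel f (E B f) = of_real (nsq lborel (E B f))"
    using ip_sym[of lborel "E B f" f] pvm_nsq[OF B f] by (metis complex_cnj_cancel_iff complex_cnj_complex_of_real)
  then have "nsq lborel P = nsq lborel f - nsq lborel (E B f)"
    using nsq_lincomb[OF f pvm_L2[OF B f], of 1 "-1"] by (simp add: P_def[abs_def])
  then have "nsq lborel P = nsq lborel (E (- B) f)" using tot by simp
  then have "nsq lborel (\<lambda>x. 1 * P x + (-1) * E (- B) f x) = 0"
    unfolding nsq_lincomb[OF PL pvm_L2[OF cB f]] by (simp add: c)
  then have "AE x in lborel. P x - E (- B) f x = 0"
    using nsq_eq_0_iff[OF L2on_diff[OF PL pvm_L2[OF cB f]]] by simp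
  then show ?thesis by eventually_elim (simp add: P_def algebra_simps)
qed

end

context rank_one
begin

lemma eigenvector_form:
  assumes E: "spectral_resolution E (H_op u \<alpha>)" and \<phi>: "\<phi> \<in> dom"
    and eig: "AE x in lborel. H \<phi> x = of_real l * \<phi> x" and B: "B \<in> sets borel"
  shows "(LINT t|scalar_measure E \<phi>. indicator B t * (t - l)) = 0"
proof -
  have pvm: "proj_valued_measure E" using E by (simp add: spectral_resolution_def)
  have dom_eq: "f \<in> dom \<longleftrightarrow> f \<in> L2on lborel \<and> integrable (scalar_measure E f) (\<lambda>t. t\<^sup>2)" for f
    using E by (simp add: spectral_resolution_def dom_def L2_eq)
  have form: "ip lborel (H f) f = of_real (LINT t|scalar_measure E f. t)" if "f \<in> dom" for f
    using E that by (simp add: spectral_resolution_def dom_def H_def l2_inner_eq)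
  have \<phi>L: "\<phi> \<in> L2on lborel" by (rule dom_L2[OF \<phi>])
  let ?\<mu> = "scalar_measure E \<phi>"
  interpret finite_measure ?\<mu> by (rule finite_scalar_measure[OF pvm \<phi>L])
  have sq: "integrable ?\<mu> (\<lambda>t. t\<^sup>2)" using dom_eq \<phi> by simp
  have int: "integrable ?\<mu> (\<lambda>t. t)"
  proof (rule Bochner_Integration.integrable_bound)
    show "integrable ?\<mu> (\<lambda>t. 1 + t\<^sup>2)" using sq by simp
    show "AE t in ?\<mu>. norm t \<le> norm (1 + t\<^sup>2)"
    proof (rule AE_I2)
      fix t :: real
      have "0 \<le> (\<bar>t\<bar> - 1)\<^sup>2" by simp
      then have "2 * \<bar>t\<bar> \<le> 1 + t\<^sup>2" by (simp add: power2_diff)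
      then show "norm t \<le> norm (1 + t\<^sup>2)" by simp
    qed
  qed simp
  have PD: "E C \<phi> \<in> dom" "ip lborel (H (E C \<phi>)) (E C \<phi>) = of_real (LINT t|?\<mu>. indicator C t * t)"
    if C: "C \<in> sets borel" for C
  proof -
    have s: "scalar_measure E (E C \<phi>) = density ?\<mu> (\<lambda>t. ennreal (indicator C t))"
      using scalar_measure_pvm[OF pvm \<phi>L C] by (simp add: ennreal_indicator)
    have "integrable ?\<mu> (\<lambda>t. indicator C t *\<^sub>R t\<^sup>2)"
      using integrable_mult_indicator[of C ?\<mu> "\<lambda>t. t\<^sup>2"] sq C by simp
    then have "integrable (scalar_measure E (E C \<phi>)) (\<lambda>t. t\<^sup>2)"
      unfolding s using C by (subst integrable_density) auto
    then show d: "E C \<phi> \<in> dom" using pvm_L2[OF pvm C \<phi>L] by (simp add: dom_eq)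
    show "ip lborel (H (E C \<phi>)) (E C \<phi>) = of_real (LINT t|?\<mu>. indicator C t * t)"
      unfolding form[OF d] s using C by (subst integral_density) auto
  qed
  have cB: "- B \<in> sets borel" using B by auto
  define P where "P = E B \<phi>"
  define P' where "P' = E (- B) \<phi>"
  have d: "P \<in> dom" "P' \<in> dom" using PD(1)[OF B] PD(1)[OF cB] by (simp_all add: P_def P'_def)
  note L = dom_L2[OF d(1)] dom_L2[OF d(2)] H_L2[OF d(1)] H_L2[OF d(2)]
  define S where "S x = 1 * P x + 1 * P' x" for x
  have Sd: "S \<in> dom" unfolding S_def by (rule dom_lincomb[OF d])
  have SL: "S \<in> L2on lborel" by (rule dom_L2[OF Sd])
  have split: "AE x in lborel. \<phi> x = S x" using pvm_compl[OF pvm \<phi>L B] by (simp add: S_def P_def P'_def)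
  have HS: "H S = (\<lambda>x. 1 * H P x + 1 * H P' x)"
    unfolding S_def[abs_def] by (rule ext) (rule H_lincomb[OF d])
  have "ip lborel (H \<phi>) \<phi> = ip lborel (H S) S"
    using H_cong_AE[OF \<phi> Sd split] split
    by (intro ip_cong_AE L2onD(1)[OF H_L2] L2onD(1)[OF \<phi>L] L2onD(1)[OF SL] \<phi> Sd)
  also have "\<dots> = ip lborel (H P) P + ip lborel (H P) P' + (ip lborel (H P') P + ip lborel (H P') P')"
    unfolding HS unfolding S_def[abs_def] ip_lincomb_left[OF L(3,4) L2on_lincomb[OF L(1,2)]]
      ip_lincomb_right[OF L(1,2) L(3)] ip_lincomb_right[OF L(1,2) L(4)] by simp
  also have "ip lborel (H P') P = cnj (ip lborel (H P) P')"
    unfolding H_symmetric[OF d(2,1)] by (rule ip_sym)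
  finally have "of_real (LINT t|?\<mu>. t) = of_real (LINT t|?\<mu>. indicator B t * t) + ip lborel (H P) P'
      + (cnj (ip lborel (H P) P') + of_real (LINT t|?\<mu>. indicator (- B) t * t))"
    using form[OF \<phi>] PD(2)[OF B] PD(2)[OF cB] by (simp add: P_def P'_def)
  then have "(LINT t|?\<mu>. t) = (LINT t|?\<mu>. indicator B t * t) + 2 * Re (ip lborel (H P) P')
      + (LINT t|?\<mu>. indicator (- B) t * t)"
    by (simp add: complex_eq_iff)
  moreover have "(LINT t|?\<mu>. t) = (LINT t|?\<mu>. indicator B t * t) + (LINT t|?\<mu>. indicator (- B) t * t)"
  proof -
    have i: "integrable ?\<mu> (\<lambda>t. indicator C t * t)" if "C \<in> sets borel" for C
      using integrable_mult_indicator[of C ?\<mu> "\<lambda>t. t"] int that by simp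
    show ?thesis
      unfolding Bochner_Integration.integral_add[OF i[OF B] i[OF cB], symmetric]
      by (rule Bochner_Integration.integral_cong) (auto simp: indicator_def)
  qed
  ultimately have cross: "Re (ip lborel (H P) P') = 0" by simp
  have "ip lborel (H P) P + ip lborel (H P) P' = ip lborel (H P) S"
    unfolding S_def[abs_def] ip_lincomb_right[OF L(1,2) L(3)] by simp
  also have "\<dots> = ip lborel (H P) \<phi>"
    by (rule ip_cong_AE_L2(2)[OF \<phi>L SL L(3) split, symmetric])
  also have "\<dots> = ip lborel P (H \<phi>)" by (rule H_symmetric[OF d(1) \<phi>])
  also have "\<dots> = ip lborel P (\<lambda>x. of_real l * \<phi> x)"
    by (rule ip_cong_AE_L2(2)[OF H_L2[OF \<phi>] L2on_scale[OF \<phi>L] L(1) eig])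
  also have "\<dots> = of_real (l * measure ?\<mu> B)"
    using pvm_nsq[OF pvm B \<phi>L] measure_scalar_measure[OF pvm \<phi>L B] by (simp add: ip_scale_right P_def)
  finally have "Re (ip lborel (H P) P) = l * measure ?\<mu> B"
    using cross by (simp add: complex_eq_iff)
  then have "(LINT t|?\<mu>. indicator B t * t) = l * measure ?\<mu> B"
    using PD(2)[OF B] by (simp add: P_def)
  moreover have "(LINT t|?\<mu>. indicator B t * (t - l)) = (LINT t|?\<mu>. indicator B t * t) - (LINT t|?\<mu>. l * indicator B t)"
  proof -
    have "integrable ?\<mu> (\<lambda>t. indicator B t * t)"
      using integrable_mult_indicator[of B ?\<mu> "\<lambda>t. t"] int B by simp
    moreover have "integrable ?\<mu> (\<lambda>t. l * indicator B t)"
      using B by (intro integrable_mult_right integrable_real_indicator) (auto simp: emeasure_eq_measure)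
    ultimately show ?thesis
      by (subst Bochner_Integration.integral_diff[symmetric])
        (auto simp: algebra_simps intro!: Bochner_Integration.integral_cong)
  qed
  ultimately show ?thesis using B by simp
qed

lemma ac_orthogonal_eigenvector:
  assumes E: "spectral_resolution E (H_op u \<alpha>)" and \<phi>: "\<phi> \<in> dom"
    and eig: "AE x in lborel. H \<phi> x = of_real l * \<phi> x"
    and f: "f \<in> L2on lborel" and ac: "absolutely_continuous lborel (scalar_measure E f)"
  shows "ip lborel f \<phi> = 0"
proof -
  have pvm: "proj_valued_measure E" using E by (simp add: spectral_resolution_def)
  have \<phi>L: "\<phi> \<in> L2on lborel" by (rule dom_L2[OF \<phi>])
  let ?\<mu> = "scalar_measure E \<phi>"
  interpret finite_measure ?\<mu> by (rule finite_scalar_measure[OF pvm \<phi>L])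
  have sq: "integrable ?\<mu> (\<lambda>t. t\<^sup>2)"
    using E \<phi> by (simp add: spectral_resolution_def dom_def)
  have int: "integrable ?\<mu> (\<lambda>t. s * (indicator B t * (t - l)))" if [measurable]: "B \<in> sets borel" for B s
  proof (rule Bochner_Integration.integrable_bound)
    show "integrable ?\<mu> (\<lambda>t. \<bar>s\<bar> * (1 + l\<^sup>2 + t\<^sup>2))" using sq by simp
    have "\<bar>t - l\<bar> \<le> 1 + l\<^sup>2 + t\<^sup>2" for t
    proof -
      have "0 \<le> (\<bar>t\<bar> - 1)\<^sup>2" "0 \<le> (\<bar>l\<bar> - 1)\<^sup>2" by simp_all
      then have "2 * \<bar>t\<bar> \<le> 1 + t\<^sup>2" "2 * \<bar>l\<bar> \<le> 1 + l\<^sup>2" by (simp_all add: power2_diff)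
      then show ?thesis using zero_le_power2[of t] zero_le_power2[of l] by linarith
    qed
    then show "AE t in ?\<mu>. norm (s * (indicator B t * (t - l))) \<le> norm (\<bar>s\<bar> * (1 + l\<^sup>2 + t\<^sup>2))"
      by (intro AE_I2) (auto simp: abs_mult indicator_def intro!: mult_left_mono)
  qed simp
  have null: "AE t in ?\<mu>. t \<notin> B" if B: "B \<in> sets borel" and pos: "\<And>t. t \<in> B \<Longrightarrow> s * (t - l) > 0" for B s
  proof -
    have "(LINT t|?\<mu>. s * (indicator B t * (t - l))) = 0"
      using eigenvector_form[OF E \<phi> eig B] by simp
    moreover have "0 \<le> s * (indicator B t * (t - l))" for t
      using pos[of t] by (auto simp: indicator_def)
    ultimately have "AE t in ?\<mu>. s * (indicator B t * (t - l)) = 0"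
      using integral_nonneg_eq_0_iff_AE[OF int[OF B]] by simp
    then show ?thesis
    proof eventually_elim
      case (elim t)
      then show ?case using pos[of t] by (auto simp: indicator_def)
    qed
  qed
  have "AE t in ?\<mu>. t \<notin> {l<..}" by (rule null[where s=1]) auto
  moreover have "AE t in ?\<mu>. t \<notin> {..<l}" by (rule null[where s="-1"]) auto
  ultimately have "AE t in ?\<mu>. t \<notin> - {l}" by eventually_elim auto
  then have "emeasure ?\<mu> (- {l}) = 0"
    by (subst (asm) AE_iff_measurable[of "- {l}"]) auto
  then have "nsq lborel (E (- {l}) \<phi>) = 0"
    using emeasure_scalar_measure[OF pvm \<phi>L, of "- {l}"] by (simp add: nsq_nonneg)
  then have "AE x in lborel. E (- {l}) \<phi> x = 0"
    using nsq_eq_0_iff[OF pvm_L2[OF pvm _ \<phi>L], of "- {l}"] by simp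
  with pvm_compl[OF pvm \<phi>L, of "{l}"] have eq: "AE x in lborel. \<phi> x = E {l} \<phi> x"
    by (auto elim: AE_mp)
  have "{l} \<in> null_sets lborel" by (auto simp: null_sets_def)
  then have "{l} \<in> null_sets (scalar_measure E f)" using ac unfolding absolutely_continuous_def by blast
  then have "emeasure (scalar_measure E f) {l} = 0" by (rule null_setsD1)
  then have "nsq lborel (E {l} f) = 0"
    using emeasure_scalar_measure[OF pvm f, of "{l}"] by (simp add: nsq_nonneg)
  then have "ip lborel (E {l} f) \<phi> = 0"
    using ip_cauchy_schwarz[OF pvm_L2[OF pvm _ f] \<phi>L, of "{l}"] by simp
  moreover have "ip lborel f \<phi> = ip lborel f (E {l} \<phi>)"
    by (rule ip_cong_AE_L2(2)[OF \<phi>L pvm_L2[OF pvm _ \<phi>L] f eq]) simp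
  ultimately show ?thesis using pvm_sym[OF pvm _ f \<phi>L, of "{l}"] by simp
qed

end

section \<open>Absolute continuity\<close>

lemma null_if_interval_bound:
  fixes \<mu> :: "real measure"
  assumes sets: "sets \<mu> = sets borel" and N: "N \<in> sets borel" "emeasure lborel N = 0" "N \<subseteq> {a..b}"
    and ab: "a < b"
    and bound: "\<And>x y. a \<le> x \<Longrightarrow> x < y \<Longrightarrow> y \<le> b \<Longrightarrow> emeasure \<mu> {x..y} \<le> ennreal (C * (y - x))"
    and C: "C > 0"
  shows "emeasure \<mu> N = 0"
proof -
  note [measurable_cong] = sets and [simp] = sets
  have point: "emeasure \<mu> {x} = 0" if x: "x \<in> {a..b}" for x
  proof -
    have "emeasure \<mu> {x} \<le> ennreal e" if e: "e > 0" for e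
    proof (cases "x < b")
      case True
      define y where "y = min b (x + e / C)"
      have y: "x < y" "y \<le> b" "C * (y - x) \<le> e" using True e C by (auto simp: y_def min_def field_simps)
      have "emeasure \<mu> {x} \<le> emeasure \<mu> {x..y}" using y by (intro emeasure_mono) auto
      also have "\<dots> \<le> ennreal (C * (y - x))" using x y by (intro bound) auto
      also have "\<dots> \<le> ennreal e" using y by (intro ennreal_leI)
      finally show ?thesis .
    next
      case False
      define y where "y = max a (x - e / C)"
      have y: "y < x" "a \<le> y" "C * (x - y) \<le> e" using False x ab e C by (auto simp: y_def max_def field_simps)
      have "emeasure \<mu> {x} \<le> emeasure \<mu> {y..x}" using y by (intro emeasure_mono) auto
      also have "\<dots> \<le> ennreal (C * (x - y))" using x y by (intro bound) auto
      also have "\<dots> \<le> ennreal e" using y by (intro ennreal_leI)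
      finally show ?thesis .
    qed
    then have "emeasure \<mu> {x} \<le> 0 + ennreal e" if "e > 0" for e using that by simp
    then have "emeasure \<mu> {x} \<le> 0" by (rule ennreal_le_epsilon)
    then show ?thesis by simp
  qed
  have "emeasure \<mu> N \<le> ennreal e" if e: "e > 0" for e
  proof -
    have "0 < e / C" using e C by simp
    then obtain U where U: "open U" "N \<subseteq> U" "emeasure lborel (U - N) < ennreal (e / C)"
      by (rule outer_regular_lborel[OF N(1)])
    have Um: "U \<in> sets borel" using U(1) by simp
    have lU: "emeasure lborel U \<le> ennreal (e / C)"
    proof -
      have "emeasure lborel U = emeasure lborel (U - N)"
        using N Um by (intro emeasure_Diff_null_set[symmetric]) (auto simp: null_sets_def)
      then show ?thesis using U(3) by simp
    qed
    define g where "g x = (if x \<in> U then U else UNIV)" for x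
    have g: "gauge g" using U(1) by (auto simp: gauge_def g_def)
    have Nab: "N \<subseteq> cbox a b" and box: "box a b \<noteq> {}" using N(3) ab by (auto simp: cbox_interval box_real)
    obtain D where D: "countable D" "\<Union>D \<subseteq> cbox a b"
        "\<And>K. K \<in> D \<Longrightarrow> interior K \<noteq> {} \<and> (\<exists>c d. K = cbox c d)"
        "pairwise (\<lambda>A B. interior A \<inter> interior B = {}) D"
        "\<And>K. K \<in> D \<Longrightarrow> \<exists>x\<in>N \<inter> K. K \<subseteq> g x" "N \<subseteq> \<Union>D"
    proof (rule covering_lemma[OF Nab box g], goal_cases)
      case (1 D)
      show ?case by (rule that[of D]; fact 1)
    qed
    have KU: "K \<subseteq> U" if "K \<in> D" for K using D(5)[OF that] U(2) by (auto simp: g_def split: if_splits)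
    have K: "\<exists>c d. c < d \<and> a \<le> c \<and> d \<le> b \<and> K = {c..d}" if K: "K \<in> D" for K
    proof -
      obtain c d where cd: "K = {c..d}" using D(3)[OF K] by (auto simp: cbox_interval)
      moreover have "c < d" using D(3)[OF K] cd by (auto simp: interior_atLeastAtMost_real)
      moreover have "{c..d} \<subseteq> {a..b}" using D(2) K cd unfolding cbox_interval by blast
      ultimately show ?thesis by (intro exI[of _ c] exI[of _ d]) simp
    qed
    have im: "interior K \<in> sets borel" for K :: "real set" by simp
    have le: "emeasure \<mu> (interior K) \<le> ennreal C * emeasure lborel (interior K)"
      and nul: "K - interior K \<in> null_sets \<mu>" if KD: "K \<in> D" for K
    proof -
      obtain c d where cd: "c < d" "a \<le> c" "d \<le> b" "K = {c..d}" using K[OF KD] by blast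
      have int: "interior K = {c<..<d}" using cd by (simp add: interior_atLeastAtMost_real)
      have "emeasure \<mu> (interior K) \<le> emeasure \<mu> {c..d}" unfolding int by (rule emeasure_mono) auto
      also have "\<dots> \<le> ennreal (C * (d - c))" by (rule bound[OF cd(2,1,3)])
      also have "\<dots> = ennreal C * emeasure lborel (interior K)"
        unfolding int using cd C by (simp add: ennreal_mult)
      finally show "emeasure \<mu> (interior K) \<le> ennreal C * emeasure lborel (interior K)" .
      have "K - interior K = {c} \<union> {d}" unfolding int using cd by auto
      moreover have "{c} \<in> null_sets \<mu>" "{d} \<in> null_sets \<mu>"
        using point[of c] point[of d] cd by (auto simp: null_sets_def)
      ultimately show "K - interior K \<in> null_sets \<mu>" by (metis null_sets.Un)
    qed
    have nulU: "(\<Union>K\<in>D. K - interior K) \<in> null_sets \<mu>" by (rule null_sets_UN'[OF D(1) nul])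
    have disj: "disjoint_family_on interior D"
      using D(4) by (auto simp: disjoint_family_on_def pairwise_def)
    have iU: "(\<Union>K\<in>D. interior K) \<subseteq> U" using KU interior_subset by blast
    have oU: "open (\<Union>K\<in>D. interior K)" by auto
    have "emeasure \<mu> N \<le> emeasure \<mu> ((\<Union>K\<in>D. interior K) \<union> (\<Union>K\<in>D. K - interior K))"
      using D(6) nulU oU by (intro emeasure_mono) auto
    also have "\<dots> = emeasure \<mu> (\<Union>K\<in>D. interior K)"
      using nulU oU by (intro emeasure_Un_null_set) auto
    also have "\<dots> = (\<integral>\<^sup>+K. emeasure \<mu> (interior K) \<partial>count_space D)"
      by (rule emeasure_UN_countable[of D interior \<mu>, OF _ D(1) disj]) simp
    also have "\<dots> \<le> (\<integral>\<^sup>+K. ennreal C * emeasure lborel (interior K) \<partial>count_space D)"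
      by (rule nn_integral_mono) (simp add: le)
    also have "\<dots> = ennreal C * (\<integral>\<^sup>+K. emeasure lborel (interior K) \<partial>count_space D)"
      by (rule nn_integral_cmult) simp
    also have "(\<integral>\<^sup>+K. emeasure lborel (interior K) \<partial>count_space D) = emeasure lborel (\<Union>K\<in>D. interior K)"
      by (rule emeasure_UN_countable[of D interior lborel, OF _ D(1) disj, symmetric]) simp
    also have "\<dots> \<le> emeasure lborel U" using iU Um by (intro emeasure_mono) auto
    also note lU
    finally have "emeasure \<mu> N \<le> ennreal C * ennreal (e / C)" by (simp add: mult_left_mono)
    also have "\<dots> = ennreal e" using C e by (simp add: ennreal_mult[symmetric])
    finally show ?thesis .
  qed
  then have "emeasure \<mu> N \<le> 0 + ennreal e" if "e > 0" for e using that by simp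
  then have "emeasure \<mu> N \<le> 0" by (rule ennreal_le_epsilon)
  then show ?thesis by simp
qed

lemma (in rank_one) Im_F_ge:
  assumes e: "e > 0" and m: "m \<ge> 0" and u: "\<And>x. \<bar>x - l\<bar> \<le> e \<Longrightarrow> m \<le> (cmod (u x))\<^sup>2"
  shows "m \<le> Im (F (Complex l e))"
proof -
  let ?w = "Complex l e"
  have w: "Im ?w \<noteq> 0" using e by simp
  have "(LINT x|lborel. m / (2 * e\<^sup>2) * indicator {l - e..l + e} x) \<le> nsq lborel (R0 ?w u)"
    unfolding nsq_def
  proof (rule integral_mono)
    show "integrable lborel (\<lambda>x. m / (2 * e\<^sup>2) * indicator {l - e..l + e} x)"
      using e by (intro integrable_mult_right integrable_real_indicator) (auto simp: ennreal_less_top)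
    show "integrable lborel (\<lambda>x. (cmod (R0 ?w u x))\<^sup>2)" by (rule L2onD(2)[OF R0_L2[OF w u_L2]])
    fix x
    show "m / (2 * e\<^sup>2) * indicator {l - e..l + e} x \<le> (cmod (R0 ?w u x))\<^sup>2"
    proof (cases "x \<in> {l - e..l + e}")
      case True
      then have x: "\<bar>x - l\<bar> \<le> e" by auto
      then have "(x - l)\<^sup>2 \<le> e\<^sup>2" by (rule power2_le_iff_abs_le[THEN iffD2, rotated]) (use e in simp)
      then have d: "(cmod (of_real x - ?w))\<^sup>2 \<le> 2 * e\<^sup>2" by (simp add: cmod_power2)
      have d0: "0 < (cmod (of_real x - ?w))\<^sup>2" using of_real_diff_ne[OF w, of x] by simp
      have "m / (2 * e\<^sup>2) \<le> (cmod (u x))\<^sup>2 / (cmod (of_real x - ?w))\<^sup>2"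
        by (rule frac_le) (use u[OF x] d d0 in auto)
      then show ?thesis using True by (simp add: R0_def norm_divide power_divide)
    qed simp
  qed
  moreover have "(LINT x|lborel. m / (2 * e\<^sup>2) * indicator {l - e..l + e} x) = m / e"
    using e by (simp add: power2_eq_square)
  ultimately have "m / e \<le> nsq lborel (R0 ?w u)" by simp
  then have "m \<le> e * nsq lborel (R0 ?w u)" using e by (simp add: field_simps)
  then show ?thesis using F_Im[OF w] by simp
qed

context rank_one
begin

lemma borel_transform:
  fixes M :: "'a measure"
  assumes fin: "finite_measure M" and model: "spectral_model M c W (H_op u \<alpha>)" and one: "W (\<lambda>z. 1) u"
    and w: "Im w \<noteq> 0"
  shows "(LINT z|M. 1 / (of_real (c z) - w)) * (1 + of_real \<alpha> * F w) = F w"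
proof -
  interpret finite_measure M by (rule fin)
  have iso: "iso_rel M lborel W" and uni: "unitary_rel M lborel W" and [measurable]: "c \<in> borel_measurable M"
    and d: "\<And>h f. W h f \<Longrightarrow> f \<in> dom \<longleftrightarrow> (\<lambda>z. of_real (c z) * h z) \<in> L2on M"
    and act: "\<And>h f. W h f \<Longrightarrow> f \<in> dom \<Longrightarrow> W (\<lambda>z. of_real (c z) * h z) (H f)"
    using model by (simp_all add: spectral_model_def unitary_rel_def dom_def H_def)
  define h where "h z = 1 / (of_real (c z) - w)" for z
  have [measurable]: "h \<in> borel_measurable M" unfolding h_def[abs_def] by measurable
  have hL: "h \<in> L2on M" by (rule L2on_bounded) (use norm_resolvent_le[OF w] in \<open>auto simp: h_def\<close>)
  obtain g where g: "W h g" using unitary_relD(2)[OF uni hL] by (rule exE)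
  have gL: "g \<in> L2on lborel" by (rule iso_relD(2)[OF iso, OF g])
  have ch: "(\<lambda>z. of_real (c z) * h z) = (\<lambda>z. 1 * 1 + w * h z)"
    using of_real_diff_ne[OF w] by (auto simp: h_def fun_eq_iff field_simps)
  have rel: "W (\<lambda>z. 1 * 1 + w * h z) (\<lambda>x. 1 * u x + w * g x)"
    by (rule iso_relD(3)[OF iso, OF one g])
  have gd: "g \<in> dom" using d[OF g] iso_relD(1)[OF iso, OF rel] by (simp add: ch)
  have "AE x in lborel. H g x = 1 * u x + w * g x"
    by (rule iso_rel_unique[OF iso, OF act[OF g gd, unfolded ch] rel]) simp
  then have "AE x in lborel. g x = (1 - of_real \<alpha> * ip lborel g u) * R0 w u x"
  proof eventually_elim
    case (elim x)
    then have "(of_real x - w) * g x = (1 - of_real \<alpha> * ip lborel g u) * u x"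
      by (simp add: H_apply algebra_simps)
    then show ?case using of_real_diff_ne[OF w, of x] by (simp add: R0_def field_simps)
  qed
  then have "ip lborel g u = ip lborel (\<lambda>x. (1 - of_real \<alpha> * ip lborel g u) * R0 w u x) u"
    by (rule ip_cong_AE_L2(1)[OF gL L2on_scale[OF R0_L2[OF w u_L2]] u_L2])
  also have "\<dots> = (1 - of_real \<alpha> * ip lborel g u) * F w"
    unfolding F_def by (rule ip_scale_left)
  finally have "ip lborel g u * (1 + of_real \<alpha> * F w) = F w" by (simp add: algebra_simps)
  moreover have "ip lborel g u = (LINT z|M. h z)"
    using iso_relD(5)[OF iso, OF g one] by (simp add: ip_def)
  ultimately show ?thesis by (simp add: h_def)
qed

text \<open>The Borel transforms are related by \<open>s = F / (1 + \<alpha> F)\<close>, so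
  \<open>Im s = Im F / |1 + \<alpha> F|\<^sup>2 \<le> 1 / (\<alpha>\<^sup>2 Im F)\<close>: a lower bound for \<open>u\<close> near \<open>l\<close> bounds the spectral measure there.\<close>

lemma spectral_measure_interval_le:
  fixes M :: "'a measure"
  assumes fin: "finite_measure M" and model: "spectral_model M c W (H_op u \<alpha>)" and one: "W (\<lambda>z. 1) u"
    and \<alpha>: "\<alpha> \<noteq> 0" and e: "e > 0" and m: "m > 0"
    and u: "\<And>x. \<bar>x - l\<bar> \<le> e \<Longrightarrow> m \<le> (cmod (u x))\<^sup>2"
  shows "measure M {z \<in> space M. \<bar>c z - l\<bar> \<le> e} \<le> 2 * e / (\<alpha>\<^sup>2 * m)"
proof -
  interpret finite_measure M by (rule fin)
  have [measurable]: "c \<in> borel_measurable M" using model by (simp add: spectral_model_def)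
  let ?w = "Complex l e"
  have w: "Im ?w \<noteq> 0" using e by simp
  define s where "s = (LINT z|M. 1 / (of_real (c z) - ?w))"
  define b where "b = 1 + of_real \<alpha> * F ?w"
  have int: "integrable M (\<lambda>z. 1 / (of_real (c z) - ?w))"
    by (rule L2on_integrable, rule L2on_bounded) (use norm_resolvent_le[OF w] in auto)
  have Im_eq: "Im (1 / (of_real x - ?w)) = e / ((x - l)\<^sup>2 + e\<^sup>2)" for x
    by (simp add: Im_divide)
  have FIm: "m \<le> Im (F ?w)" by (rule Im_F_ge[OF e _ u]) (use m in auto)
  have s: "s * b = F ?w" unfolding s_def b_def by (rule borel_transform[OF fin model one w])
  have b_ge: "(\<alpha> * Im (F ?w))\<^sup>2 \<le> (cmod b)\<^sup>2" by (simp add: b_def cmod_power2)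
  have "\<alpha> * Im (F ?w) \<noteq> 0" using \<alpha> FIm m by simp
  then have b_pos: "0 < (\<alpha> * Im (F ?w))\<^sup>2" by simp
  have "Im (s * b * cnj b) = Im s * (cmod b)\<^sup>2"
    by (simp only: mult.assoc complex_norm_square[symmetric]) simp
  moreover have "Im (F ?w * cnj b) = Im (F ?w)" by (simp add: b_def algebra_simps)
  ultimately have Ims: "Im s * (cmod b)\<^sup>2 = Im (F ?w)" using s by simp
  have "0 < (cmod b)\<^sup>2" using b_pos b_ge by linarith
  then have "Im s = Im (F ?w) / (cmod b)\<^sup>2" using Ims by (simp add: eq_divide_eq)
  also have "\<dots> \<le> Im (F ?w) / (\<alpha> * Im (F ?w))\<^sup>2"
    using b_ge b_pos FIm m by (intro divide_left_mono mult_pos_pos) auto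
  also have "\<dots> = 1 / (\<alpha>\<^sup>2 * Im (F ?w))" using FIm m by (simp add: power2_eq_square)
  also have "\<dots> \<le> 1 / (\<alpha>\<^sup>2 * m)" using FIm m \<alpha> by (intro divide_left_mono mult_left_mono) auto
  finally have Ims_le: "Im s \<le> 1 / (\<alpha>\<^sup>2 * m)" .
  have A: "{z \<in> space M. \<bar>c z - l\<bar> \<le> e} \<in> sets M" by measurable
  have "1 / (2 * e) * measure M {z \<in> space M. \<bar>c z - l\<bar> \<le> e}
      = (LINT z|M. 1 / (2 * e) * indicator {z \<in> space M. \<bar>c z - l\<bar> \<le> e} z)"
    by simp
  also have "\<dots> \<le> (LINT z|M. Im (1 / (of_real (c z) - ?w)))"
  proof (rule integral_mono)
    show "integrable M (\<lambda>z. 1 / (2 * e) * indicator {z \<in> space M. \<bar>c z - l\<bar> \<le> e} z)"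
      using A by (intro integrable_mult_right integrable_real_indicator) (auto simp: emeasure_eq_measure)
    show "integrable M (\<lambda>z. Im (1 / (of_real (c z) - ?w)))" by (rule integrable_Im[OF int])
    fix z
    show "1 / (2 * e) * indicator {z \<in> space M. \<bar>c z - l\<bar> \<le> e} z \<le> Im (1 / (of_real (c z) - ?w))"
    proof (cases "\<bar>c z - l\<bar> \<le> e")
      case True
      then have "(c z - l)\<^sup>2 \<le> e\<^sup>2" by (rule power2_le_iff_abs_le[THEN iffD2, rotated]) (use e in simp)
      then have "e / (2 * e\<^sup>2) \<le> e / ((c z - l)\<^sup>2 + e\<^sup>2)"
        using e by (intro divide_left_mono) (auto intro!: mult_pos_pos add_nonneg_pos)
      moreover have "e / (2 * e\<^sup>2) = 1 / (2 * e)" using e by (simp add: power2_eq_square)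
      ultimately have *: "1 / (2 * e) \<le> Im (1 / (of_real (c z) - ?w))" unfolding Im_eq by simp
      have "0 \<le> 1 / (2 * e)" using e by simp
      with * have "0 \<le> Im (1 / (of_real (c z) - ?w))" by linarith
      with * show ?thesis unfolding indicator_def by (simp split: if_splits)
    next
      case False
      moreover have "0 \<le> e / ((c z - l)\<^sup>2 + e\<^sup>2)" using e by simp
      ultimately show ?thesis unfolding Im_eq by simp
    qed
  qed
  also have "\<dots> = Im s" unfolding s_def by (rule integral_Im[OF int])
  finally have "1 / (2 * e) * measure M {z \<in> space M. \<bar>c z - l\<bar> \<le> e} \<le> 1 / (\<alpha>\<^sup>2 * m)"
    using Ims_le by simp
  then show ?thesis using e m \<alpha> by (simp add: field_simps)
qed

lemma spectral_measure_null:
  fixes M :: "'a measure"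
  assumes fin: "finite_measure M" and model: "spectral_model M c W (H_op u \<alpha>)" and one: "W (\<lambda>z. 1) u"
    and \<alpha>: "\<alpha> \<noteq> 0" and cont: "continuous_on UNIV u" and u0: "\<And>x. x \<noteq> l0 \<Longrightarrow> u x \<noteq> 0"
    and N: "N \<in> sets borel" "emeasure lborel N = 0" "l0 \<notin> N"
  shows "AE z in M. c z \<notin> N"
proof -
  interpret finite_measure M by (rule fin)
  have cm [measurable]: "c \<in> borel_measurable M" using model by (simp add: spectral_model_def)
  let ?\<mu> = "distr M borel c"
  have loc: "emeasure ?\<mu> (N \<inter> {a..b}) = 0" if ab: "a < b" and l0: "l0 \<notin> {a..b}" for a b
  proof -
    have "compact {a..b}" "{a..b} \<noteq> {}" using ab by auto
    moreover have "continuous_on {a..b} (\<lambda>x. (cmod (u x))\<^sup>2)"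
      by (intro continuous_intros continuous_on_subset[OF cont]) auto
    ultimately obtain x0 where x0: "x0 \<in> {a..b}" "\<And>x. x \<in> {a..b} \<Longrightarrow> (cmod (u x0))\<^sup>2 \<le> (cmod (u x))\<^sup>2"
      using continuous_attains_inf[of "{a..b}" "\<lambda>x. (cmod (u x))\<^sup>2"] by blast
    define m where "m = (cmod (u x0))\<^sup>2"
    have m: "m > 0" using u0[of x0] x0(1) l0 by (auto simp: m_def)
    show ?thesis
    proof (rule null_if_interval_bound[OF _ _ _ _ ab])
      show "emeasure lborel (N \<inter> {a..b}) = 0"
        using emeasure_mono[of "N \<inter> {a..b}" N lborel] N by auto
      show "0 < 1 / (\<alpha>\<^sup>2 * m)" using \<alpha> m by simp
      fix x y assume xy: "a \<le> x" "x < y" "y \<le> b"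
      define e where "e = (y - x) / 2"
      define l where "l = (x + y) / 2"
      have e: "e > 0" using xy by (simp add: e_def)
      have mid: "x \<le> t \<and> t \<le> y \<longleftrightarrow> \<bar>t - l\<bar> \<le> e" for t by (auto simp: e_def l_def abs_le_iff field_simps)
      have "emeasure ?\<mu> {x..y} = emeasure M {z \<in> space M. \<bar>c z - l\<bar> \<le> e}"
        by (subst emeasure_distr) (auto simp: mid intro!: arg_cong[where f="emeasure M"])
      also have "\<dots> = ennreal (measure M {z \<in> space M. \<bar>c z - l\<bar> \<le> e})" by (rule emeasure_eq_measure)
      also have "\<dots> \<le> ennreal (2 * e / (\<alpha>\<^sup>2 * m))"
      proof (rule ennreal_leI, rule spectral_measure_interval_le[OF fin model one \<alpha> e m])
        fix t assume "\<bar>t - l\<bar> \<le> e"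
        then have "t \<in> {a..b}" using mid[of t] xy by auto
        then show "m \<le> (cmod (u t))\<^sup>2" unfolding m_def by (rule x0(2))
      qed
      also have "2 * e / (\<alpha>\<^sup>2 * m) = 1 / (\<alpha>\<^sup>2 * m) * (y - x)"
      proof -
        have "2 * e = y - x" by (simp add: e_def)
        then show ?thesis by simp
      qed
      finally show "emeasure ?\<mu> {x..y} \<le> ennreal (1 / (\<alpha>\<^sup>2 * m) * (y - x))" .
    qed (use N in auto)
  qed
  define A where "A n = {l0 + 1 / Suc n..l0 + 1 + Suc n}" for n
  define B where "B n = {l0 - 1 - Suc n..l0 - 1 / Suc n}" for n
  have small: "1 / real (Suc n) \<le> 1" for n by simp
  have "N \<inter> A n \<in> null_sets ?\<mu>" for n
  proof -
    have "l0 + 1 / real (Suc n) < l0 + 1 + real (Suc n)" using small[of n] by (simp only: of_nat_Suc)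
    then show ?thesis using loc[of "l0 + 1 / Suc n" "l0 + 1 + Suc n"] N(1) unfolding A_def by (auto simp: null_sets_def)
  qed
  moreover have "N \<inter> B n \<in> null_sets ?\<mu>" for n
  proof -
    have "l0 - 1 - real (Suc n) < l0 - 1 / real (Suc n)" using small[of n] by (simp only: of_nat_Suc)
    then show ?thesis using loc[of "l0 - 1 - Suc n" "l0 - 1 / Suc n"] N(1) unfolding B_def by (auto simp: null_sets_def)
  qed
  ultimately have nul: "(\<Union>n. N \<inter> A n) \<union> (\<Union>n. N \<inter> B n) \<in> null_sets ?\<mu>" by (intro null_sets.Un null_sets_UN) auto
  have "N \<subseteq> (\<Union>n. N \<inter> A n) \<union> (\<Union>n. N \<inter> B n)"
  proof
    fix t assume t: "t \<in> N"
    then have "t \<noteq> l0" using N(3) by auto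
    then have d: "0 < \<bar>t - l0\<bar>" by simp
    obtain n1 where n1: "1 / real (Suc n1) < \<bar>t - l0\<bar>"
      using reals_Archimedean[OF d] by (auto simp: inverse_eq_divide)
    obtain n2 :: nat where n2: "\<bar>t - l0\<bar> < real n2" using reals_Archimedean2 by blast
    define n where "n = max n1 n2"
    have "1 / real (Suc n) \<le> 1 / real (Suc n1)" by (intro divide_left_mono) (auto simp: n_def)
    then have 1: "1 / real (Suc n) < \<bar>t - l0\<bar>" using n1 by linarith
    have 2: "\<bar>t - l0\<bar> < 1 + real (Suc n)" using n2 by (simp add: n_def)
    have "t \<in> A n \<or> t \<in> B n"
    proof (cases "l0 < t")
      case True
      then have "t \<in> A n" unfolding A_def atLeastAtMost_iff using 1 2 by linarith
      then show ?thesis ..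
    next
      case False
      then have "t \<in> B n" unfolding B_def atLeastAtMost_iff using 1 2 by linarith
      then show ?thesis ..
    qed
    then show "t \<in> (\<Union>n. N \<inter> A n) \<union> (\<Union>n. N \<inter> B n)" using t by blast
  qed
  then have "N \<in> null_sets ?\<mu>" using null_sets_subset[OF nul] N(1) by simp
  then have "AE t in ?\<mu>. t \<notin> N" by (rule AE_not_in)
  then show ?thesis by (subst (asm) AE_distr_iff) (use N in auto)
qed

end

section \<open>Eigenvalues\<close>

locale smooth_rank_one = rank_one +
  fixes l :: real and d :: complex
  assumes cont: "continuous_on UNIV u" and deriv: "(u has_vector_derivative d) (at l)"
begin

definition \<phi> :: cfun where
  "\<phi> x = (if x \<noteq> l then u x / of_real (x - l) else d)"

lemma u_measurable [measurable]: "u \<in> borel_measurable borel"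
  using L2onD(1)[OF u_L2] by simp

lemma phi_measurable [measurable]: "\<phi> \<in> borel_measurable borel"
  unfolding \<phi>_def[abs_def] by measurable

lemma AE_ne: "AE x in lborel. x \<noteq> l"
  by (rule AE_lborel_singleton)

lemma phi_bounded:
  assumes ul: "u l = 0"
  obtains K \<delta> where "\<delta> > 0" "\<And>x. \<bar>x - l\<bar> < \<delta> \<Longrightarrow> cmod (\<phi> x) \<le> K"
proof -
  have "((\<lambda>y. (u y - u l - (y - l) *\<^sub>R d) /\<^sub>R norm (y - l)) \<longlongrightarrow> 0) (at l)"
    using deriv by (simp add: has_vector_derivative_def has_derivative_at_within)
  from tendsto_norm_zero[OF this]
  have "((\<lambda>y. norm (u y - u l - (y - l) *\<^sub>R d) / norm (y - l)) \<longlongrightarrow> 0) (at l)"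
    by (simp add: divide_inverse mult.commute)
  then have "\<forall>\<^sub>F y in at l. norm (u y - u l - (y - l) *\<^sub>R d) / norm (y - l) < 1"
    by (rule order_tendstoD) simp
  then obtain \<delta> where \<delta>: "\<delta> > 0"
    "\<And>y. y \<noteq> l \<Longrightarrow> dist y l < \<delta> \<Longrightarrow> norm (u y - u l - (y - l) *\<^sub>R d) / norm (y - l) < 1"
    unfolding eventually_at by blast
  show thesis
  proof (rule that[OF \<delta>(1)])
    fix x assume x: "\<bar>x - l\<bar> < \<delta>"
    show "cmod (\<phi> x) \<le> cmod d + 1"
    proof (cases "x = l")
      case False
      then have "norm (u x - (x - l) *\<^sub>R d) < \<bar>x - l\<bar>"
        using \<delta>(2)[of x] x ul by (simp add: dist_real_def)
      moreover have "norm (u x) \<le> norm ((x - l) *\<^sub>R d) + norm (u x - (x - l) *\<^sub>R d)"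
        by (metis add_diff_cancel_left' diff_add_cancel norm_triangle_ineq)
      moreover have "norm ((x - l) *\<^sub>R d) = \<bar>x - l\<bar> * cmod d" by simp
      ultimately have "norm (u x) \<le> \<bar>x - l\<bar> * (cmod d + 1)" by (simp only: distrib_left mult_1_right)
      then show ?thesis using False by (simp add: \<phi>_def norm_divide field_simps flip: of_real_diff)
    qed (simp add: \<phi>_def)
  qed
qed

lemma phi_L2:
  assumes ul: "u l = 0"
  shows "\<phi> \<in> L2on lborel"
proof -
  obtain K \<delta> where \<delta>: "\<delta> > 0" and K: "\<And>x. \<bar>x - l\<bar> < \<delta> \<Longrightarrow> cmod (\<phi> x) \<le> K"
    by (rule phi_bounded[OF ul]) blast
  have "integrable lborel (\<lambda>x. (cmod (\<phi> x))\<^sup>2)"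
  proof (rule Bochner_Integration.integrable_bound)
    have "integrable lborel (indicator {l - \<delta>..l + \<delta>} :: real \<Rightarrow> real)"
      by (rule integrable_real_indicator) (use \<delta> in \<open>auto simp: ennreal_less_top\<close>)
    then show "integrable lborel (\<lambda>x. K\<^sup>2 * indicator {l - \<delta>..l + \<delta>} x + (cmod (u x))\<^sup>2 / \<delta>\<^sup>2)"
      using L2onD(2)[OF u_L2] by simp
    have "(cmod (\<phi> x))\<^sup>2 \<le> K\<^sup>2 * indicator {l - \<delta>..l + \<delta>} x + (cmod (u x))\<^sup>2 / \<delta>\<^sup>2" for x
    proof (cases "\<bar>x - l\<bar> < \<delta>")
      case True
      then have "x \<in> {l - \<delta>..l + \<delta>}" by auto
      moreover have "(cmod (\<phi> x))\<^sup>2 \<le> K\<^sup>2" using K[OF True] by (intro power_mono) auto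
      ultimately show ?thesis by (simp add: add_increasing2)
    next
      case False
      then have "\<delta> \<le> \<bar>x - l\<bar>" by simp
      then have ne: "x \<noteq> l" and le: "\<delta>\<^sup>2 \<le> \<bar>x - l\<bar>\<^sup>2" using \<delta> power_mono[of \<delta> "\<bar>x - l\<bar>" 2] by auto
      have "(cmod (\<phi> x))\<^sup>2 = (cmod (u x))\<^sup>2 / \<bar>x - l\<bar>\<^sup>2"
        using ne by (simp add: \<phi>_def norm_divide power_divide flip: of_real_diff)
      also have "\<dots> \<le> (cmod (u x))\<^sup>2 / \<delta>\<^sup>2"
        using le \<delta> ne by (intro divide_left_mono mult_pos_pos) auto
      finally show ?thesis by (simp add: add_increasing)
    qed
    then show "AE x in lborel. norm ((cmod (\<phi> x))\<^sup>2)
        \<le> norm (K\<^sup>2 * indicator {l - \<delta>..l + \<delta>} x + (cmod (u x))\<^sup>2 / \<delta>\<^sup>2)"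
      by (intro AE_I2) (simp add: abs_of_nonneg)
  qed measurable
  then show ?thesis by (simp add: L2on_def)
qed

lemma x_phi: "u l = 0 \<Longrightarrow> of_real x * \<phi> x = u x + of_real l * \<phi> x"
  by (auto simp: \<phi>_def field_simps)

lemma phi_dom:
  assumes "u l = 0"
  shows "\<phi> \<in> dom"
  using phi_L2[OF assms] L2on_lincomb[OF u_L2 phi_L2[OF assms], of 1 "of_real l"]
  by (simp add: dom_iff x_phi[OF assms])

lemma H_phi:
  assumes "u l = 0"
  shows "H \<phi> x = of_real l * \<phi> x + (1 + of_real \<alpha> * ip lborel \<phi> u) * u x"
  unfolding H_apply x_phi[OF assms] by (simp add: algebra_simps)

lemma phi_nonzero:
  assumes ul: "u l = 0"
  shows "\<not> (AE x in lborel. \<phi> x = 0)"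
proof
  assume "AE x in lborel. \<phi> x = 0"
  then have "AE x in lborel. u x = 0"
  proof eventually_elim
    case (elim x)
    then show ?case using x_phi[OF ul, of x] by simp
  qed
  then have "nsq lborel u = 0" by (simp add: nsq_eq_0_iff[OF u_L2])
  then show False by (simp add: u_norm)
qed

lemma pv_gamma_eq:
  assumes ul: "u l = 0"
  shows "pv_gamma (\<lambda>x. of_real ((cmod (u x))\<^sup>2)) l = ip lborel \<phi> u"
  unfolding pv_gamma_def
proof (rule tendsto_Lim[OF trivial_limit_at_right_real])
  let ?G = "\<lambda>\<epsilon>. LINT x:{x. \<epsilon> \<le> \<bar>x - l\<bar>}|lborel. complex_of_real ((cmod (u x))\<^sup>2) / of_real (x - l)"
  have int: "integrable lborel (\<lambda>x. \<phi> x * cnj (u x))" by (rule L2on_prod[OF phi_L2[OF ul] u_L2])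
  show "(?G \<longlongrightarrow> ip lborel \<phi> u) (at_right 0)"
  proof (rule tendsto_at_right_sequentially[of 0 1])
    fix S :: "nat \<Rightarrow> real" assume S: "\<And>n. 0 < S n" "S \<longlonglongrightarrow> 0"
    have "(\<lambda>n. LINT x|lborel. indicator {x. S n \<le> \<bar>x - l\<bar>} x *\<^sub>R (\<phi> x * cnj (u x))) \<longlonglongrightarrow> (LINT x|lborel. \<phi> x * cnj (u x))"
    proof (rule integral_dominated_convergence[where w="\<lambda>x. cmod (\<phi> x * cnj (u x))"])
      show "integrable lborel (\<lambda>x. cmod (\<phi> x * cnj (u x)))" using int by (rule integrable_norm)
      show "AE x in lborel. (\<lambda>n. indicator {x. S n \<le> \<bar>x - l\<bar>} x *\<^sub>R (\<phi> x * cnj (u x))) \<longlonglongrightarrow> \<phi> x * cnj (u x)"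
        using AE_ne
      proof eventually_elim
        case (elim x)
        then have "0 < \<bar>x - l\<bar>" by simp
        from order_tendstoD(2)[OF S(2) this]
        have "\<forall>\<^sub>F n in sequentially. indicator {x. S n \<le> \<bar>x - l\<bar>} x *\<^sub>R (\<phi> x * cnj (u x)) = \<phi> x * cnj (u x)"
          by eventually_elim simp
        then show ?case by (rule tendsto_eventually)
      qed
      show "AE x in lborel. norm (indicator {x. S n \<le> \<bar>x - l\<bar>} x *\<^sub>R (\<phi> x * cnj (u x))) \<le> cmod (\<phi> x * cnj (u x))" for n
        by (auto simp: indicator_def)
    qed measurable
    moreover have "?G (S n) = (LINT x|lborel. indicator {x. S n \<le> \<bar>x - l\<bar>} x *\<^sub>R (\<phi> x * cnj (u x)))" for n
      unfolding set_lebesgue_integral_def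
    proof (rule Bochner_Integration.integral_cong[OF refl])
      fix x
      show "indicator {x. S n \<le> \<bar>x - l\<bar>} x *\<^sub>R (complex_of_real ((cmod (u x))\<^sup>2) / of_real (x - l))
        = indicator {x. S n \<le> \<bar>x - l\<bar>} x *\<^sub>R (\<phi> x * cnj (u x))"
        using S(1)[of n] by (cases "x = l") (simp_all add: \<phi>_def complex_norm_square del: of_real_power)
    qed
    ultimately show "(\<lambda>n. ?G (S n)) \<longlonglongrightarrow> ip lborel \<phi> u" by (simp add: ip_def)
  qed simp
qed

lemma eigenvector_imp:
  assumes f: "f \<in> dom" and eig: "AE x in lborel. H f x = of_real l * f x"
    and nz: "\<not> (AE x in lborel. f x = 0)"
  obtains k where "u l = 0" "AE x in lborel. f x = k * \<phi> x" "1 + of_real \<alpha> * ip lborel \<phi> u = 0"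
proof -
  define k where "k = - of_real \<alpha> * ip lborel f u"
  have fL: "f \<in> L2on lborel" by (rule dom_L2[OF f])
  have fk: "AE x in lborel. f x = k * \<phi> x"
    using eig AE_ne
  proof eventually_elim
    case (elim x)
    then have "of_real (x - l) * f x = k * u x" by (simp add: H_apply k_def algebra_simps)
    then show ?case using elim(2) by (simp add: \<phi>_def field_simps flip: of_real_diff)
  qed
  have k: "k \<noteq> 0" using fk nz by auto
  have ul: "u l = 0"
  proof (rule ccontr)
    assume ul: "u l \<noteq> 0"
    define m where "m = cmod (u l) / 2"
    have m: "m > 0" using ul by (simp add: m_def)
    have "isCont u l" using cont by (simp add: continuous_on_eq_continuous_at)
    then obtain \<delta> where \<delta>: "\<delta> > 0" "\<And>x. dist x l < \<delta> \<Longrightarrow> dist (u x) (u l) < m"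
      using m unfolding continuous_at_eps_delta by blast
    have lower: "m \<le> cmod (u x)" if "\<bar>x - l\<bar> < \<delta>" for x
    proof -
      have "cmod (u l - u x) < m" using \<delta>(2)[of x] that by (simp add: dist_norm norm_minus_commute)
      then show ?thesis using norm_triangle_ineq2[of "u l" "u x"] by (simp add: m_def)
    qed
    define C where "C = (cmod k * m)\<^sup>2"
    have C: "C > 0" using k m by (simp add: C_def)
    have blow: "C / (2 * \<eta>) \<le> nsq lborel f" if \<eta>: "0 < \<eta>" "\<eta> < \<delta>" for \<eta>
    proof -
      have "(LINT x|lborel. C / \<eta>\<^sup>2 * indicator {l + \<eta> / 2..l + \<eta>} x) \<le> nsq lborel f"
        unfolding nsq_def
      proof (rule integral_mono_AE)
        show "integrable lborel (\<lambda>x. C / \<eta>\<^sup>2 * indicator {l + \<eta> / 2..l + \<eta>} x)"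
          using \<eta> by (intro integrable_mult_right integrable_real_indicator) (auto simp: ennreal_less_top)
        show "integrable lborel (\<lambda>x. (cmod (f x))\<^sup>2)" by (rule L2onD(2)[OF fL])
        show "AE x in lborel. C / \<eta>\<^sup>2 * indicator {l + \<eta> / 2..l + \<eta>} x \<le> (cmod (f x))\<^sup>2"
          using fk
        proof eventually_elim
          case (elim x)
          show ?case
          proof (cases "x \<in> {l + \<eta> / 2..l + \<eta>}")
            case True
            then have x: "0 < x - l" "x - l \<le> \<eta>" using \<eta> by auto
            have "cmod k * m / \<eta> \<le> cmod k * cmod (u x) / (x - l)"
              using x \<eta> m lower[of x] by (intro frac_le mult_left_mono) auto
            also have "\<dots> = cmod (f x)"
              using x by (simp add: elim \<phi>_def norm_mult norm_divide flip: of_real_diff)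
            finally have "(cmod k * m / \<eta>)\<^sup>2 \<le> (cmod (f x))\<^sup>2" using m \<eta> by (intro power_mono) auto
            then show ?thesis using True by (simp add: C_def power_divide)
          qed simp
        qed
      qed
      moreover have "(LINT x|lborel. C / \<eta>\<^sup>2 * indicator {l + \<eta> / 2..l + \<eta>} x) = C / (2 * \<eta>)"
        using \<eta> by (simp add: power2_eq_square field_simps)
      ultimately show ?thesis by simp
    qed
    define A where "A = nsq lborel f + 1"
    have A: "A > 0" using nsq_nonneg[of lborel f] by (simp add: A_def)
    define \<eta> where "\<eta> = min (\<delta> / 2) (C / (2 * A))"
    have \<eta>: "0 < \<eta>" "\<eta> < \<delta>" "\<eta> \<le> C / (2 * A)" using \<delta>(1) C A by (auto simp: \<eta>_def)
    have "A \<le> C / (2 * \<eta>)" using \<eta> A by (simp add: field_simps)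
    with blow[OF \<eta>(1,2)] show False by (simp add: A_def)
  qed
  have "ip lborel f u = ip lborel (\<lambda>x. k * \<phi> x) u"
    by (rule ip_cong_AE_L2(1)[OF fL L2on_scale[OF phi_L2[OF ul]] u_L2 fk])
  then have "ip lborel f u = k * ip lborel \<phi> u" by (simp only: ip_scale_left)
  then have "k = - of_real \<alpha> * (k * ip lborel \<phi> u)" using k_def by simp
  then have "k + of_real \<alpha> * (k * ip lborel \<phi> u) = 0" by (simp only: eq_neg_iff_add_eq_0 mult_minus_left)
  then have "k * (1 + of_real \<alpha> * ip lborel \<phi> u) = 0" by (simp add: algebra_simps)
  then have "1 + of_real \<alpha> * ip lborel \<phi> u = 0" using k by simp
  from that[OF ul fk this] show thesis .
qed

end

section \<open>The absolutely continuous subspace\<close>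

lemma spectral_model_mult_x: "spectral_model lborel (\<lambda>x. x) (\<lambda>h f. h \<in> L2on lborel \<and> f \<in> L2on lborel \<and> (AE x in lborel. h x = f x)) (H_op u 0)"
proof -
  let ?W = "\<lambda>h f :: cfun. h \<in> L2on lborel \<and> f \<in> L2on lborel \<and> (AE x in lborel. h x = f x)"
  have iso: "iso_rel lborel lborel ?W"
  proof (rule iso_relI)
    fix f g f' g' :: cfun and a b assume h: "?W f g" "?W f' g'"
    have "AE x in lborel. a * f x + b * f' x = a * g x + b * g' x" using h by auto
    with h show "?W (\<lambda>x. a * f x + b * f' x) (\<lambda>x. a * g x + b * g' x)" by (auto intro: L2on_lincomb)
    show "ip lborel f f' = ip lborel g g'"
      using h by (intro ip_cong_AE L2onD(1)) auto
  next
    fix F G f g assume FG: "\<And>n::nat. ?W (F n) (G n)" and f: "f \<in> L2on lborel" and g: "g \<in> L2on lborel"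
      and lim: "l2_tendsto lborel F f" "l2_tendsto lborel G g"
    have FL: "F n \<in> L2on lborel" and GL: "G n \<in> L2on lborel" and eq: "AE x in lborel. F n x = G n x" for n
      using FG by auto
    have "nsq lborel (\<lambda>x. F n x - g x) = nsq lborel (\<lambda>x. G n x - g x)" for n
      by (rule nsq_cong_AE[OF L2onD(1)[OF L2on_diff[OF FL g]] L2onD(1)[OF L2on_diff[OF GL g]]]) (use eq[of n] in auto)
    then have lim': "l2_tendsto lborel F g" using lim(2) by (simp add: l2_tendsto_def)
    have "(\<lambda>n. 2 * nsq lborel (\<lambda>x. F n x - f x) + 2 * nsq lborel (\<lambda>x. F n x - g x)) \<longlonglongrightarrow> 2 * 0 + 2 * 0"
      by (intro tendsto_intros l2_tendstoD lim lim')
    moreover have "nsq lborel (\<lambda>x. f x - g x) \<le> 2 * nsq lborel (\<lambda>x. F n x - f x) + 2 * nsq lborel (\<lambda>x. F n x - g x)" for n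
      using nsq_triangle[OF f FL[of n] g] nsq_minus_commute[of lborel f "F n"] by simp
    ultimately have "nsq lborel (\<lambda>x. f x - g x) \<le> 2 * 0 + 2 * 0" by (intro LIMSEQ_le_const) auto
    then have "nsq lborel (\<lambda>x. f x - g x) = 0" using nsq_nonneg[of lborel "\<lambda>x. f x - g x"] by simp
    then show "?W f g" using nsq_eq_0_iff[OF L2on_diff[OF f g]] f g by simp
  qed auto
  have "unitary_rel lborel lborel ?W" using iso by (auto simp: unitary_rel_def)
  moreover have "f \<in> fst (H_op u 0) \<longleftrightarrow> (\<lambda>x. of_real x * h x) \<in> L2on lborel"
    and "f \<in> fst (H_op u 0) \<Longrightarrow> ?W (\<lambda>x. of_real x * h x) (snd (H_op u 0) f)" if W: "?W h f" for h f
  proof -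
    have m: "h \<in> borel_measurable lborel" "f \<in> borel_measurable lborel" using W L2onD(1) by blast+
    have eq: "AE x in lborel. of_real x * h x = of_real x * f x" using W by auto
    have eq': "AE x in lborel. of_real x * f x = of_real x * h x" using W by auto
    have xf: "(\<lambda>x. of_real x * h x) \<in> L2on lborel \<longleftrightarrow> (\<lambda>x. of_real x * f x) \<in> L2on lborel"
    proof
      show "(\<lambda>x. of_real x * f x) \<in> L2on lborel" if "(\<lambda>x. of_real x * h x) \<in> L2on lborel"
        by (rule L2on_cong_AE[OF that _ eq]) (use m in measurable)
      show "(\<lambda>x. of_real x * h x) \<in> L2on lborel" if "(\<lambda>x. of_real x * f x) \<in> L2on lborel"
        by (rule L2on_cong_AE[OF that _ eq']) (use m in measurable)
    qed
    show iff: "f \<in> fst (H_op u 0) \<longleftrightarrow> (\<lambda>x. of_real x * h x) \<in> L2on lborel"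
      using W by (simp add: H_op_def in_dom_iff xf)
    show "?W (\<lambda>x. of_real x * h x) (snd (H_op u 0) f)" if "f \<in> fst (H_op u 0)"
    proof -
      have "snd (H_op u 0) f = (\<lambda>x. of_real x * f x)" by (auto simp: H_op_def mult_x_def)
      moreover have "(\<lambda>x. of_real x * h x) \<in> L2on lborel" using that iff by simp
      ultimately show ?thesis using xf eq by simp
    qed
  qed
  moreover have "(\<lambda>x::real. x) \<in> borel_measurable lborel" by simp
  ultimately show ?thesis unfolding spectral_model_def by blast
qed

lemma H_ac_mult_x: "H_ac (H_op u 0) = L2"
proof -
  have "fst (H_op u 0) \<subseteq> L2on lborel" by (auto simp: H_op_def in_dom_iff)
  from spectral_resolution_of_model[OF spectral_model_mult_x this]
  obtain E where E: "spectral_resolution E (H_op u 0)"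
    and sc: "\<And>h f. h \<in> L2on lborel \<and> f \<in> L2on lborel \<and> (AE x in lborel. h x = f x) \<Longrightarrow>
      scalar_measure E f = distr (density lborel (\<lambda>z. ennreal ((cmod (h z))\<^sup>2))) borel (\<lambda>x. x)" by blast
  have "f \<in> H_ac (H_op u 0)" if f: "f \<in> L2" for f
  proof -
    have fL: "f \<in> L2on lborel" using f by (simp add: L2_eq)
    note [measurable] = L2onD(1)[OF fL]
    have "absolutely_continuous lborel (scalar_measure E f)"
      unfolding absolutely_continuous_def
    proof
      fix N :: "real set" assume N: "N \<in> null_sets lborel"
      then have [measurable]: "N \<in> sets borel" by (simp add: null_sets_def)
      have "AE x in lborel. x \<notin> N" by (rule AE_not_in[OF N])
      then have "AE x in density lborel (\<lambda>z. ennreal ((cmod (f z))\<^sup>2)). x \<notin> N"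
        by (subst AE_density) auto
      then have "AE x in scalar_measure E f. x \<notin> N"
        unfolding sc[of f f, simplified, OF fL] by (subst AE_distr_iff) auto
      then show "N \<in> null_sets (scalar_measure E f)"
        by (subst (asm) AE_iff_null_sets[symmetric]) simp_all
    qed
    with E f show ?thesis by (auto simp: H_ac_def)
  qed
  then show ?thesis by (auto simp: H_ac_def)
qed

lemma (in cyclic_rank_one) in_H_ac:
  assumes \<alpha>: "\<alpha> \<noteq> 0" and cont: "continuous_on UNIV u" and u0: "\<And>x. x \<noteq> l \<Longrightarrow> u x \<noteq> 0"
    and f: "f \<in> L2on lborel"
    and orth: "\<And>g. g \<in> dom \<Longrightarrow> AE x in lborel. H g x = of_real l * g x \<Longrightarrow> ip lborel f g = 0"
  shows "f \<in> H_ac (H_op u \<alpha>)"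
proof -
  obtain M :: "complex measure" and c W where M: "prob_space M"
    and model: "spectral_model M c W (H_op u \<alpha>)" and one: "W (\<lambda>z. 1) u"
    by (rule spectral_model_exists) blast
  interpret prob_space M by (rule M)
  have iso: "iso_rel M lborel W" and uni: "unitary_rel M lborel W" and [measurable]: "c \<in> borel_measurable M"
    and d: "\<And>h f. W h f \<Longrightarrow> f \<in> dom \<longleftrightarrow> (\<lambda>z. of_real (c z) * h z) \<in> L2on M"
    and act: "\<And>h f. W h f \<Longrightarrow> f \<in> dom \<Longrightarrow> W (\<lambda>z. of_real (c z) * h z) (H f)"
    using model by (simp_all add: spectral_model_def unitary_rel_def dom_def H_def)
  have "fst (H_op u \<alpha>) \<subseteq> L2on lborel" using dom_L2 by (auto simp: dom_def)
  from spectral_resolution_of_model[OF model this]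
  obtain E where E: "spectral_resolution E (H_op u \<alpha>)"
    and sc: "\<And>h f. W h f \<Longrightarrow> scalar_measure E f = distr (density M (\<lambda>z. ennreal ((cmod (h z))\<^sup>2))) borel c"
    by blast
  obtain h where h: "W h f" using unitary_relD(3)[OF uni f] by (rule exE)
  have hL: "h \<in> L2on M" by (rule iso_relD(1)[OF iso, OF h])
  note [measurable] = L2onD(1)[OF hL]
  define k where "k z = (if c z = l then h z else 0)" for z
  have "(\<lambda>z. (if c z = l then 1 else 0) * h z) \<in> L2on M"
    by (rule L2on_mult_bounded[OF hL, of _ 1]) auto
  then have kL: "k \<in> L2on M" by (simp add: k_def[abs_def] if_distrib if_distribR cong: if_cong)
  obtain g where g: "W k g" using unitary_relD(2)[OF uni kL] by (rule exE)
  have ck: "(\<lambda>z. of_real (c z) * k z) = (\<lambda>z. of_real l * k z)" by (auto simp: k_def)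
  have gd: "g \<in> dom" using d[OF g] L2on_scale[OF kL] by (simp add: ck)
  have "AE x in lborel. H g x = of_real l * g x"
    by (rule iso_rel_unique[OF iso, OF act[OF g gd, unfolded ck] iso_rel_scale[OF iso, OF g]]) simp
  then have "ip lborel f g = 0" by (rule orth[OF gd])
  then have "ip M h k = 0" using iso_relD(5)[OF iso, OF h g] by simp
  moreover have "ip M h k = ip M k k"
    unfolding ip_def by (rule Bochner_Integration.integral_cong) (auto simp: k_def)
  ultimately have "nsq M k = 0" by (simp add: ip_self)
  then have atom: "AE z in M. k z = 0" by (simp add: nsq_eq_0_iff[OF kL])
  have "absolutely_continuous lborel (scalar_measure E f)"
    unfolding absolutely_continuous_def
  proof
    fix N :: "real set" assume N: "N \<in> null_sets lborel"
    then have [measurable]: "N \<in> sets borel" by (simp add: null_sets_def)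
    have "emeasure lborel (N - {l}) = 0" using emeasure_mono[of "N - {l}" N lborel] N by (auto simp: null_sets_def)
    from spectral_measure_null[OF finite_measure_axioms model one \<alpha> cont u0 _ this, of l]
    have "AE z in M. c z \<notin> N - {l}" by simp
    with atom have "AE z in M. c z \<in> N \<longrightarrow> h z = 0" by eventually_elim (auto simp: k_def)
    then have "AE z in density M (\<lambda>z. ennreal ((cmod (h z))\<^sup>2)). c z \<notin> N"
      by (subst AE_density) auto
    then have "AE x in scalar_measure E f. x \<notin> N"
      unfolding sc[OF h] by (subst AE_distr_iff) auto
    then show "N \<in> null_sets (scalar_measure E f)"
      by (subst (asm) AE_iff_null_sets[symmetric]) simp_all
  qed
  with E f show ?thesis by (auto simp: H_ac_def L2_eq)
qed

theorem theorem3p3: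
  fixes u :: "real \<Rightarrow> complex" and \<alpha>\<^sub>0 l\<^sub>0 :: real and \<phi> :: "real \<Rightarrow> complex"
  assumes u_schwartz: "schwartz u"
    and u_norm: "l2_norm u = 1"
  defines "\<phi> \<equiv> \<lambda>x. if x \<noteq> l\<^sub>0 then u x / of_real (x - l\<^sub>0) else vector_derivative u (at l\<^sub>0)"
  shows
    "(eigenvalue (H_op u \<alpha>\<^sub>0) (of_real l\<^sub>0) \<longleftrightarrow>
        u l\<^sub>0 = 0 \<and> 1 + of_real \<alpha>\<^sub>0 * pv_gamma (\<lambda>x. of_real ((cmod (u x))\<^sup>2)) l\<^sub>0 = 0) \<and>
     (eigenvalue (H_op u \<alpha>\<^sub>0) (of_real l\<^sub>0) \<longrightarrow>
        simple_eigenvalue (H_op u \<alpha>\<^sub>0) (of_real l\<^sub>0) \<and>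
        eigenvector (H_op u \<alpha>\<^sub>0) (of_real l\<^sub>0) \<phi>) \<and>
     ((\<forall>x. u x = 0 \<longleftrightarrow> x = l\<^sub>0) \<and>
        1 + of_real \<alpha>\<^sub>0 * pv_gamma (\<lambda>x. of_real ((cmod (u x))\<^sup>2)) l\<^sub>0 = 0 \<longrightarrow>
        H_ac (H_op u \<alpha>\<^sub>0) = orth_compl \<phi> \<and>
        (\<forall>\<alpha>::real. \<alpha> \<noteq> \<alpha>\<^sub>0 \<longrightarrow> H_ac (H_op u \<alpha>) = L2))"
proof -
  have u_diff: "u differentiable (at x)" for x
  proof -
    have "(vderiv ^^ 0) u differentiable (at x)" using u_schwartz unfolding schwartz_def by blast
    then show ?thesis by simp
  qed
  then have cont: "continuous_on UNIV u"
    by (simp add: continuous_on_eq_continuous_at differentiable_imp_continuous_within)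
  have nsq: "nsq lborel u = 1" using u_norm by (simp add: l2_norm_eq)
  have uL: "u \<in> L2on lborel"
    unfolding L2on_def
  proof (intro CollectI conjI)
    show "u \<in> borel_measurable lborel" using borel_measurable_continuous_onI[OF cont] by simp
    show "integrable lborel (\<lambda>x. (cmod (u x))\<^sup>2)"
      using not_integrable_integral_eq[of lborel "\<lambda>x. (cmod (u x))\<^sup>2"] nsq by (auto simp: nsq_def)
  qed
  have deriv: "(u has_vector_derivative vector_derivative u (at l\<^sub>0)) (at l\<^sub>0)"
    using u_diff[of l\<^sub>0] by (simp add: vector_derivative_works)
  have smooth: "smooth_rank_one u l\<^sub>0 (vector_derivative u (at l\<^sub>0))"
    by unfold_locales (use uL nsq cont deriv in auto)
  interpret A: smooth_rank_one u \<alpha>\<^sub>0 l\<^sub>0 "vector_derivative u (at l\<^sub>0)" by (rule smooth)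
  have phi: "\<phi> = A.\<phi>" by (auto simp: \<phi>_def A.\<phi>_def)
  define \<gamma> where "\<gamma> = pv_gamma (\<lambda>x. of_real ((cmod (u x))\<^sup>2)) l\<^sub>0"
  have \<gamma>: "\<gamma> = ip lborel \<phi> u" if "u l\<^sub>0 = 0"
    unfolding \<gamma>_def phi by (rule A.pv_gamma_eq[OF that])
  have space: "f \<in> eigenspace (H_op u \<alpha>\<^sub>0) (of_real l\<^sub>0) \<longleftrightarrow>
      f \<in> A.dom \<and> (AE x in lborel. A.H f x = of_real l\<^sub>0 * f x)" for f
    by (simp add: eigenspace_def ae_eq_def A.dom_def A.H_def)
  have vec: "eigenvector (H_op u \<alpha>\<^sub>0) (of_real l\<^sub>0) f \<longleftrightarrow>
      f \<in> A.dom \<and> (AE x in lborel. A.H f x = of_real l\<^sub>0 * f x) \<and> \<not> (AE x in lborel. f x = 0)" for f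
    by (simp add: eigenvector_def space ae_eq_def)
  have phi_vec: "eigenvector (H_op u \<alpha>\<^sub>0) (of_real l\<^sub>0) \<phi>"
    if "u l\<^sub>0 = 0" "1 + of_real \<alpha>\<^sub>0 * \<gamma> = 0"
    using that A.H_phi[OF that(1)] A.phi_dom[OF that(1)] A.phi_nonzero[OF that(1)]
    unfolding vec \<gamma>[OF that(1)] phi by simp
  have ev: "u l\<^sub>0 = 0 \<and> 1 + of_real \<alpha>\<^sub>0 * \<gamma> = 0" if l: "eigenvalue (H_op u \<alpha>\<^sub>0) (of_real l\<^sub>0)"
  proof -
    obtain f where f: "eigenvector (H_op u \<alpha>\<^sub>0) (of_real l\<^sub>0) f" using l by (auto simp: eigenvalue_def)
    show ?thesis
      by (rule A.eigenvector_imp[of f]) (use f \<gamma> in \<open>auto simp: vec phi\<close>)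
  qed
  have mult: "\<exists>c. ae_eq g (\<lambda>x. c * \<phi> x)" if "g \<in> eigenspace (H_op u \<alpha>\<^sub>0) (of_real l\<^sub>0)" for g
  proof (cases "AE x in lborel. g x = 0")
    case True
    then show ?thesis by (intro exI[of _ 0]) (simp add: ae_eq_def)
  next
    case False
    show ?thesis
      by (rule A.eigenvector_imp[of g]) (use that False in \<open>auto simp: space phi ae_eq_def\<close>)
  qed
  have part_a1: "eigenvalue (H_op u \<alpha>\<^sub>0) (of_real l\<^sub>0) \<longleftrightarrow> u l\<^sub>0 = 0 \<and> 1 + of_real \<alpha>\<^sub>0 * \<gamma> = 0"
    using ev phi_vec by (auto simp: eigenvalue_def)
  have part_a2: "simple_eigenvalue (H_op u \<alpha>\<^sub>0) (of_real l\<^sub>0) \<and> eigenvector (H_op u \<alpha>\<^sub>0) (of_real l\<^sub>0) \<phi>"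
    if "eigenvalue (H_op u \<alpha>\<^sub>0) (of_real l\<^sub>0)"
    using ev[OF that] phi_vec mult by (auto simp: simple_eigenvalue_def)
  have part_b: "H_ac (H_op u \<alpha>\<^sub>0) = orth_compl \<phi> \<and> (\<forall>\<alpha>::real. \<alpha> \<noteq> \<alpha>\<^sub>0 \<longrightarrow> H_ac (H_op u \<alpha>) = L2)"
    if zero: "\<forall>x. u x = 0 \<longleftrightarrow> x = l\<^sub>0" and g: "1 + of_real \<alpha>\<^sub>0 * \<gamma> = 0"
  proof -
    have ul: "u l\<^sub>0 = 0" and u0: "\<And>x. x \<noteq> l\<^sub>0 \<Longrightarrow> u x \<noteq> 0" using zero by auto
    have cyclic: "cyclic_rank_one u"
      by unfold_locales (use uL nsq zero AE_lborel_singleton[of l\<^sub>0] in auto)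
    have \<alpha>0: "\<alpha>\<^sub>0 \<noteq> 0" using g by auto
    interpret C: cyclic_rank_one u \<alpha>\<^sub>0 by (rule cyclic)
    have phi_eig: "\<phi> \<in> A.dom" "AE x in lborel. A.H \<phi> x = of_real l\<^sub>0 * \<phi> x"
      using phi_vec[OF ul g] unfolding vec by auto
    have "H_ac (H_op u \<alpha>\<^sub>0) \<subseteq> orth_compl \<phi>"
      using A.ac_orthogonal_eigenvector[OF _ phi_eig] by (auto simp: H_ac_def orth_compl_def L2_eq l2_inner_eq)
    moreover have "f \<in> H_ac (H_op u \<alpha>\<^sub>0)" if f: "f \<in> orth_compl \<phi>" for f
    proof (rule C.in_H_ac[OF \<alpha>0 cont u0])
      show fL: "f \<in> L2on lborel" using f by (simp add: orth_compl_def L2_eq)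
      fix e assume e: "e \<in> A.dom" "AE x in lborel. A.H e x = of_real l\<^sub>0 * e x"
      then obtain c where c: "AE x in lborel. e x = c * \<phi> x" using mult[of e] by (auto simp: space ae_eq_def)
      have "ip lborel f e = ip lborel f (\<lambda>x. c * \<phi> x)"
        by (rule ip_cong_AE_L2(2)[OF A.dom_L2[OF e(1)] L2on_scale[OF A.dom_L2[OF phi_eig(1)]] fL c])
      then show "ip lborel f e = 0" using f by (simp add: ip_scale_right orth_compl_def l2_inner_eq)
    qed
    moreover have "H_ac (H_op u \<alpha>) = L2" if "\<alpha> \<noteq> \<alpha>\<^sub>0" for \<alpha>
    proof (cases "\<alpha> = 0")
      case True
      then show ?thesis by (simp add: H_ac_mult_x)
    next
      case False
      interpret B: smooth_rank_one u \<alpha> l\<^sub>0 "vector_derivative u (at l\<^sub>0)" by (rule smooth)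
      interpret D: cyclic_rank_one u \<alpha> by (rule cyclic)
      have pv': "\<gamma> = ip lborel B.\<phi> u" unfolding \<gamma>_def by (rule B.pv_gamma_eq[OF ul])
      have "f \<in> H_ac (H_op u \<alpha>)" if f: "f \<in> L2" for f
      proof (rule D.in_H_ac[OF False cont u0])
        show fL: "f \<in> L2on lborel" using f by (simp add: L2_eq)
        fix e assume e: "e \<in> B.dom" "AE x in lborel. B.H e x = of_real l\<^sub>0 * e x"
        have "AE x in lborel. e x = 0"
        proof (rule ccontr)
          assume "\<not> (AE x in lborel. e x = 0)"
          then have "1 + of_real \<alpha> * \<gamma> = 0" unfolding pv' by (rule B.eigenvector_imp[OF e])
          have "of_real (\<alpha> - \<alpha>\<^sub>0) * \<gamma> = (1 + of_real \<alpha> * \<gamma>) - (1 + of_real \<alpha>\<^sub>0 * \<gamma>)"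
            by (simp add: algebra_simps)
          also have "\<dots> = 0" using \<open>1 + of_real \<alpha> * \<gamma> = 0\<close> g by simp
          finally have "of_real (\<alpha> - \<alpha>\<^sub>0) * \<gamma> = 0" .
          moreover have "\<gamma> \<noteq> 0" using g by auto
          ultimately show False using \<open>\<alpha> \<noteq> \<alpha>\<^sub>0\<close> by simp
        qed
        then have "ip lborel f e = ip lborel f (\<lambda>x. 0)"
          by (rule ip_cong_AE_L2(2)[OF B.dom_L2[OF e(1)] L2on_zero fL])
        then show "ip lborel f e = 0" by (simp add: ip_def)
      qed
      then show ?thesis by (auto simp: H_ac_def)
    qed
    ultimately show ?thesis by blast
  qed
  show ?thesis using part_a1 part_a2 part_b unfolding \<gamma>_def by blast
qed

end
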